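(* Let $\mathcal H$ be a real Hilbert space with a complex structure $J$, let $L_0\in\Lambda_J(\mathcal H)$, and let $S_0,S_1\in\mathcal U^{c,J}_{L_0}$. Then there exists a geodesic of the linear connection of $\mathcal U^{c,J}_{L_0}$ which joins them. The geodesic has minimal length (with respect to the Finsler metric induced by the operator norm). If $\|\epsilon_{S_0}-\epsilon_{S_1}\|<2$, the geodesic is unique. In any case, $\mathcal U^{c,J}_{L_0}$ is geodesically convex, in the sense that if $S_0,S_1\in\mathcal U^{c,J}_{L_0}$ and $\gamma$ is a geodesic of the connection joining them, then $\gamma\subset\mathcal U^{c,J}_{L_0}$.
   Context: $\mathcal H$ is a real Hilbert space; $J$ is an isometric operator on $\mathcal H$ with $J^*=-J$ and $J^2=-I$. A closed subspace $L$ is Lagrangian if $J(L)=L^\perp$; a closed subspace $S$ is identified with the symmetry $\epsilon_S=2p_S-I$ ($p_S$ the orthogonal projection onto $S$), and $\Lambda_J(\mathcal H)=\{\epsilon\in\mathcal B(\mathcal H):\epsilon^*=\epsilon=\epsilon^{-1},\ \epsilon J=-J\epsilon\}$ is the set of Lagrangian subspaces. $U(\mathcal H_J)$ is the group of orthogonal operators on $\mathcal H$ commuting with $J$, and $U_c(\mathcal H_J)=\{u\in U(\mathcal H_J):u-I\text{ is compact}\}$. The orbit is $\mathcal U^{c,J}_{L_0}=\{u(L_0):u\in U_c(\mathcal H_J)\}$ (in terms of symmetries, $\{u\epsilon_{L_0}u^*:u\in U_c(\mathcal H_J)\}$), whose tangent space at $L$ consists of the compact symmetric operators anti-commuting with both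 $\epsilon_L$ and $J$. The linear connection on $\Lambda_J(\mathcal H)$ is $\frac{D}{dt}X=\Pi_{\gamma(t)}(\dot X(t))$ for a tangent field $X$ along a curve $\gamma$, with $\Pi_\epsilon(a)=\frac12(a-\epsilon a\epsilon)$; it restricts to $\mathcal U^{c,J}_{L_0}$. Its geodesics in $\Lambda_J(\mathcal H)$ starting at $\epsilon$ are $e^{2tz}\epsilon$ with $z\in\mathcal B(\mathcal H)$, $z^*=-z$, $z\epsilon=-\epsilon z$, $zJ=Jz$. The length of a curve $\gamma$ is $L(\gamma)=\int\|\dot\gamma(t)\|\,dt$ with the operator norm.
   Formalization: Uniqueness is claimed only among length-minimising geodesics, and convexity only for geodesics that are length-minimising in the Lagrangian Grassmannian or have initial velocity tangent to the orbit; for arbitrary geodesics both claims fail (e.g. z = πJ, S_0 = S_1). *)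

theory Defs
  imports "HOL-Analysis.Analysis"
begin

section \<open>Operators on a real Hilbert space\<close>

text \<open>
  A real Hilbert space is a type of sort \<open>{real_inner, complete_space}\<close>, and
  \<open>'h \<Rightarrow>\<^sub>L 'h\<close> is the algebra of bounded operators with the operator norm.
\<close>

type_synonym 'h op = "'h \<Rightarrow>\<^sub>L 'h"

text \<open>\<open>is_adjoint A B\<close> says \<open>B = A\<^sup>*\<close>.\<close>

definition is_adjoint :: "'h::real_inner op \<Rightarrow> 'h op \<Rightarrow> bool" where
  "is_adjoint A B \<longleftrightarrow> (\<forall>x y. blinfun_apply A x \<bullet> y = x \<bullet> blinfun_apply B y)"

definition compact_operator :: "'h::real_inner op \<Rightarrow> bool" where
  "compact_operator A \<longleftrightarrow> compact (closure (blinfun_apply A ` cball 0 1))"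

text \<open>In infinite dimension an isometry need not be onto, so surjectivity is part of orthogonality.\<close>

definition orthogonal_operator :: "'h::real_inner op \<Rightarrow> bool" where
  "orthogonal_operator u \<longleftrightarrow>
     orthogonal_transformation (blinfun_apply u) \<and> surj (blinfun_apply u)"

definition orthogonal_projection :: "'h::{real_inner,complete_space} set \<Rightarrow> 'h op" where
  "orthogonal_projection S =
     (THE p. \<forall>x. blinfun_apply p x \<in> S \<and> x - blinfun_apply p x \<in> orthogonal_comp S)"

definition symmetry :: "'h::{real_inner,complete_space} set \<Rightarrow> 'h op" where
  "symmetry S = 2 *\<^sub>R orthogonal_projection S - id_blinfun"


section \<open>Lagrangian subspaces and the compact orbit\<close>

definition complex_structure :: "'h::real_inner op \<Rightarrow> bool" where
  "complex_structure J \<longleftrightarrow>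
     (\<forall>x. norm (blinfun_apply J x) = norm x) \<and> is_adjoint J (- J) \<and> J o\<^sub>L J = - id_blinfun"

definition lagrangian :: "'h::real_inner op \<Rightarrow> 'h set \<Rightarrow> bool" where
  "lagrangian J L \<longleftrightarrow> closed L \<and> subspace L \<and> blinfun_apply J ` L = orthogonal_comp L"

text \<open>\<open>\<Lambda>\<^sub>J(H)\<close>, each Lagrangian subspace being represented by its symmetry.\<close>

definition lagrangian_symmetries :: "'h::real_inner op \<Rightarrow> 'h op set" where
  "lagrangian_symmetries J =
     {e. is_adjoint e e \<and> e o\<^sub>L e = id_blinfun \<and> e o\<^sub>L J = - (J o\<^sub>L e)}"

definition unitary_group :: "'h::real_inner op \<Rightarrow> 'h op set" where
  "unitary_group J = {u. orthogonal_operator u \<and> u o\<^sub>L J = J o\<^sub>L u}"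

definition compact_unitary_group :: "'h::real_inner op \<Rightarrow> 'h op set" where
  "compact_unitary_group J = {u \<in> unitary_group J. compact_operator (u - id_blinfun)}"

definition compact_orbit :: "'h::real_inner op \<Rightarrow> 'h set \<Rightarrow> 'h set set" where
  "compact_orbit J L\<^sub>0 = {blinfun_apply u ` L\<^sub>0 |u. u \<in> compact_unitary_group J}"

text \<open>The tangent space of a compact orbit at the point with symmetry \<open>e\<close>.\<close>

definition orbit_tangent_space :: "'h::real_inner op \<Rightarrow> 'h op \<Rightarrow> 'h op set" where
  "orbit_tangent_space J e =
     {x. compact_operator x \<and> is_adjoint x x \<and> x o\<^sub>L e = - (e o\<^sub>L x) \<and> x o\<^sub>L J = - (J o\<^sub>L x)}"


section \<open>The linear connection, geodesics and length\<close>

text \<open>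
  Curves are functions \<open>real \<Rightarrow> 'h op\<close> of which only the restriction to \<open>{0..1}\<close> matters;
  derivatives are norm derivatives within \<open>{0..1}\<close>, hence one-sided at the end points.
\<close>

definition connection_projection :: "'h::real_inner op \<Rightarrow> 'h op \<Rightarrow> 'h op" where
  "connection_projection e a = (1/2) *\<^sub>R (a - (e o\<^sub>L a o\<^sub>L e))"

definition velocity :: "(real \<Rightarrow> 'h::real_inner op) \<Rightarrow> real \<Rightarrow> 'h op" where
  "velocity \<gamma> t = vector_derivative \<gamma> (at t within {0..1})"

definition covariant_derivative ::
    "(real \<Rightarrow> 'h::real_inner op) \<Rightarrow> (real \<Rightarrow> 'h op) \<Rightarrow> real \<Rightarrow> 'h op" where
  "covariant_derivative \<gamma> X t =
     connection_projection (\<gamma> t) (vector_derivative X (at t within {0..1}))"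

text \<open>
  Continuity of the second derivative is not demanded: for a curve of symmetries the equation
  \<open>D\<gamma>'/dt = 0\<close> reads \<open>\<gamma>'' = - \<gamma> \<gamma>'\<^sup>2\<close>.
\<close>

definition geodesic :: "'h::real_inner op set \<Rightarrow> (real \<Rightarrow> 'h op) \<Rightarrow> bool" where
  "geodesic M \<gamma> \<longleftrightarrow>
     \<gamma> ` {0..1} \<subseteq> M \<and>
     \<gamma> differentiable_on {0..1} \<and> velocity \<gamma> differentiable_on {0..1} \<and>
     (\<forall>t\<in>{0..1}. covariant_derivative \<gamma> (velocity \<gamma>) t = 0)"

definition joins :: "(real \<Rightarrow> 'h::real_inner op) \<Rightarrow> 'h op \<Rightarrow> 'h op \<Rightarrow> bool" where
  "joins \<gamma> p q \<longleftrightarrow> \<gamma> 0 = p \<and> \<gamma> 1 = q"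

definition curve_length :: "(real \<Rightarrow> 'h::real_inner op) \<Rightarrow> real" where
  "curve_length \<gamma> = integral {0..1} (\<lambda>t. norm (velocity \<gamma> t))"

text \<open>
  \<open>piecewise_C1_differentiable_on\<close> puts no bound on the derivative near the break points, and
  \<open>integral\<close> is \<open>0\<close> for a non-integrable speed; the last conjunct excludes such curves,
  whose length is infinite.
\<close>

definition finite_length_curve :: "'h::real_inner op set \<Rightarrow> (real \<Rightarrow> 'h op) \<Rightarrow> bool" where
  "finite_length_curve M \<gamma> \<longleftrightarrow>
     \<gamma> ` {0..1} \<subseteq> M \<and> \<gamma> piecewise_C1_differentiable_on {0..1} \<and>
     (\<lambda>t. norm (velocity \<gamma> t)) integrable_on {0..1}"

definition minimal_geodesic ::
    "'h::real_inner op set \<Rightarrow> 'h op \<Rightarrow> 'h op \<Rightarrow> (real \<Rightarrow> 'h op) \<Rightarrow> bool" where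
  "minimal_geodesic M p q \<gamma> \<longleftrightarrow>
     geodesic M \<gamma> \<and> joins \<gamma> p q \<and>
     (\<forall>\<delta>. finite_length_curve M \<delta> \<and> joins \<delta> p q \<longrightarrow> curve_length \<gamma> \<le> curve_length \<delta>)"

end

theory Submission
  imports Defs
begin

text \<open>
  Write \<open>\<epsilon>\<^sub>0, \<epsilon>\<^sub>1\<close> for the symmetries of \<open>S\<^sub>0, S\<^sub>1\<close>. The operator \<open>w = \<epsilon>\<^sub>1 \<epsilon>\<^sub>0\<close> is orthogonal, a compact
  perturbation of the identity, commutes with \<open>J\<close>, and is inverted by conjugation with \<open>\<epsilon>\<^sub>0\<close>. It has a
  compact skew logarithm \<open>X\<close> with \<open>norm X \<le> \<pi>\<close> and the same symmetries, and \<open>e\<^sup>t\<^sup>X \<epsilon>\<^sub>0\<close> is a geodesic of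
  length \<open>norm X\<close>. A curve of symmetries \<open>\<delta>\<close> from \<open>\<epsilon>\<^sub>0\<close> to \<open>\<epsilon>\<^sub>1\<close> moves \<open>\<delta>(t) x\<close> on a sphere, so its length
  bounds every angle between \<open>\<epsilon>\<^sub>0 x\<close> and \<open>\<epsilon>\<^sub>1 x\<close>; the supremum of these angles is \<open>norm X\<close>, whence
  minimality. Conversely every geodesic is \<open>e\<^sup>t\<^sup>X \<epsilon>\<^sub>0\<close> with \<open>X = \<gamma>'(0) \<gamma>(0)\<close>. Uniqueness is injectivity of the
  exponential on skew operators of norm below \<open>\<pi>\<close>, and convexity holds because a skew \<open>X\<close> with
  \<open>norm X \<le> \<pi>\<close> is compact as soon as \<open>e\<^sup>X - 1\<close> is.
\<close>

text \<open>No spectral calculus enters. Angles are carried by inequalities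
  \<open>cos \<theta> * (norm x)\<^sup>2 \<le> w x \<bullet> x\<close>, which say that an orthogonal
  \<open>w\<close> turns no vector by more than \<open>\<theta>\<close>. For
  \<open>\<theta> < pi\<close> a suitable square root halves the angle, and a curve of isometries of
  length at most \<open>pi\<close> produces such a bound. The square roots themselves come from
  contractions. The delicate value is \<pi>. On the eigenspace of \<open>w\<close> for
  \<open>-1\<close> the root construction degenerates, so this eigenspace is split off; there
  \<open>J\<close>, which anticommutes with the symmetries and squares to \<open>-1\<close>,
  supplies the logarithm. Beyond \<pi> unrestricted convexity fails: for
  \<open>X = (2 * pi) *\<^sub>R J\<close> the geodesic
  \<open>op_exp (t *\<^sub>R X) o\<^sub>L e\<close> is a loop through \<open>- e\<close>, and in
  infinite dimension \<open>- e - e\<close> is not compact. Hence convexity concerns geodesics that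
  are minimal or have a compact initial velocity.\<close>

section \<open>Algebra and completeness of bounded operators\<close>

interpretation blinfun_compose: bounded_bilinear "(o\<^sub>L)"
  by (rule bounded_bilinear_blinfun_compose)

lemmas blinfun_compose_linear_simps =
  blinfun_compose.add_left blinfun_compose.add_right
  blinfun_compose.diff_left blinfun_compose.diff_right
  blinfun_compose.minus_left blinfun_compose.minus_right
  blinfun_compose.scaleR_left blinfun_compose.scaleR_right

lemma blinfun_compose_assoc: "(a o\<^sub>L b) o\<^sub>L c = a o\<^sub>L (b o\<^sub>L c)"
  by (rule blinfun_eqI) simp

lemma blinfun_compose_id [simp]: "a o\<^sub>L id_blinfun = a" "id_blinfun o\<^sub>L a = a"
  by (rule blinfun_eqI, simp)+

lemmas op_ring = blinfun_compose_linear_simps blinfun_compose_assoc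

lemma norm_blinfun_compose_le:
  assumes "norm a \<le> r" "norm b \<le> s"
  shows "norm (a o\<^sub>L b) \<le> r * s"
proof -
  have "norm (a o\<^sub>L b) \<le> norm a * norm b" by (rule norm_blinfun_compose)
  also have "\<dots> \<le> r * s" using assms by (meson mult_mono norm_ge_zero order_trans)
  finally show ?thesis .
qed

text \<open>The sort \<open>{real_inner, complete_space}\<close> does not include
  \<open>banach\<close>, so completeness of the operator space is derived from that of the target:
  take the pointwise limit, then let \<open>m\<close> tend to infinity in the uniform Cauchy
  estimate.\<close>

lemma blinfun_Cauchy_convergent:
  fixes X :: "nat \<Rightarrow> 'a::real_normed_vector \<Rightarrow>\<^sub>L 'b::{real_normed_vector,complete_space}"
  assumes "Cauchy X"
  shows "convergent X"
proof -
  have "Cauchy (\<lambda>n. X n x)" for x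
    by (rule bounded_linear.Cauchy[OF blinfun.bounded_linear_left assms])
  then have "\<exists>l. (\<lambda>n. X n x) \<longlonglongrightarrow> l" for x
    using Cauchy_convergent_iff convergent_def by blast
  then obtain f where f: "\<And>x. (\<lambda>n. X n x) \<longlonglongrightarrow> f x" by metis
  obtain K where K: "\<And>n. norm (X n) \<le> K"
    using Cauchy_Bseq[OF assms] by (metis BseqE)
  have lin: "linear f"
  proof (rule linearI)
    fix x y c
    have "(\<lambda>n. X n (x + y)) \<longlonglongrightarrow> f x + f y"
      by (auto simp: blinfun.add_right intro: tendsto_add f)
    then show "f (x + y) = f x + f y" using f LIMSEQ_unique by blast
    have "(\<lambda>n. X n (c *\<^sub>R x)) \<longlonglongrightarrow> c *\<^sub>R f x"
      by (auto simp: blinfun.scaleR_right intro: tendsto_scaleR f)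
    then show "f (c *\<^sub>R x) = c *\<^sub>R f x" using f LIMSEQ_unique by blast
  qed
  have bnd: "norm (f x) \<le> norm x * K" for x
  proof (rule Lim_norm_ubound[OF sequentially_bot f])
    show "\<forall>\<^sub>F n in sequentially. norm (X n x) \<le> norm x * K"
    proof (intro always_eventually allI)
      fix n
      have "norm (X n x) \<le> norm (X n) * norm x" by (rule norm_blinfun)
      also have "\<dots> \<le> K * norm x" by (intro mult_right_mono K) simp
      finally show "norm (X n x) \<le> norm x * K" by (simp add: mult.commute)
    qed
  qed
  have bl: "bounded_linear f"
    using lin bnd by (auto intro!: bounded_linear_intro[of f K] simp: linear_add linear_scale)
  have "(\<lambda>n. X n) \<longlonglongrightarrow> Blinfun f"
  proof (rule LIMSEQ_I)
    fix e :: real assume "0 < e"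
    then obtain N where N: "\<And>m n. m \<ge> N \<Longrightarrow> n \<ge> N \<Longrightarrow> norm (X m - X n) < e / 2"
      using CauchyD[OF assms, of "e/2"] by auto
    have "norm (X n - Blinfun f) < e" if "n \<ge> N" for n
    proof -
      have "norm (X n - Blinfun f) \<le> e / 2"
      proof (rule norm_blinfun_bound)
        fix x
        have "(\<lambda>m. X n x - X m x) \<longlonglongrightarrow> X n x - f x"
          by (intro tendsto_intros f)
        then have "norm (X n x - f x) \<le> e / 2 * norm x"
        proof (rule Lim_norm_ubound[OF sequentially_bot])
          show "\<forall>\<^sub>F m in sequentially. norm (X n x - X m x) \<le> e / 2 * norm x"
            using eventually_ge_at_top[of N]
          proof eventually_elim
            case (elim m)
            have "norm ((X n - X m) x) \<le> norm (X n - X m) * norm x" by (rule norm_blinfun)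
            also have "\<dots> \<le> e / 2 * norm x"
              using N[OF that elim] by (intro mult_right_mono) auto
            finally show ?case by (simp add: blinfun.diff_left)
          qed
        qed
        then show "norm ((X n - Blinfun f) x) \<le> e / 2 * norm x"
          by (simp add: blinfun.diff_left bounded_linear_Blinfun_apply[OF bl])
      qed (use \<open>0 < e\<close> in simp)
      then show ?thesis using \<open>0 < e\<close> by simp
    qed
    then show "\<exists>N. \<forall>n\<ge>N. norm (X n - Blinfun f) < e" by blast
  qed
  then show ?thesis by (auto simp: convergent_def)
qed

lemma complete_closed_blinfun:
  fixes S :: "('a::real_normed_vector \<Rightarrow>\<^sub>L 'b::{real_normed_vector,complete_space}) set"
  assumes "closed S"
  shows "complete S"
  unfolding complete_def
  by (metis assms blinfun_Cauchy_convergent closed_sequentially convergent_def)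

section \<open>Adjoints\<close>

lemma is_adjointI: "(\<And>x y. blinfun_apply A x \<bullet> y = x \<bullet> blinfun_apply B y) \<Longrightarrow> is_adjoint A B"
  by (simp add: is_adjoint_def)

lemma is_adjointD: "is_adjoint A B \<Longrightarrow> A x \<bullet> y = x \<bullet> B y"
  by (simp add: is_adjoint_def)

lemma is_adjoint_sym: "is_adjoint A B \<Longrightarrow> is_adjoint B A"
  by (simp add: is_adjoint_def inner_commute)

lemma is_adjoint_id: "is_adjoint id_blinfun id_blinfun"
  by (simp add: is_adjoint_def)

lemma is_adjoint_add: "is_adjoint A A' \<Longrightarrow> is_adjoint B B' \<Longrightarrow> is_adjoint (A + B) (A' + B')"
  by (simp add: is_adjoint_def blinfun.bilinear_simps inner_simps)

lemma is_adjoint_diff: "is_adjoint A A' \<Longrightarrow> is_adjoint B B' \<Longrightarrow> is_adjoint (A - B) (A' - B')"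
  by (simp add: is_adjoint_def blinfun.bilinear_simps inner_simps)

lemma is_adjoint_minus: "is_adjoint A A' \<Longrightarrow> is_adjoint (- A) (- A')"
  by (simp add: is_adjoint_def blinfun.bilinear_simps inner_simps)

lemma is_adjoint_scaleR: "is_adjoint A A' \<Longrightarrow> is_adjoint (c *\<^sub>R A) (c *\<^sub>R A')"
  by (simp add: is_adjoint_def blinfun.bilinear_simps inner_simps)

lemma is_adjoint_compose: "is_adjoint A A' \<Longrightarrow> is_adjoint B B' \<Longrightarrow> is_adjoint (A o\<^sub>L B) (B' o\<^sub>L A')"
  by (simp add: is_adjoint_def)

lemmas is_adjoint_intros = is_adjoint_id is_adjoint_add is_adjoint_diff is_adjoint_minus
  is_adjoint_scaleR is_adjoint_compose

text \<open>Adjoints are exhibited as explicit candidates. Uniqueness turns two candidates for one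
  operator into an identity, which is how commutation with projections is obtained later.\<close>

lemma is_adjoint_unique:
  assumes "is_adjoint A B" "is_adjoint A C"
  shows "B = C"
proof (rule blinfun_eqI)
  fix y
  have "x \<bullet> (B y - C y) = 0" for x
    using is_adjointD[OF assms(1), of x y] is_adjointD[OF assms(2), of x y]
    by (simp add: inner_diff_right)
  from this[of "B y - C y"] show "B y = C y" by simp
qed

lemma is_adjoint_tendsto:
  assumes "\<And>n::nat. is_adjoint (A n) (B n)" "A \<longlonglongrightarrow> a" "B \<longlonglongrightarrow> b"
  shows "is_adjoint a b"
proof (rule is_adjointI)
  fix x y
  have "(\<lambda>n. A n x \<bullet> y) \<longlonglongrightarrow> a x \<bullet> y" "(\<lambda>n. x \<bullet> B n y) \<longlonglongrightarrow> x \<bullet> b y"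
    using assms(2,3) by (auto intro!: tendsto_intros)
  moreover have "(\<lambda>n. A n x \<bullet> y) = (\<lambda>n. x \<bullet> B n y)"
    using assms(1) by (simp add: is_adjoint_def)
  ultimately show "a x \<bullet> y = x \<bullet> b y" using LIMSEQ_unique by metis
qed

lemma isometry_norm:
  assumes "is_adjoint u u'" "u' o\<^sub>L u = id_blinfun"
  shows "norm (u x) = norm x"
proof -
  have "u x \<bullet> u x = x \<bullet> (u' o\<^sub>L u) x" using assms(1) by (simp add: is_adjoint_def)
  then show ?thesis using assms(2) by (simp add: norm_eq_sqrt_inner)
qed

lemma isometry_norm_le:
  assumes "is_adjoint u u'" "u' o\<^sub>L u = id_blinfun"
  shows "norm u \<le> 1"
  by (rule norm_blinfun_bound) (simp_all add: isometry_norm[OF assms])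

section \<open>Compact operators\<close>

lemma compact_operatorI:
  assumes "compact C" "blinfun_apply A ` cball 0 1 \<subseteq> C"
  shows "compact_operator A"
proof -
  have "closure (blinfun_apply A ` cball 0 1) \<subseteq> C"
    using assms by (simp add: closure_minimal compact_imp_closed)
  then have "compact (C \<inter> closure (blinfun_apply A ` cball 0 1))"
    "C \<inter> closure (blinfun_apply A ` cball 0 1) = closure (blinfun_apply A ` cball 0 1)"
    using assms(1) by (auto intro: compact_Int_closed)
  then show ?thesis unfolding compact_operator_def by simp
qed

lemma compact_operatorE:
  assumes "compact_operator A"
  obtains C where "compact C" "\<And>x. norm x \<le> 1 \<Longrightarrow> A x \<in> C"
  using assms unfolding compact_operator_def
  by (metis closure_subset imageI in_mono mem_cball_0)

lemma compact_operator_add: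
  assumes "compact_operator A" "compact_operator B"
  shows "compact_operator (A + B)"
proof -
  obtain C where C: "compact C" "\<And>x. norm x \<le> 1 \<Longrightarrow> A x \<in> C" using assms compact_operatorE by blast
  obtain D where D: "compact D" "\<And>x. norm x \<le> 1 \<Longrightarrow> B x \<in> D" using assms compact_operatorE by blast
  show ?thesis
  proof (rule compact_operatorI[OF compact_sums[OF C(1) D(1)]], rule image_subsetI)
    fix x :: 'a assume "x \<in> cball 0 1"
    then have "A x \<in> C" "B x \<in> D" using C(2) D(2) by auto
    then show "(A + B) x \<in> {x + y |x y. x \<in> C \<and> y \<in> D}" by (auto simp: blinfun.add_left)
  qed
qed

lemma compact_operator_compose_left:
  assumes "compact_operator A"
  shows "compact_operator (B o\<^sub>L A)"
proof -
  obtain C where C: "compact C" "\<And>x. norm x \<le> 1 \<Longrightarrow> A x \<in> C" using assms compact_operatorE by blast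
  have "compact (blinfun_apply B ` C)"
    by (intro compact_continuous_image C(1) linear_continuous_on blinfun.bounded_linear_right)
  then show ?thesis by (rule compact_operatorI) (use C(2) in auto)
qed

lemma compact_operator_scaleR:
  assumes "compact_operator A"
  shows "compact_operator (c *\<^sub>R A)"
  using compact_operator_compose_left[OF assms, of "c *\<^sub>R id_blinfun"]
  by (simp add: blinfun_compose_linear_simps)

lemma compact_operator_minus:
  assumes "compact_operator A"
  shows "compact_operator (- A)"
  using compact_operator_scaleR[OF assms, of "-1"] by simp

lemma compact_operator_diff:
  "compact_operator A \<Longrightarrow> compact_operator B \<Longrightarrow> compact_operator (A - B)"
  using compact_operator_add[OF _ compact_operator_minus, of A B] by simp

lemma compact_operator_compose_right:
  fixes A B :: "'h::real_inner op"
  assumes "compact_operator A"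
  shows "compact_operator (A o\<^sub>L B)"
proof -
  obtain C where C: "compact C" "\<And>x. norm x \<le> 1 \<Longrightarrow> A x \<in> C" using assms compact_operatorE by blast
  define r where "r = norm B + 1"
  have r: "r > 0" by (simp add: r_def add_nonneg_pos)
  show ?thesis
  proof (rule compact_operatorI[OF compact_scaling[OF C(1), of r]], clarsimp)
    fix x :: 'h assume x: "norm x \<le> 1"
    have "norm (B x) \<le> r * 1"
      using mult_mono[of "norm B" r "norm x" 1] norm_blinfun[of B x] x by (simp add: r_def)
    then have "A ((1 / r) *\<^sub>R B x) \<in> C" using r by (intro C(2)) (simp add: field_simps)
    moreover have "A (B x) = r *\<^sub>R A ((1 / r) *\<^sub>R B x)" using r by (simp add: blinfun.scaleR_right)
    ultimately show "A (B x) \<in> (*\<^sub>R) r ` C" by blast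
  qed
qed

lemma compact_operator_zero: "compact_operator 0"
  by (rule compact_operatorI[of "{0}"]) auto

lemma closed_compact_operators:
  "closed {A :: 'h::{real_inner,complete_space} op. compact_operator A}"
proof (unfold closed_sequential_limits, intro allI impI, elim conjE)
  fix X :: "nat \<Rightarrow> 'h op" and A
  assume X: "\<forall>n. X n \<in> {A. compact_operator A}" "X \<longlonglongrightarrow> A"
  let ?S = "closure (blinfun_apply A ` cball 0 1)"
  have "\<exists>k. finite k \<and> ?S \<subseteq> (\<Union>x\<in>k. ball x e)" if "e > 0" for e
  proof -
    obtain n where n: "norm (X n - A) < e / 4"
      using LIMSEQ_D[OF X(2), of "e/4"] \<open>e > 0\<close> by auto
    obtain C where C: "compact C" "\<And>x. norm x \<le> 1 \<Longrightarrow> X n x \<in> C"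
      using X(1) compact_operatorE by blast
    obtain k where k: "finite k" "C \<subseteq> (\<Union>x\<in>k. ball x (e/4))"
      using C(1) \<open>e > 0\<close> unfolding compact_eq_totally_bounded by (meson divide_pos_pos zero_less_numeral)
    \<comment> \<open>Closed balls: their finite union is closed and therefore also covers the
      closure of the image. The radius \<open>e/2\<close> is the net of \<open>X n\<close> plus the
      error of \<open>X n\<close>, each below \<open>e/4\<close>.\<close>
    have sub: "blinfun_apply A ` cball 0 1 \<subseteq> (\<Union>x\<in>k. cball x (e/2))"
    proof clarsimp
      fix x :: 'h assume x: "norm x \<le> 1"
      obtain y where y: "y \<in> k" "dist y (X n x) < e / 4" using C(2)[OF x] k(2) by auto
      have "norm ((X n - A) x) \<le> norm (X n - A) * norm x" by (rule norm_blinfun)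
      also have "\<dots> \<le> norm (X n - A) * 1" using x by (intro mult_left_mono) auto
      finally have "norm (X n x - A x) < e / 4" using n by (simp add: blinfun.diff_left)
      then have "dist y (A x) \<le> e / 2"
        using y(2) dist_triangle[of y "A x" "X n x"] by (simp add: dist_norm)
      then show "\<exists>y\<in>k. dist y (A x) * 2 \<le> e" using y(1) by auto
    qed
    have "closed (\<Union>x\<in>k. cball x (e/2))" using k(1) by blast
    then have "?S \<subseteq> (\<Union>x\<in>k. cball x (e/2))" using sub by (rule closure_minimal[rotated])
    also have "\<dots> \<subseteq> (\<Union>x\<in>k. ball x e)" using \<open>e > 0\<close> by force
    finally show ?thesis using k(1) by blast
  qed
  then show "A \<in> {A. compact_operator A}"
    by (simp add: compact_operator_def compact_eq_totally_bounded complete_eq_closed)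
qed

lemma compact_operator_tendsto:
  fixes X :: "nat \<Rightarrow> 'h::{real_inner,complete_space} op"
  assumes "\<And>n. compact_operator (X n)" "X \<longlonglongrightarrow> A"
  shows "compact_operator A"
  using closed_sequentially[OF closed_compact_operators, of X A] assms by simp

text \<open>Unit vectors \<open>x n\<close> with \<open>K (x n) + 2 *\<^sub>R x n\<close> tending to
  \<open>0\<close> converge along a subsequence, since \<open>K (x n)\<close> does, to a unit vector
  in the kernel. Later \<open>K = W - id_blinfun\<close>, so that \<open>W + id_blinfun\<close> is
  bounded below.\<close>

lemma compact_perturbation_bounded_below:
  fixes K :: "'h::{real_inner,complete_space} op"
  assumes "compact_operator K" and inj: "\<And>x. K x + 2 *\<^sub>R x = 0 \<Longrightarrow> x = 0"
  obtains c where "c > 0" "\<And>x. c * norm x \<le> norm (K x + 2 *\<^sub>R x)"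
proof -
  have "\<exists>c>0. \<forall>x. c * norm x \<le> norm (K x + 2 *\<^sub>R x)"
  proof (rule ccontr)
    assume neg: "\<not> ?thesis"
    have "\<exists>x. norm x = 1 \<and> norm (K x + 2 *\<^sub>R x) < 1 / real (Suc n)" for n
    proof -
      obtain x where x: "norm (K x + 2 *\<^sub>R x) < 1 / real (Suc n) * norm x"
        using neg by (metis linorder_not_le of_nat_0_less_iff zero_less_Suc zero_less_divide_1_iff)
      then have "x \<noteq> 0" by auto
      define c where "c = 1 / norm x"
      have c: "c > 0" "c * norm x = 1" using \<open>x \<noteq> 0\<close> by (simp_all add: c_def)
      have "K (c *\<^sub>R x) + 2 *\<^sub>R (c *\<^sub>R x) = c *\<^sub>R (K x + 2 *\<^sub>R x)"
        by (simp add: blinfun.scaleR_right scaleR_add_right mult.commute)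
      then have "norm (K (c *\<^sub>R x) + 2 *\<^sub>R (c *\<^sub>R x)) = c * norm (K x + 2 *\<^sub>R x)"
        using c(1) by simp
      also have "\<dots> < c * (1 / real (Suc n) * norm x)" using x c(1) by (rule mult_strict_left_mono)
      also have "\<dots> = 1 / real (Suc n)" using c(2) by (metis mult.commute mult.left_commute mult_1)
      finally have "norm (K (c *\<^sub>R x) + 2 *\<^sub>R (c *\<^sub>R x)) < 1 / real (Suc n)" .
      moreover have "norm (c *\<^sub>R x) = 1" using c by simp
      ultimately show ?thesis by blast
    qed
    then obtain x where x: "\<And>n. norm (x n) = 1" "\<And>n. norm (K (x n) + 2 *\<^sub>R x n) < 1 / real (Suc n)"
      by metis
    obtain C where C: "compact C" "\<And>x. norm x \<le> 1 \<Longrightarrow> K x \<in> C" using assms(1) compact_operatorE by blast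
    then have "\<forall>n. K (x n) \<in> C" using x(1) by simp
    then obtain l r where lr: "strict_mono (r :: nat \<Rightarrow> nat)" "((\<lambda>n. K (x n)) \<circ> r) \<longlonglongrightarrow> l"
      using C(1) unfolding compact_def by metis
    have z: "(\<lambda>n. K (x n) + 2 *\<^sub>R x n) \<longlonglongrightarrow> 0"
      by (rule LIMSEQ_norm_0) (use x(2) in auto)
    then have "((\<lambda>n. K (x n) + 2 *\<^sub>R x n) \<circ> r) \<longlonglongrightarrow> 0" using lr(1) LIMSEQ_subseq_LIMSEQ by blast
    from tendsto_scaleR[OF tendsto_const[of "1/2"] tendsto_diff[OF this lr(2)]]
    have lim: "(\<lambda>n. x (r n)) \<longlonglongrightarrow> - (1/2) *\<^sub>R l" by (simp add: o_def)
    then have "(\<lambda>n. K (x (r n)) + 2 *\<^sub>R x (r n)) \<longlonglongrightarrow> K (- (1/2) *\<^sub>R l) + 2 *\<^sub>R (- (1/2) *\<^sub>R l)"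
      by (intro tendsto_intros)
    moreover have "(\<lambda>n. K (x (r n)) + 2 *\<^sub>R x (r n)) \<longlonglongrightarrow> 0"
      using z lr(1) LIMSEQ_subseq_LIMSEQ[of _ 0 r] by (force simp: o_def)
    ultimately have "- (1/2) *\<^sub>R l = 0" using inj LIMSEQ_unique by blast
    moreover have "norm (- (1/2) *\<^sub>R l) = 1"
      using tendsto_norm[OF lim] x(1) by (simp add: LIMSEQ_const_iff)
    ultimately show False by simp
  qed
  then show ?thesis using that by blast
qed

section \<open>Orthogonal projections\<close>

lemma nearest_point_in_subspace:
  fixes N :: "'h::{real_inner,complete_space} set"
  assumes "closed N" "subspace N"
  obtains y where "y \<in> N" "\<And>z. z \<in> N \<Longrightarrow> norm (x - y) \<le> norm (x - z)"
proof -
  define d where "d = infdist x N"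
  have ne: "N \<noteq> {}" using assms(2) subspace_0 by blast
  have d: "d \<le> norm (x - z)" if "z \<in> N" for z
    using infdist_le[OF that, of x] by (simp add: d_def dist_norm)
  have "0 \<le> d" by (simp add: d_def infdist_nonneg)
  have "\<exists>y\<in>N. (norm (x - y))\<^sup>2 < d\<^sup>2 + 1 / real (Suc n)" for n
  proof -
    have "d < sqrt (d\<^sup>2 + 1 / real (Suc n))"
      by (rule real_less_rsqrt) simp
    then have "(INF a\<in>N. dist x a) < sqrt (d\<^sup>2 + 1 / real (Suc n))"
      using ne by (simp add: d_def infdist_def)
    then obtain y where y: "y \<in> N" "dist x y < sqrt (d\<^sup>2 + 1 / real (Suc n))"
      using ne by (subst (asm) cINF_less_iff) (auto intro: bdd_belowI2[of _ 0])
    then have "(norm (x - y))\<^sup>2 < (sqrt (d\<^sup>2 + 1 / real (Suc n)))\<^sup>2"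
      by (intro power_strict_mono) (auto simp: dist_norm)
    then show ?thesis using y(1) by (intro bexI[of _ y]) simp_all
  qed
  then obtain y where yN: "\<And>n. y n \<in> N" and y: "\<And>n. (norm (x - y n))\<^sup>2 < d\<^sup>2 + 1 / real (Suc n)"
    by metis
  \<comment> \<open>Parallelogram law: the midpoint of \<open>y m\<close> and \<open>y n\<close>
    lies in \<open>N\<close>, so its distance from \<open>x\<close> is at least
    \<open>d\<close>.\<close>
  have par: "(norm (y m - y n))\<^sup>2 \<le> 2 / real (Suc m) + 2 / real (Suc n)" for m n
  proof -
    let ?z = "(1/2) *\<^sub>R (y m + y n)"
    have "?z \<in> N" using assms(2) yN by (intro subspace_scale subspace_add) auto
    then have "d\<^sup>2 \<le> (norm (x - ?z))\<^sup>2" using d \<open>0 \<le> d\<close> by (intro power_mono) auto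
    moreover have "(norm (y m - y n))\<^sup>2 = 2 * (norm (x - y m))\<^sup>2 + 2 * (norm (x - y n))\<^sup>2 - 4 * (norm (x - ?z))\<^sup>2"
      by (simp add: power2_norm_eq_inner inner_simps inner_commute algebra_simps)
    ultimately show ?thesis using y[of m] y[of n] by simp
  qed
  have "Cauchy y"
  proof (rule CauchyI)
    fix e :: real assume "0 < e"
    obtain M :: nat where M: "4 / e\<^sup>2 < real M" using reals_Archimedean2 by blast
    have "norm (y m - y n) < e" if "m \<ge> M" "n \<ge> M" for m n
    proof -
      have "4 / e\<^sup>2 > 0" using \<open>0 < e\<close> by simp
      then have M0: "real M > 0" using M by linarith
      have "2 / real (Suc m) \<le> 2 / real M" "2 / real (Suc n) \<le> 2 / real M"
        using that M0 by (auto intro!: divide_left_mono)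
      then have "(norm (y m - y n))\<^sup>2 \<le> 4 / real M" using par[of m n] by simp
      also have "\<dots> < e\<^sup>2" using M M0 \<open>0 < e\<close> by (simp add: field_simps)
      finally show ?thesis using \<open>0 < e\<close> power2_less_imp_less less_imp_le by blast
    qed
    then show "\<exists>M. \<forall>m\<ge>M. \<forall>n\<ge>M. norm (y m - y n) < e" by blast
  qed
  then obtain l where l: "y \<longlonglongrightarrow> l" using Cauchy_convergent_iff convergent_def by blast
  have "l \<in> N" using closed_sequentially[OF assms(1) _ l] yN by blast
  have "(norm (x - l))\<^sup>2 \<le> d\<^sup>2 + 0"
  proof (rule LIMSEQ_le)
    show "(\<lambda>n. (norm (x - y n))\<^sup>2) \<longlonglongrightarrow> (norm (x - l))\<^sup>2" by (intro tendsto_intros l)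
    show "(\<lambda>n. d\<^sup>2 + 1 / real (Suc n)) \<longlonglongrightarrow> d\<^sup>2 + 0"
      by (intro tendsto_intros LIMSEQ_Suc[OF lim_1_over_n])
    show "\<exists>N. \<forall>n\<ge>N. (norm (x - y n))\<^sup>2 \<le> d\<^sup>2 + 1 / real (Suc n)" using y less_imp_le by blast
  qed
  then have "norm (x - l) \<le> d" using \<open>0 \<le> d\<close> power2_le_imp_le by auto
  then have "norm (x - l) \<le> norm (x - z)" if "z \<in> N" for z using d[OF that] by linarith
  then show ?thesis using that \<open>l \<in> N\<close> by blast
qed

lemma orthogonal_decomposition:
  fixes N :: "'h::{real_inner,complete_space} set"
  assumes "closed N" "subspace N"
  obtains y where "y \<in> N" "x - y \<in> orthogonal_comp N"
proof -
  obtain y where y: "y \<in> N" "\<And>z. z \<in> N \<Longrightarrow> norm (x - y) \<le> norm (x - z)"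
    using nearest_point_in_subspace[OF assms] by blast
  have "(x - y) \<bullet> z = 0" if "z \<in> N" for z
  proof (cases "z = 0")
    case False
    \<comment> \<open>The minimiser of \<open>norm (x - y - t *\<^sub>R z)\<close> over
      \<open>t\<close>. As \<open>t = 0\<close> is already optimal, the inner product must
      vanish.\<close>
    define t where "t = ((x - y) \<bullet> z) / (z \<bullet> z)"
    have zz: "z \<bullet> z > 0" using False by simp
    have "y + t *\<^sub>R z \<in> N" using assms(2) y(1) that by (simp add: subspace_add subspace_scale)
    from y(2)[OF this] have "(norm (x - y))\<^sup>2 \<le> (norm (x - y - t *\<^sub>R z))\<^sup>2"
      by (intro power_mono) (simp_all add: diff_diff_eq)
    also have "\<dots> = (norm (x - y))\<^sup>2 - 2 * t * ((x - y) \<bullet> z) + t * (t * (z \<bullet> z))"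
      by (simp add: power2_norm_eq_inner inner_simps inner_commute algebra_simps)
    also have "t * (z \<bullet> z) = (x - y) \<bullet> z" using zz by (simp add: t_def)
    finally have "t * ((x - y) \<bullet> z) \<le> 0" by simp
    then have "((x - y) \<bullet> z)\<^sup>2 \<le> 0" using zz by (simp add: t_def power2_eq_square divide_le_0_iff)
    then show ?thesis by simp
  qed simp
  then have "x - y \<in> orthogonal_comp N"
    by (simp add: orthogonal_comp_def orthogonal_def inner_commute)
  then show ?thesis using that y(1) by blast
qed

lemma orthogonal_compD:
  assumes "x \<in> orthogonal_comp N" "y \<in> N"
  shows "x \<bullet> y = 0"
proof -
  have "y \<bullet> x = 0" using assms by (simp add: orthogonal_comp_def orthogonal_def)
  then show ?thesis by (simp add: inner_commute)
qed

lemma orthogonal_decomposition_unique: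
  assumes "subspace N" "a \<in> N" "b \<in> N" "x - a \<in> orthogonal_comp N" "x - b \<in> orthogonal_comp N"
  shows "a = b"
proof -
  have ab: "a - b \<in> N" using assms by (simp add: subspace_diff)
  have "(x - b - (x - a)) \<bullet> (a - b) = 0"
    using orthogonal_compD[OF assms(4) ab] orthogonal_compD[OF assms(5) ab]
    by (simp only: inner_diff_left)
  then show ?thesis by simp
qed

lemma projection_exists:
  fixes N :: "'h::{real_inner,complete_space} set"
  assumes "closed N" "subspace N"
  obtains p :: "'h op" where "\<And>x. p x \<in> N" "\<And>x. x - p x \<in> orthogonal_comp N"
proof -
  have "\<exists>y. y \<in> N \<and> x - y \<in> orthogonal_comp N" for x
    using orthogonal_decomposition[OF assms, of x] by blast
  then obtain f where f: "\<And>x. f x \<in> N" "\<And>x. x - f x \<in> orthogonal_comp N" by metis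
  have "bounded_linear f"
  proof (rule bounded_linear_intro[of _ 1])
    fix x y :: 'h and c :: real
    have "(x - f x) + (y - f y) \<in> orthogonal_comp N"
      using f(2) subspace_orthogonal_comp subspace_add by blast
    then show "f (x + y) = f x + f y"
      using f assms(2) by (intro orthogonal_decomposition_unique[of N _ _ "x + y"])
        (auto simp: subspace_add algebra_simps)
    have "c *\<^sub>R (x - f x) \<in> orthogonal_comp N"
      using f(2) subspace_orthogonal_comp subspace_scale by blast
    then show "f (c *\<^sub>R x) = c *\<^sub>R f x"
      using f assms(2) by (intro orthogonal_decomposition_unique[of N _ _ "c *\<^sub>R x"])
        (auto simp: subspace_scale algebra_simps)
    have "(x - f x) \<bullet> f x = 0" using orthogonal_compD f by blast
    then have "(norm x)\<^sup>2 = (norm (f x))\<^sup>2 + (norm (x - f x))\<^sup>2"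
      by (simp add: power2_norm_eq_inner inner_simps inner_commute algebra_simps)
    then have "(norm (f x))\<^sup>2 \<le> (norm x)\<^sup>2" by simp
    then show "norm (f x) \<le> norm x * 1" by (simp add: abs_le_square_iff [symmetric])
  qed
  then show ?thesis using that[of "Blinfun f"] f by (simp add: bounded_linear_Blinfun_apply)
qed

lemma projection_selfadjoint:
  assumes "\<And>x. blinfun_apply p x \<in> N" "\<And>x. x - blinfun_apply p x \<in> orthogonal_comp N"
  shows "is_adjoint p p"
proof (rule is_adjointI)
  fix x y
  have "(x - p x) \<bullet> p y = 0" "(y - p y) \<bullet> p x = 0" using assms orthogonal_compD by blast+
  then have "x \<bullet> p y = p x \<bullet> p y" "y \<bullet> p x = p y \<bullet> p x" by (simp_all only: inner_diff_left right_minus_eq)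
  then show "p x \<bullet> y = x \<bullet> p y" by (simp only: inner_commute[of "p x" y] inner_commute[of "p y" "p x"])
qed

lemma projection_fixes:
  assumes "subspace N" "\<And>x. blinfun_apply p x \<in> N" "\<And>x. x - blinfun_apply p x \<in> orthogonal_comp N" "x \<in> N"
  shows "p x = x"
  using assms(2-4) subspace_0[OF subspace_orthogonal_comp[of N]]
  by (intro orthogonal_decomposition_unique[OF assms(1), of _ _ x]) auto

section \<open>Inverses and square roots\<close>

text \<open>The two one-sided inverses are fixed points of the contractions
  \<open>x \<mapsto> 1 + A x\<close> and \<open>x \<mapsto> 1 + x A\<close>; associativity
  identifies them.\<close>

lemma neumann_inverse:
  fixes A :: "'h::{real_inner,complete_space} op"
  assumes "norm A < 1"
  obtains Z where "Z o\<^sub>L (id_blinfun - A) = id_blinfun" "(id_blinfun - A) o\<^sub>L Z = id_blinfun"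
proof -
  have "\<exists>!x. x \<in> UNIV \<and> id_blinfun + (A o\<^sub>L x) = x"
  proof (rule Banach_fix[of _ "norm A"])
    show "complete (UNIV :: 'h op set)" by (simp add: complete_closed_blinfun)
    fix x y :: "'h op"
    have "dist (id_blinfun + (A o\<^sub>L x)) (id_blinfun + (A o\<^sub>L y)) = norm (A o\<^sub>L (x - y))"
      by (simp add: dist_norm blinfun_compose_linear_simps)
    then show "dist (id_blinfun + (A o\<^sub>L x)) (id_blinfun + (A o\<^sub>L y)) \<le> norm A * dist x y"
      by (simp add: dist_norm norm_blinfun_compose)
  qed (use assms in auto)
  then obtain Z where Z: "id_blinfun + (A o\<^sub>L Z) = Z" by blast
  have "\<exists>!x. x \<in> UNIV \<and> id_blinfun + (x o\<^sub>L A) = x"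
  proof (rule Banach_fix[of _ "norm A"])
    show "complete (UNIV :: 'h op set)" by (simp add: complete_closed_blinfun)
    fix x y :: "'h op"
    have "dist (id_blinfun + (x o\<^sub>L A)) (id_blinfun + (y o\<^sub>L A)) = norm ((x - y) o\<^sub>L A)"
      by (simp add: dist_norm blinfun_compose_linear_simps)
    then show "dist (id_blinfun + (x o\<^sub>L A)) (id_blinfun + (y o\<^sub>L A)) \<le> norm A * dist x y"
      using norm_blinfun_compose[of "x - y" A] by (simp add: dist_norm mult.commute)
  qed (use assms in auto)
  then obtain Y where Y: "id_blinfun + (Y o\<^sub>L A) = Y" by blast
  have 1: "(id_blinfun - A) o\<^sub>L Z = id_blinfun" and 2: "Y o\<^sub>L (id_blinfun - A) = id_blinfun"
    using Z Y by (simp_all add: blinfun_compose_linear_simps algebra_simps)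
  have "Y = Y o\<^sub>L ((id_blinfun - A) o\<^sub>L Z)" using 1 by simp
  also have "\<dots> = Z" using 2 by (simp flip: blinfun_compose_assoc)
  finally show ?thesis using that 1 2 by blast
qed

text \<open>With \<open>s = s'\<close> it transports commutation to inverses; with
  \<open>s = w'\<close> and \<open>s' = w\<close> it transports the twisted relation
  \<open>C w = w' C\<close>.\<close>

lemma inverse_intertwines:
  assumes "Z o\<^sub>L s = id_blinfun" "s' o\<^sub>L Z' = id_blinfun" "C o\<^sub>L s' = s o\<^sub>L C"
  shows "C o\<^sub>L Z' = Z o\<^sub>L C"
proof -
  have "C o\<^sub>L Z' = (Z o\<^sub>L s) o\<^sub>L C o\<^sub>L Z'" using assms(1) by simp
  also have "\<dots> = Z o\<^sub>L (C o\<^sub>L s') o\<^sub>L Z'" using assms(3) by (simp add: blinfun_compose_assoc)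
  also have "\<dots> = Z o\<^sub>L C" using assms(2) by (simp add: blinfun_compose_assoc)
  finally show ?thesis .
qed

text \<open>The root is \<open>1 - y\<close> with \<open>y\<close> the small fixed point of \<open>y \<mapsto> (T + y\<^sup>2)/2\<close>.\<close>

lemma square_root_exists:
  fixes T :: "'h::{real_inner,complete_space} op"
  assumes T: "is_adjoint T T" "compact_operator T" "norm T \<le> q" "0 \<le> q" "q < 1"
  obtains y where "(id_blinfun - y) o\<^sub>L (id_blinfun - y) = id_blinfun - T"
    "is_adjoint y y" "compact_operator y" "norm y \<le> 1 - sqrt (1 - q)"
    "\<And>C. C o\<^sub>L T = T o\<^sub>L C \<Longrightarrow> C o\<^sub>L y = y o\<^sub>L C"
proof -
  \<comment> \<open>The smaller root of \<open>r = (q + r\<^sup>2) / 2\<close>: the ball of radius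
    \<open>r\<close> is mapped into itself by \<open>F\<close>, and \<open>r < 1\<close> is also the
    contraction constant there.\<close>
  define r where "r = 1 - sqrt (1 - q)"
  have r: "0 \<le> r" "r < 1" "(1/2) * (q + r * r) = r"
    using assms(4,5) by (auto simp: r_def algebra_simps)
  \<comment> \<open>All properties wanted of the root are closed conditions preserved by
    \<open>F\<close>; putting them into the domain makes the fixed point inherit them.\<close>
  define S where "S = {y :: 'h op. norm y \<le> r \<and> is_adjoint y y \<and> compact_operator y \<and>
    (\<forall>C. C o\<^sub>L T = T o\<^sub>L C \<longrightarrow> C o\<^sub>L y = y o\<^sub>L C)}"
  define F where "F y = (1/2) *\<^sub>R (T + (y o\<^sub>L y))" for y :: "'h op"
  have "closed S"
  proof (unfold closed_sequential_limits, intro allI impI, elim conjE)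
    fix Y and y :: "'h op" assume Y: "\<forall>n. Y n \<in> S" "Y \<longlonglongrightarrow> y"
    have "norm y \<le> r"
      using Y by (intro Lim_norm_ubound[OF sequentially_bot Y(2)]) (auto simp: S_def)
    moreover have "is_adjoint y y" using is_adjoint_tendsto[of Y Y] Y by (auto simp: S_def)
    moreover have "compact_operator y" using compact_operator_tendsto[of Y] Y by (auto simp: S_def)
    moreover have "C o\<^sub>L y = y o\<^sub>L C" if "C o\<^sub>L T = T o\<^sub>L C" for C
    proof -
      have "(\<lambda>n. C o\<^sub>L Y n) \<longlonglongrightarrow> (C o\<^sub>L y)" "(\<lambda>n. Y n o\<^sub>L C) \<longlonglongrightarrow> (y o\<^sub>L C)"
        by (intro tendsto_intros Y(2))+
      moreover have "(\<lambda>n. C o\<^sub>L Y n) = (\<lambda>n. Y n o\<^sub>L C)" using Y(1) that by (simp add: S_def)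
      ultimately show ?thesis using LIMSEQ_unique by metis
    qed
    ultimately show "y \<in> S" by (simp add: S_def)
  qed
  moreover have "0 \<in> S"
    using r by (simp add: S_def is_adjoint_def compact_operator_zero)
  moreover have "F ` S \<subseteq> S"
  proof (rule image_subsetI)
    fix y assume y: "y \<in> S"
    have "norm (y o\<^sub>L y) \<le> r * r" using y by (intro norm_blinfun_compose_le) (auto simp: S_def)
    then have "norm (T + (y o\<^sub>L y)) \<le> q + r * r" using T(3) norm_triangle_mono by blast
    then have "norm (F y) \<le> (1/2) * (q + r * r)" by (simp add: F_def)
    then have "norm (F y) \<le> r" using r(3) by simp
    moreover have "is_adjoint (F y) (F y)"
      using y T(1) unfolding F_def S_def by (intro is_adjoint_intros) auto
    moreover have "compact_operator (F y)"
      using y T(2) unfolding F_def S_def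
      by (intro compact_operator_scaleR compact_operator_add compact_operator_compose_left) auto
    moreover have "C o\<^sub>L F y = F y o\<^sub>L C" if "C o\<^sub>L T = T o\<^sub>L C" for C
    proof -
      have *: "C o\<^sub>L y = y o\<^sub>L C" using y that by (simp add: S_def)
      then have "C o\<^sub>L (y o\<^sub>L y) = (y o\<^sub>L y) o\<^sub>L C" by (metis blinfun_compose_assoc)
      then show ?thesis using that by (simp add: F_def blinfun_compose_linear_simps)
    qed
    ultimately show "F y \<in> S" by (simp add: S_def)
  qed
  moreover have "dist (F y) (F z) \<le> r * dist y z" if "y \<in> S" "z \<in> S" for y z
  proof -
    have "F y - F z = (1/2) *\<^sub>R ((y o\<^sub>L (y - z)) + ((y - z) o\<^sub>L z))"
      by (simp add: F_def blinfun_compose_linear_simps algebra_simps)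
    moreover have "norm ((y o\<^sub>L (y - z)) + ((y - z) o\<^sub>L z)) \<le> r * norm (y - z) + norm (y - z) * r"
      using that by (intro norm_triangle_mono norm_blinfun_compose_le) (auto simp: S_def)
    ultimately show ?thesis by (simp add: dist_norm)
  qed
  ultimately have "\<exists>!y. y \<in> S \<and> F y = y"
    using r by (intro Banach_fix[of _ r]) (auto simp: complete_closed_blinfun)
  then obtain y where y: "y \<in> S" "F y = y" by blast
  have "y + y = T + (y o\<^sub>L y)"
    using y(2) by (simp add: F_def) (metis scaleR_half_double scaleR_right_distrib)
  then have "(id_blinfun - y) o\<^sub>L (id_blinfun - y) = id_blinfun - T"
    by (simp add: blinfun_compose_linear_simps algebra_simps)
  then show ?thesis using y(1) that by (simp add: S_def r_def)
qed

section \<open>The exponential of an operator\<close>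

text \<open>
  The library exponential needs a Banach algebra with a unit of norm \<open>1\<close>. The operators on a
  possibly trivial space do not form one, but their unitization \<open>\<real> \<oplus> B(H)\<close> does.
\<close>

declare [[typedef_overloaded]]

datatype ('h::real_inner) unitization =
  Unitization (scalar_part: real) (op_part: "'h op")

instantiation unitization :: ("{real_inner,complete_space}") real_normed_algebra_1
begin

definition "0 = Unitization 0 0"
definition "1 = Unitization 1 0"
definition "a + b = Unitization (scalar_part a + scalar_part b) (op_part a + op_part b)"
definition "a - b = Unitization (scalar_part a - scalar_part b) (op_part a - op_part b)"
definition "- a = Unitization (- scalar_part a) (- op_part a)"
definition "a * b = Unitization (scalar_part a * scalar_part b)
  (scalar_part a *\<^sub>R op_part b + scalar_part b *\<^sub>R op_part a + (op_part a o\<^sub>L op_part b))"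
definition "r *\<^sub>R a = Unitization (r * scalar_part a) (r *\<^sub>R op_part a)"
text \<open>The sum norm is submultiplicative and gives the unit norm \<open>1\<close> even over the
  trivial space.\<close>

definition "norm a = \<bar>scalar_part a\<bar> + norm (op_part a)"
definition "dist a b = norm (a - b :: 'a unitization)"
definition "sgn a = inverse (norm a) *\<^sub>R (a :: 'a unitization)"
definition [code del]:
  "(uniformity :: ('a unitization \<times> 'a unitization) filter) = (INF e\<in>{0 <..}. principal {(x, y). dist x y < e})"
definition [code del]:
  "open (U :: 'a unitization set) \<longleftrightarrow> (\<forall>x\<in>U. eventually (\<lambda>(x', y). x' = x \<longrightarrow> y \<in> U) uniformity)"

lemmas unitization_ops = zero_unitization_def one_unitization_def plus_unitization_def
  minus_unitization_def uminus_unitization_def times_unitization_def scaleR_unitization_def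

instance
proof
  fix a b c :: "'a unitization" and r s :: real
  show "a + b + c = a + (b + c)" by (simp add: unitization_ops)
  show "a + b = b + a" by (simp add: unitization_ops)
  show "0 + a = a" by (simp add: unitization_ops)
  show "- a + a = 0" by (simp add: unitization_ops)
  show "a - b = a + - b" by (simp add: unitization_ops)
  show "r *\<^sub>R (a + b) = r *\<^sub>R a + r *\<^sub>R b" by (simp add: unitization_ops algebra_simps)
  show "(r + s) *\<^sub>R a = r *\<^sub>R a + s *\<^sub>R a" by (simp add: unitization_ops algebra_simps)
  show "r *\<^sub>R s *\<^sub>R a = (r * s) *\<^sub>R a" by (simp add: unitization_ops)
  show "1 *\<^sub>R a = a" by (simp add: unitization_ops)
  show "a * b * c = a * (b * c)"
    by (simp add: unitization_ops op_ring algebra_simps)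
  show "(a + b) * c = a * c + b * c" "a * (b + c) = a * b + a * c"
    by (simp_all add: unitization_ops op_ring algebra_simps)
  show "r *\<^sub>R a * b = r *\<^sub>R (a * b)" "a * r *\<^sub>R b = r *\<^sub>R (a * b)"
    by (simp_all add: unitization_ops op_ring algebra_simps)
  show "1 * a = a" "a * 1 = a" "(0 :: 'a unitization) \<noteq> 1" by (simp_all add: unitization_ops)
  show "dist a b = norm (a - b)" by (simp add: dist_unitization_def)
  show "sgn a = inverse (norm a) *\<^sub>R a" by (simp add: sgn_unitization_def)
  show "(uniformity :: ('a unitization \<times> 'a unitization) filter) = (INF e\<in>{0 <..}. principal {(x, y). dist x y < e})"
    by (rule uniformity_unitization_def)
  show "open U \<longleftrightarrow> (\<forall>x\<in>U. eventually (\<lambda>(x', y). x' = x \<longrightarrow> y \<in> U) uniformity)"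
    for U :: "'a unitization set"
    by (rule open_unitization_def)
  show "(norm a = 0) = (a = 0)"
    by (cases a) (auto simp: norm_unitization_def unitization_ops add_nonneg_eq_0_iff)
  show "norm (a + b) \<le> norm a + norm b"
    using norm_triangle_ineq[of "op_part a" "op_part b"] abs_triangle_ineq[of "scalar_part a" "scalar_part b"]
    by (simp add: norm_unitization_def unitization_ops)
  show "norm (r *\<^sub>R a) = \<bar>r\<bar> * norm a"
    by (simp add: norm_unitization_def unitization_ops abs_mult algebra_simps)
  have "norm (scalar_part a *\<^sub>R op_part b + scalar_part b *\<^sub>R op_part a + (op_part a o\<^sub>L op_part b))
    \<le> \<bar>scalar_part a\<bar> * norm (op_part b) + \<bar>scalar_part b\<bar> * norm (op_part a) + norm (op_part a) * norm (op_part b)"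
    by (intro norm_triangle_mono norm_blinfun_compose) simp_all
  then show "norm (a * b) \<le> norm a * norm b"
    by (simp add: norm_unitization_def unitization_ops abs_mult algebra_simps)
  show "norm (1 :: 'a unitization) = 1" by (simp add: norm_unitization_def unitization_ops)
qed

end

lemma bounded_linear_scalar_part: "bounded_linear scalar_part"
  by (rule bounded_linear_intro[of _ 1]) (simp_all add: unitization_ops norm_unitization_def)

lemma bounded_linear_op_part: "bounded_linear op_part"
  by (rule bounded_linear_intro[of _ 1]) (simp_all add: unitization_ops norm_unitization_def)

instance unitization :: ("{real_inner,complete_space}") banach
proof
  fix X :: "nat \<Rightarrow> 'a unitization"
  assume X: "Cauchy X"
  obtain r where r: "(\<lambda>n. scalar_part (X n)) \<longlonglongrightarrow> r"
    using bounded_linear.Cauchy[OF bounded_linear_scalar_part X]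
    by (auto simp: Cauchy_convergent_iff convergent_def)
  obtain A where A: "(\<lambda>n. op_part (X n)) \<longlonglongrightarrow> A"
    using blinfun_Cauchy_convergent[OF bounded_linear.Cauchy[OF bounded_linear_op_part X]]
    by (auto simp: convergent_def)
  have "(\<lambda>n. \<bar>scalar_part (X n) - r\<bar> + norm (op_part (X n) - A)) \<longlonglongrightarrow> \<bar>r - r\<bar> + norm (A - A)"
    by (intro tendsto_intros r A)
  then have "(\<lambda>n. norm (X n - Unitization r A)) \<longlonglongrightarrow> 0"
    by (simp add: norm_unitization_def unitization_ops)
  then have "X \<longlonglongrightarrow> Unitization r A" using LIM_zero_iff tendsto_norm_zero_iff by blast
  then show "convergent X" by (auto simp: convergent_def)
qed

text \<open>The canonical homomorphism onto the operators. It is not injective, since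
  \<open>Unitization 1 0\<close> and \<open>Unitization 0 id_blinfun\<close> have the same image,
  but being bounded, linear and multiplicative it carries over the laws of
  \<open>exp\<close>.\<close>

definition op_of_unitization :: "'h::{real_inner,complete_space} unitization \<Rightarrow> 'h op" where
  "op_of_unitization a = scalar_part a *\<^sub>R id_blinfun + op_part a"

lemma bounded_linear_op_of_unitization: "bounded_linear op_of_unitization"
proof (rule bounded_linear_intro[of _ 1])
  fix a b :: "'a unitization" and r :: real
  show "op_of_unitization (a + b) = op_of_unitization a + op_of_unitization b"
    "op_of_unitization (r *\<^sub>R a) = r *\<^sub>R op_of_unitization a"
    by (simp_all add: op_of_unitization_def unitization_ops algebra_simps)
  have "norm (op_of_unitization a) \<le> \<bar>scalar_part a\<bar> * 1 + norm (op_part a)"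
    unfolding op_of_unitization_def
    by (intro norm_triangle_mono order_refl) (simp add: mult_left_le norm_blinfun_id_le)
  then show "norm (op_of_unitization a) \<le> norm a * 1" by (simp add: norm_unitization_def)
qed

lemma op_of_unitization_mult:
  "op_of_unitization (a * b) = (op_of_unitization a o\<^sub>L op_of_unitization b)"
  by (simp add: op_of_unitization_def unitization_ops op_ring algebra_simps)

lemma op_of_unitization_one: "op_of_unitization 1 = id_blinfun"
  by (simp add: op_of_unitization_def unitization_ops)

definition op_exp :: "'h::{real_inner,complete_space} op \<Rightarrow> 'h op" where
  "op_exp A = op_of_unitization (exp (Unitization 0 A))"

lemma Unitization_zero_scaleR: "Unitization 0 (t *\<^sub>R A) = t *\<^sub>R Unitization 0 A"
  by (simp add: unitization_ops)

lemma op_exp_zero [simp]: "op_exp 0 = id_blinfun"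
  using op_of_unitization_one by (simp add: op_exp_def flip: zero_unitization_def)

lemma op_exp_arg_commute: "op_exp A o\<^sub>L A = A o\<^sub>L op_exp A"
proof -
  have "op_of_unitization (exp (Unitization 0 A) * Unitization 0 A)
    = op_of_unitization (Unitization 0 A * exp (Unitization 0 A))"
    by (simp add: exp_times_arg_commute)
  then show ?thesis
    by (simp add: op_of_unitization_mult op_exp_def) (simp add: op_of_unitization_def)
qed

lemma op_exp_derivative:
  "((\<lambda>t. op_exp (t *\<^sub>R A)) has_vector_derivative (A o\<^sub>L op_exp (t *\<^sub>R A))) (at t within T)"
proof -
  have "((\<lambda>t. op_of_unitization (exp (t *\<^sub>R Unitization 0 A))) has_vector_derivative
     op_of_unitization (exp (t *\<^sub>R Unitization 0 A) * Unitization 0 A)) (at t within T)"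
    by (rule bounded_linear.has_vector_derivative[OF bounded_linear_op_of_unitization
          exp_scaleR_has_vector_derivative_right])
  moreover have "op_of_unitization (exp (t *\<^sub>R Unitization 0 A) * Unitization 0 A)
     = (A o\<^sub>L op_exp (t *\<^sub>R A))"
  proof -
    have "exp (t *\<^sub>R Unitization 0 A) * Unitization 0 A = Unitization 0 A * exp (t *\<^sub>R Unitization 0 A)"
      by (rule exp_times_scaleR_commute)
    then show ?thesis
      by (simp add: op_of_unitization_mult op_exp_def Unitization_zero_scaleR)
        (simp add: op_of_unitization_def)
  qed
  ultimately show ?thesis by (simp add: op_exp_def Unitization_zero_scaleR)
qed

lemma op_exp_add: "op_exp ((s + t) *\<^sub>R A) = (op_exp (s *\<^sub>R A) o\<^sub>L op_exp (t *\<^sub>R A))"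
proof -
  have "exp ((s + t) *\<^sub>R Unitization 0 A) = exp (s *\<^sub>R Unitization 0 A) * exp (t *\<^sub>R Unitization 0 A)"
    unfolding scaleR_add_left by (rule exp_add_commuting) simp
  then show ?thesis by (simp add: op_exp_def Unitization_zero_scaleR op_of_unitization_mult)
qed

lemma op_exp_half: "op_exp A = (op_exp ((1/2) *\<^sub>R A) o\<^sub>L op_exp ((1/2) *\<^sub>R A))"
  using op_exp_add[of "1/2" "1/2" A] by simp

lemma op_exp_minus:
  "op_exp (- A) o\<^sub>L op_exp A = id_blinfun" "op_exp A o\<^sub>L op_exp (- A) = id_blinfun"
  using op_exp_add[of "-1" 1 A] op_exp_add[of 1 "-1" A] by simp_all

text \<open>Integrating factor: \<open>op_exp (t *\<^sub>R (- A)) o\<^sub>L F t\<close> has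
  derivative zero. Intertwining relations, the flow form of geodesics and the explicit logarithm are
  all reduced to checking this linear equation.\<close>

lemma op_exp_ode_unique:
  fixes F :: "real \<Rightarrow> 'h::{real_inner,complete_space} op"
  assumes "\<And>t. t \<in> {0..1} \<Longrightarrow> (F has_vector_derivative (A o\<^sub>L F t)) (at t within {0..1})"
    and "t \<in> {0..1}"
  shows "F t = op_exp (t *\<^sub>R A) o\<^sub>L F 0"
proof -
  let ?G = "\<lambda>t. op_exp (t *\<^sub>R (- A)) o\<^sub>L F t"
  have "(?G has_vector_derivative 0) (at s within {0..1})" if "s \<in> {0..1}" for s
  proof -
    have "(?G has_vector_derivative ((op_exp (s *\<^sub>R (- A)) o\<^sub>L (A o\<^sub>L F s))
      + ((- A o\<^sub>L op_exp (s *\<^sub>R (- A))) o\<^sub>L F s))) (at s within {0..1})"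
      by (rule bounded_bilinear.has_vector_derivative[OF bounded_bilinear_blinfun_compose
            op_exp_derivative assms(1)[OF that]])
    \<comment> \<open>The known commutation is with the whole exponent
      \<open>s *\<^sub>R (- A)\<close>; the factor \<open>s\<close> is divided out, which leaves
      \<open>s = 0\<close> as a separate case.\<close>
    moreover have "op_exp (s *\<^sub>R (- A)) o\<^sub>L A = A o\<^sub>L op_exp (s *\<^sub>R (- A))"
    proof (cases "s = 0")
      case False
      then show ?thesis
        using op_exp_arg_commute[of "s *\<^sub>R (- A)"] by (simp add: blinfun_compose_linear_simps)
    qed simp
    ultimately show ?thesis
      by (simp add: blinfun_compose_linear_simps) (simp flip: blinfun_compose_assoc)
  qed
  then obtain c where c: "\<And>s. s \<in> {0..1} \<Longrightarrow> ?G s = c"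
    using has_vector_derivative_zero_constant[of "{0..1::real}" ?G] by auto
  have "op_exp (t *\<^sub>R A) o\<^sub>L ?G t = F t"
    using op_exp_minus(2)[of "t *\<^sub>R A"] by (simp flip: blinfun_compose_assoc)
  moreover have "?G t = F 0" using c[of t] c[of 0] assms(2) by simp
  ultimately show ?thesis by simp
qed

text \<open>With \<open>B = A\<close> this is commutation; with \<open>B = - A\<close> an operator
  that anticommutes with \<open>A\<close> carries \<open>op_exp A\<close> to
  \<open>op_exp (- A)\<close>. As functions of the time parameter both sides solve the equation with
  generator \<open>B\<close>.\<close>

lemma op_exp_intertwine:
  fixes A B C :: "'h::{real_inner,complete_space} op"
  assumes "C o\<^sub>L A = B o\<^sub>L C"
  shows "C o\<^sub>L op_exp A = op_exp B o\<^sub>L C"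
proof -
  have "C o\<^sub>L op_exp (1 *\<^sub>R A) = op_exp (1 *\<^sub>R B) o\<^sub>L (C o\<^sub>L op_exp (0 *\<^sub>R A))"
  proof (rule op_exp_ode_unique[of "\<lambda>t. C o\<^sub>L op_exp (t *\<^sub>R A)" B 1])
    fix t :: real
    have "((\<lambda>t. C o\<^sub>L op_exp (t *\<^sub>R A)) has_vector_derivative (C o\<^sub>L (A o\<^sub>L op_exp (t *\<^sub>R A)))) (at t within {0..1})"
      by (rule bounded_linear.has_vector_derivative[OF blinfun_compose.bounded_linear_right op_exp_derivative])
    then show "((\<lambda>t. C o\<^sub>L op_exp (t *\<^sub>R A)) has_vector_derivative (B o\<^sub>L (C o\<^sub>L op_exp (t *\<^sub>R A)))) (at t within {0..1})"
      using assms by (simp flip: blinfun_compose_assoc)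
  qed simp
  then show ?thesis by simp
qed

lemma op_exp_series:
  "(\<lambda>n. op_of_unitization (\<Sum>i<n. Unitization 0 A ^ i /\<^sub>R fact i)) \<longlonglongrightarrow> op_exp A"
  unfolding op_exp_def
  by (rule bounded_linear.tendsto[OF bounded_linear_op_of_unitization])
    (use exp_converges[of "Unitization 0 A"] in \<open>simp add: sums_def\<close>)

lemma op_of_unitization_Unitization: "op_of_unitization (Unitization 0 A) = A"
  by (simp add: op_of_unitization_def)

lemma op_exp_adjoint:
  assumes "is_adjoint A B"
  shows "is_adjoint (op_exp A) (op_exp B)"
proof (rule is_adjoint_tendsto[OF _ op_exp_series op_exp_series])
  interpret bounded_linear "op_of_unitization :: 'a unitization \<Rightarrow> _"
    by (rule bounded_linear_op_of_unitization)
  have p: "is_adjoint (op_of_unitization (Unitization 0 A ^ i)) (op_of_unitization (Unitization 0 B ^ i))" for i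
  proof (induction i)
    case (Suc i)
    have "op_of_unitization (Unitization 0 A ^ Suc i) = (A o\<^sub>L op_of_unitization (Unitization 0 A ^ i))"
      by (simp add: op_of_unitization_mult op_of_unitization_Unitization)
    moreover have "op_of_unitization (Unitization 0 B ^ Suc i) = (op_of_unitization (Unitization 0 B ^ i) o\<^sub>L B)"
      by (simp only: power_Suc2 op_of_unitization_mult op_of_unitization_Unitization)
    ultimately show ?case using Suc assms by (simp add: is_adjoint_compose)
  qed (simp add: op_of_unitization_one is_adjoint_id)
  show "is_adjoint (op_of_unitization (\<Sum>i<n. Unitization 0 A ^ i /\<^sub>R fact i))
    (op_of_unitization (\<Sum>i<n. Unitization 0 B ^ i /\<^sub>R fact i))" for n
    by (induction n) (simp_all add: add scaleR zero is_adjoint_add is_adjoint_scaleR p, simp add: is_adjoint_def)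
qed

lemma op_exp_compact:
  assumes "compact_operator A"
  shows "compact_operator (op_exp A - id_blinfun)"
proof -
  interpret bounded_linear "op_of_unitization :: 'a unitization \<Rightarrow> _"
    by (rule bounded_linear_op_of_unitization)
  have p: "compact_operator (op_of_unitization (Unitization 0 A ^ Suc i))" for i
    by (simp add: op_of_unitization_mult op_of_unitization_Unitization compact_operator_compose_right assms)
  \<comment> \<open>With \<open>Suc n\<close> terms the summand \<open>i = 0\<close> is always
    present and cancels \<open>id_blinfun\<close>; every later summand contains a factor
    \<open>A\<close>.\<close>
  have "compact_operator (op_of_unitization (\<Sum>i<Suc n. Unitization 0 A ^ i /\<^sub>R fact i) - id_blinfun)" for n
  proof (induction n)
    case 0
    then show ?case by (simp add: op_of_unitization_one compact_operator_zero)
  next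
    case (Suc n)
    have "op_of_unitization (\<Sum>i<Suc (Suc n). Unitization 0 A ^ i /\<^sub>R fact i) - id_blinfun
      = (op_of_unitization (\<Sum>i<Suc n. Unitization 0 A ^ i /\<^sub>R fact i) - id_blinfun)
       + (1 / fact (Suc n)) *\<^sub>R op_of_unitization (Unitization 0 A ^ Suc n)"
      unfolding sum.lessThan_Suc[of _ "Suc n"] add scaleR by (simp add: divide_inverse)
    then show ?case by (simp only:) (intro compact_operator_add compact_operator_scaleR Suc p)
  qed
  moreover have "(\<lambda>n. op_of_unitization (\<Sum>i<Suc n. Unitization 0 A ^ i /\<^sub>R fact i) - id_blinfun)
    \<longlonglongrightarrow> op_exp A - id_blinfun"
    by (intro tendsto_diff tendsto_const LIMSEQ_Suc[OF op_exp_series])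
  ultimately show ?thesis by (rule compact_operator_tendsto)
qed

text \<open>The iterated square roots of \<open>op_exp A\<close>, rescaled, recover
  \<open>A\<close>. Existence, injectivity and compactness of logarithms all pass through this
  limit.\<close>

lemma op_exp_derivative_at_zero:
  "(\<lambda>k. (2 ^ k) *\<^sub>R (op_exp ((1 / 2 ^ k) *\<^sub>R A) - id_blinfun)) \<longlonglongrightarrow> A"
proof -
  have "((\<lambda>t. op_exp (t *\<^sub>R A)) has_vector_derivative A) (at 0)"
    using op_exp_derivative[of A 0 UNIV] by simp
  then have lim: "((\<lambda>h. norm (op_exp (h *\<^sub>R A) - id_blinfun - h *\<^sub>R A) / norm h) \<longlongrightarrow> 0) (at (0::real))"
    by (simp add: has_vector_derivative_def has_derivative_at)
  have "(\<lambda>k. (1 / 2) ^ k :: real) \<longlonglongrightarrow> 0" by (rule LIMSEQ_power_zero) simp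
  then have "filterlim (\<lambda>k. 1 / 2 ^ k :: real) (at 0) sequentially"
    by (simp add: filterlim_at power_one_over)
  from filterlim_compose[OF lim this]
  have "(\<lambda>k. norm (op_exp ((1 / 2 ^ k) *\<^sub>R A) - id_blinfun - (1 / 2 ^ k) *\<^sub>R A) / norm (1 / 2 ^ k :: real)) \<longlonglongrightarrow> 0" .
  moreover have "norm (op_exp ((1 / 2 ^ k) *\<^sub>R A) - id_blinfun - (1 / 2 ^ k) *\<^sub>R A) / norm (1 / 2 ^ k :: real)
    = norm ((2 ^ k) *\<^sub>R (op_exp ((1 / 2 ^ k) *\<^sub>R A) - id_blinfun) - A)" for k
  proof -
    have "(2 ^ k) *\<^sub>R (op_exp ((1 / 2 ^ k) *\<^sub>R A) - id_blinfun) - A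
      = (2 ^ k) *\<^sub>R (op_exp ((1 / 2 ^ k) *\<^sub>R A) - id_blinfun - (1 / 2 ^ k) *\<^sub>R A)"
      by (simp add: scaleR_diff_right)
    then show ?thesis by (simp only: norm_scaleR) simp
  qed
  ultimately have "(\<lambda>k. norm ((2 ^ k) *\<^sub>R (op_exp ((1 / 2 ^ k) *\<^sub>R A) - id_blinfun) - A)) \<longlonglongrightarrow> 0"
    by simp
  then show ?thesis using LIM_zero_iff tendsto_norm_zero_iff by blast
qed

section \<open>Logarithms of orthogonal operators\<close>

text \<open>The second component, adjoint and inverse at once, is carried as a witness. It is also
  needed by name in relations such as \<open>C w = w' C\<close>.\<close>

definition orthogonal_pair :: "'h::real_inner op \<Rightarrow> 'h op \<Rightarrow> bool" where
  "orthogonal_pair w w' \<longleftrightarrow>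
     is_adjoint w w' \<and> w o\<^sub>L w' = id_blinfun \<and> w' o\<^sub>L w = id_blinfun"

lemma orthogonal_pair_sym: "orthogonal_pair w w' \<Longrightarrow> orthogonal_pair w' w"
  by (auto simp: orthogonal_pair_def is_adjoint_sym)

lemma orthogonal_pair_norm: "orthogonal_pair w w' \<Longrightarrow> norm (w x) = norm x"
  by (simp add: orthogonal_pair_def isometry_norm[of w w'])

lemma orthogonal_pair_norm_le: "orthogonal_pair w w' \<Longrightarrow> norm w \<le> 1"
  by (simp add: orthogonal_pair_def isometry_norm_le[of w w'])

lemma orthogonal_pair_skew_exp:
  fixes X :: "'h::{real_inner,complete_space} op"
  assumes "is_adjoint X (- X)"
  shows "orthogonal_pair (op_exp X) (op_exp (- X))"
  using op_exp_adjoint[OF assms] op_exp_minus[of X] by (simp add: orthogonal_pair_def)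

lemma orthogonal_pair_dist_sq:
  assumes "orthogonal_pair w w'"
  shows "(norm (w x - x))\<^sup>2 = 2 * (norm x)\<^sup>2 - 2 * (w x \<bullet> x)"
proof -
  have "(norm (w x - x))\<^sup>2 = (norm (w x))\<^sup>2 + (norm x)\<^sup>2 - 2 * (w x \<bullet> x)"
    by (simp add: power2_norm_eq_inner inner_simps inner_commute)
  then show ?thesis using orthogonal_pair_norm[OF assms, of x] by simp
qed

text \<open>From angle to chord: \<open>w x\<close> and \<open>x\<close> span an isosceles triangle
  with sides \<open>norm x\<close>, and \<open>norm (w x - x)\<close> is its base.\<close>

lemma orthogonal_pair_norm_diff_id:
  assumes "orthogonal_pair w w'" "\<And>x. a * (norm x)\<^sup>2 \<le> w x \<bullet> x" "2 - 2 * a \<le> b\<^sup>2" "0 \<le> b"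
  shows "norm (w - id_blinfun) \<le> b"
proof (rule norm_blinfun_bound[OF assms(4)])
  fix x
  have "(norm (w x - x))\<^sup>2 \<le> (2 - 2 * a) * (norm x)\<^sup>2"
    using orthogonal_pair_dist_sq[OF assms(1), of x] assms(2)[of x] by (simp add: algebra_simps)
  also have "\<dots> \<le> b\<^sup>2 * (norm x)\<^sup>2" using assms(3) by (intro mult_right_mono) simp_all
  also have "\<dots> = (b * norm x)\<^sup>2" by (simp add: power_mult_distrib)
  finally have "norm (w x - x) \<le> b * norm x"
    by (rule power2_le_imp_le) (simp add: assms(4))
  then show "norm ((w - id_blinfun) x) \<le> b * norm x" by (simp add: blinfun.diff_left)
qed

lemma orthogonal_pair_norm_inverse_diff_id:
  assumes "orthogonal_pair w w'"
  shows "norm (w' - id_blinfun) \<le> norm (w - id_blinfun)"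
proof -
  have "w' - id_blinfun = - ((w - id_blinfun) o\<^sub>L w')"
    using assms by (simp add: orthogonal_pair_def blinfun_compose_linear_simps)
  then have "norm (w' - id_blinfun) \<le> norm (w - id_blinfun) * norm w'"
    by (simp add: norm_blinfun_compose)
  also have "\<dots> \<le> norm (w - id_blinfun) * 1"
    using orthogonal_pair_norm_le[OF orthogonal_pair_sym[OF assms]] by (intro mult_left_mono) auto
  finally show ?thesis by simp
qed

lemma compose_swap: "a o\<^sub>L b = c o\<^sub>L d \<Longrightarrow> a o\<^sub>L (b o\<^sub>L e) = c o\<^sub>L (d o\<^sub>L e)"
  by (simp flip: blinfun_compose_assoc)

lemma compose_cancel: "a o\<^sub>L b = id_blinfun \<Longrightarrow> a o\<^sub>L (b o\<^sub>L e) = e"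
  by (simp flip: blinfun_compose_assoc)

text \<open>
  With \<open>s\<close> the positive root of \<open>(2 + w + w\<^sup>*)/4\<close>, the square root is \<open>v = \<onehalf>(1 + w) s\<^sup>-\<^sup>1\<close>,
  and \<open>s\<close> is the symmetric part of \<open>v\<close>.
\<close>

lemma orthogonal_square_root:
  fixes w w' :: "'h::{real_inner,complete_space} op"
  assumes w: "orthogonal_pair w w'" "compact_operator (w - id_blinfun)"
    and a: "-1 < a" "a \<le> 1" "\<And>x. a * (norm x)\<^sup>2 \<le> w x \<bullet> x"
  obtains v v' where "orthogonal_pair v v'" "compact_operator (v - id_blinfun)" "v o\<^sub>L v = w"
    "\<And>x. sqrt ((1 + a) / 2) * (norm x)\<^sup>2 \<le> v x \<bullet> x"
    "\<And>C. C o\<^sub>L w = w o\<^sub>L C \<Longrightarrow> C o\<^sub>L v = v o\<^sub>L C"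
    "\<And>C. C o\<^sub>L w = w' o\<^sub>L C \<Longrightarrow> C o\<^sub>L v = v' o\<^sub>L C"
proof -
  have adj: "is_adjoint w w'" and ww': "w o\<^sub>L w' = id_blinfun" and w'w: "w' o\<^sub>L w = id_blinfun"
    using w(1) by (auto simp: orthogonal_pair_def)
  define T where "T = (1/4) *\<^sub>R (2 *\<^sub>R id_blinfun - w - w')"
  \<comment> \<open>\<open>T\<close> is a quarter of \<open>(w' - 1) (w - 1)\<close>, and both
    factors have norm at most \<open>sqrt (2 - 2 * a)\<close>; so \<open>q\<close> bounds
    \<open>norm T\<close>. For \<open>a = cos \<theta>\<close> the number \<open>1 - q\<close> is
    \<open>(cos (\<theta> / 2))\<^sup>2\<close>.\<close>
  define q where "q = (1 - a) / 2"
  have q: "0 \<le> q" "q < 1" "1 - q = (1 + a) / 2" using a by (auto simp: q_def field_simps)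
  have T_eq: "T = (1/4) *\<^sub>R ((w' - id_blinfun) o\<^sub>L (w - id_blinfun))"
    using w'w by (simp add: T_def op_ring scaleR_2 algebra_simps)
  have "is_adjoint T ((1/4) *\<^sub>R (2 *\<^sub>R id_blinfun - w' - w))"
    unfolding T_def by (intro is_adjoint_intros adj is_adjoint_sym[OF adj])
  then have T1: "is_adjoint T T" by (simp add: T_def algebra_simps)
  have T2: "compact_operator T"
    unfolding T_eq by (intro compact_operator_scaleR compact_operator_compose_left w(2))
  have n1: "norm (w - id_blinfun) \<le> sqrt (2 - 2 * a)"
    using a by (intro orthogonal_pair_norm_diff_id[OF w(1) a(3)]) auto
  have n2: "norm (w' - id_blinfun) \<le> sqrt (2 - 2 * a)"
    using orthogonal_pair_norm_inverse_diff_id[OF w(1)] n1 by linarith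
  have "norm ((w' - id_blinfun) o\<^sub>L (w - id_blinfun)) \<le> sqrt (2 - 2 * a) * sqrt (2 - 2 * a)"
    using n1 n2 by (rule norm_blinfun_compose_le[rotated])
  then have T3: "norm T \<le> q" using a(2) by (simp add: T_eq q_def)
  obtain y where y: "(id_blinfun - y) o\<^sub>L (id_blinfun - y) = id_blinfun - T"
    "is_adjoint y y" "compact_operator y" "norm y \<le> 1 - sqrt (1 - q)"
    "\<And>C. C o\<^sub>L T = T o\<^sub>L C \<Longrightarrow> C o\<^sub>L y = y o\<^sub>L C"
    using square_root_exists[OF T1 T2 T3 q(1,2)] by blast
  define s where "s = id_blinfun - y"
  have "norm y < 1" using y(4) q(2) by (smt (verit) real_sqrt_gt_zero)
  then obtain z where z: "z o\<^sub>L s = id_blinfun" "s o\<^sub>L z = id_blinfun"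
    unfolding s_def using neumann_inverse by blast
  have ss: "s o\<^sub>L s = (1/4) *\<^sub>R (2 *\<^sub>R id_blinfun + w + w')"
  proof -
    have "s o\<^sub>L s = id_blinfun - T" using y(1) by (simp add: s_def)
    also have "\<dots> = (4/4) *\<^sub>R id_blinfun - T" by simp
    also have "\<dots> = (1/4) *\<^sub>R (2 *\<^sub>R id_blinfun + w + w')"
      unfolding T_def by (simp add: scaleR_diff_right scaleR_add_right flip: scaleR_add_left)
        (simp add: algebra_simps flip: scaleR_add_left)
    finally show ?thesis .
  qed
  have s_adj: "is_adjoint s s" unfolding s_def by (intro is_adjoint_intros y(2))
  have z_adj: "is_adjoint z z"
  proof (rule is_adjointI)
    fix x u
    have "z x \<bullet> u = z x \<bullet> (s o\<^sub>L z) u" using z(2) by simp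
    also have "\<dots> = (s o\<^sub>L z) x \<bullet> z u" using is_adjointD[OF s_adj, of "z x" "z u"] by simp
    finally show "z x \<bullet> u = x \<bullet> z u" using z(2) by simp
  qed
  have z_comm: "C o\<^sub>L z = z o\<^sub>L C" if "C o\<^sub>L T = T o\<^sub>L C" for C
  proof (rule inverse_intertwines[OF z(1) z(2)])
    show "C o\<^sub>L s = s o\<^sub>L C" using y(5)[OF that] by (simp add: s_def blinfun_compose_linear_simps)
  qed
  have zw: "w o\<^sub>L z = z o\<^sub>L w" and zw': "w' o\<^sub>L z = z o\<^sub>L w'"
    using ww' w'w by (intro z_comm; simp add: T_def op_ring)+
  have sz: "s o\<^sub>L (s o\<^sub>L (z o\<^sub>L z)) = id_blinfun"
    using z by (simp add: compose_cancel)
  define v where "v = (1/2) *\<^sub>R ((id_blinfun + w) o\<^sub>L z)"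
  define v' where "v' = (1/2) *\<^sub>R ((id_blinfun + w') o\<^sub>L z)"
  note swaps = zw[symmetric] compose_swap[OF zw[symmetric]] zw'[symmetric] compose_swap[OF zw'[symmetric]]
    compose_cancel[OF ww'] compose_cancel[OF w'w] ww' w'w
  have sum: "(2 *\<^sub>R id_blinfun + w + w') = 4 *\<^sub>R (s o\<^sub>L s)" by (simp add: ss)
  have "v o\<^sub>L v = (1/4) *\<^sub>R (w o\<^sub>L ((2 *\<^sub>R id_blinfun + w + w') o\<^sub>L (z o\<^sub>L z)))"
    by (simp add: v_def op_ring swaps scaleR_2 algebra_simps)
  also have "\<dots> = w" unfolding sum by (simp add: op_ring sz)
  finally have vv: "v o\<^sub>L v = w" .
  have "v o\<^sub>L v' = (1/4) *\<^sub>R ((2 *\<^sub>R id_blinfun + w + w') o\<^sub>L (z o\<^sub>L z))"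
    by (simp add: v_def v'_def op_ring swaps scaleR_2 algebra_simps)
  also have "\<dots> = id_blinfun" unfolding sum by (simp add: op_ring sz)
  finally have vv': "v o\<^sub>L v' = id_blinfun" .
  have "v' o\<^sub>L v = (1/4) *\<^sub>R ((2 *\<^sub>R id_blinfun + w + w') o\<^sub>L (z o\<^sub>L z))"
    by (simp add: v_def v'_def op_ring swaps scaleR_2 algebra_simps)
  also have "\<dots> = id_blinfun" unfolding sum by (simp add: op_ring sz)
  finally have v'v: "v' o\<^sub>L v = id_blinfun" .
  have "is_adjoint v ((1/2) *\<^sub>R (z o\<^sub>L (id_blinfun + w')))"
    unfolding v_def by (intro is_adjoint_intros z_adj adj)
  moreover have "(1/2) *\<^sub>R (z o\<^sub>L (id_blinfun + w')) = v'"
    using zw' by (simp add: v'_def blinfun_compose_linear_simps)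
  ultimately have v_adj: "is_adjoint v v'" by simp
  have pair: "orthogonal_pair v v'" using vv' v'v v_adj by (simp add: orthogonal_pair_def)
  \<comment> \<open>Writing the identity as \<open>s o\<^sub>L z\<close> displays
    \<open>v - id_blinfun\<close> as a product with a compact factor.\<close>
  have "v - id_blinfun = ((1/2) *\<^sub>R (w - id_blinfun) + y) o\<^sub>L z"
  proof -
    have "v - id_blinfun = v - (s o\<^sub>L z)" using z by simp
    also have "\<dots> = ((1/2) *\<^sub>R (id_blinfun + w) - s) o\<^sub>L z"
      by (simp add: v_def blinfun_compose_linear_simps)
    also have "(1/2) *\<^sub>R (id_blinfun + w) - s = (1/2) *\<^sub>R (w - id_blinfun) + y"
    proof -
      have "id_blinfun = (1/2) *\<^sub>R id_blinfun + (1/2) *\<^sub>R (id_blinfun :: 'h op)"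
        by (simp flip: scaleR_add_left)
      then show ?thesis by (simp add: s_def scaleR_diff_right scaleR_add_right algebra_simps)
    qed
    finally show ?thesis .
  qed
  then have comp: "compact_operator (v - id_blinfun)"
    by (auto intro!: compact_operator_compose_right compact_operator_add compact_operator_scaleR w(2) y(3))
  have vs: "v + v' = 2 *\<^sub>R s"
  proof -
    have "v + v' = (1/2) *\<^sub>R ((2 *\<^sub>R id_blinfun + w + w') o\<^sub>L z)"
      by (simp add: v_def v'_def op_ring scaleR_2 algebra_simps)
    then show ?thesis unfolding sum by (simp add: op_ring z)
  qed
  have low: "sqrt ((1 + a) / 2) * (norm x)\<^sup>2 \<le> v x \<bullet> x" for x
  proof -
    have "2 * (v x \<bullet> x) = (v + v') x \<bullet> x"
      using is_adjointD[OF v_adj, of x x] inner_commute[of x "v' x"]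
      by (simp add: blinfun.add_left inner_add_left)
    then have "v x \<bullet> x = s x \<bullet> x" unfolding vs by (simp add: blinfun.scaleR_left)
    also have "\<dots> = (norm x)\<^sup>2 - y x \<bullet> x"
      by (simp add: s_def blinfun.diff_left inner_diff_left power2_norm_eq_inner)
    finally have eq: "v x \<bullet> x = (norm x)\<^sup>2 - y x \<bullet> x" .
    have "y x \<bullet> x \<le> norm (y x) * norm x" by (rule norm_cauchy_schwarz)
    also have "\<dots> \<le> (norm y * norm x) * norm x" by (intro mult_right_mono norm_blinfun) simp
    also have "\<dots> \<le> ((1 - sqrt (1 - q)) * norm x) * norm x" by (intro mult_right_mono y(4)) simp_all
    finally show ?thesis using eq by (simp add: q(3) power2_eq_square algebra_simps)
  qed
  have c1: "C o\<^sub>L v = v o\<^sub>L C" if C: "C o\<^sub>L w = w o\<^sub>L C" for C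
  proof -
    have C': "C o\<^sub>L w' = w' o\<^sub>L C"
      by (rule inverse_intertwines[OF w'w ww' C])
    have "C o\<^sub>L T = T o\<^sub>L C" using C C' by (simp add: T_def blinfun_compose_linear_simps)
    then have Cz: "C o\<^sub>L z = z o\<^sub>L C" by (rule z_comm)
    show ?thesis
      by (simp add: v_def op_ring C Cz compose_swap[OF C] compose_swap[OF Cz])
  qed
  have c2: "C o\<^sub>L v = v' o\<^sub>L C" if C: "C o\<^sub>L w = w' o\<^sub>L C" for C
  proof -
    have C': "C o\<^sub>L w' = w o\<^sub>L C"
      by (rule inverse_intertwines[OF ww' ww' C])
    have "C o\<^sub>L T = T o\<^sub>L C" using C C' by (simp add: T_def blinfun_compose_linear_simps algebra_simps)
    then have Cz: "C o\<^sub>L z = z o\<^sub>L C" by (rule z_comm)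
    show ?thesis
      by (simp add: v_def v'_def op_ring C Cz compose_swap[OF C] compose_swap[OF Cz])
  qed
  show ?thesis using that[OF pair comp vv low c1 c2] by blast
qed

section \<open>From iterated square roots to the logarithm\<close>

lemma cos_ge_one_minus_square: "1 - t\<^sup>2 / 2 \<le> cos (t::real)"
proof -
  have "cos t = 1 - 2 * (sin (t / 2))\<^sup>2" using cos_double_sin[of "t / 2"] by simp
  moreover have "(sin (t / 2))\<^sup>2 \<le> (t / 2)\<^sup>2"
    using abs_sin_x_le_abs_x[of "t / 2"] by (simp only: abs_le_square_iff)
  ultimately show ?thesis by (simp add: power_divide)
qed

lemma cos_half_eq_sqrt:
  assumes "0 \<le> t" "t \<le> pi"
  shows "cos (t / 2) = sqrt ((1 + cos t) / 2)"
proof -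
  have "0 \<le> cos (t / 2)" using assms by (intro cos_ge_zero) auto
  moreover have "cos t = 2 * (cos (t / 2))\<^sup>2 - 1" using cos_double_cos[of "t / 2"] by simp
  ultimately show ?thesis by simp
qed

text \<open>The cost of undoing one square root: squaring at most doubles the distance of two
  contractions, so \<open>n\<close> squarings cost \<open>2 ^ n\<close>, exactly the rescaling used
  for the logarithm.\<close>

lemma norm_square_diff_le:
  assumes "norm a \<le> 1" "norm b \<le> 1"
  shows "norm ((a o\<^sub>L a) - (b o\<^sub>L b)) \<le> 2 * norm (a - b)"
proof -
  have "(a o\<^sub>L a) - (b o\<^sub>L b) = (a o\<^sub>L (a - b)) + ((a - b) o\<^sub>L b)"
    by (simp add: blinfun_compose_linear_simps)
  also have "norm \<dots> \<le> 1 * norm (a - b) + norm (a - b) * 1"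
    using assms by (intro norm_triangle_mono norm_blinfun_compose_le) auto
  finally show ?thesis by simp
qed

text \<open>
  The logarithm is \<open>lim 2\<^sup>n (v\<^sub>n - 1)\<close> for the iterated square roots \<open>v\<^sub>n\<close> of \<open>w\<close>: halving the
  numerical angle at each step gives the norm bound together with convergence.
\<close>

lemma orthogonal_logarithm:
  fixes w w' :: "'h::{real_inner,complete_space} op"
  assumes w: "orthogonal_pair w w'" "compact_operator (w - id_blinfun)"
    and th: "0 \<le> \<theta>" "\<theta> < pi" "\<And>x. cos \<theta> * (norm x)\<^sup>2 \<le> w x \<bullet> x"
  obtains X where "op_exp X = w" "is_adjoint X (- X)" "compact_operator X" "norm X \<le> \<theta>"
    "\<And>C. C o\<^sub>L w = w o\<^sub>L C \<Longrightarrow> C o\<^sub>L X = X o\<^sub>L C"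
    "\<And>C. C o\<^sub>L w = w' o\<^sub>L C \<Longrightarrow> C o\<^sub>L X = - (X o\<^sub>L C)"
proof -
  \<comment> \<open>Invariant for the dependent choice of the pairs \<open>(v, v')\<close>. The last
    clause pins the start, because the choice principle only yields some \<open>f 0\<close> with
    \<open>P 0 (f 0)\<close>.\<close>
  define P where "P n p \<longleftrightarrow> orthogonal_pair (fst p) (snd p) \<and> compact_operator (fst p - id_blinfun) \<and>
    (\<forall>x. cos (\<theta> / 2 ^ n) * (norm x)\<^sup>2 \<le> fst p x \<bullet> x) \<and>
    (\<forall>C. C o\<^sub>L w = w o\<^sub>L C \<longrightarrow> C o\<^sub>L fst p = fst p o\<^sub>L C) \<and>
    (\<forall>C. C o\<^sub>L w = w' o\<^sub>L C \<longrightarrow> C o\<^sub>L fst p = snd p o\<^sub>L C) \<and> (n = 0 \<longrightarrow> fst p = w)"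
    for n :: nat and p :: "'h op \<times> 'h op"
  have "P 0 (w, w')" using w th by (simp add: P_def)
  moreover have "\<exists>p'. P (Suc n) p' \<and> fst p' o\<^sub>L fst p' = fst p" if p: "P n p" for n p
  proof -
    have le: "\<theta> / 2 ^ n \<le> \<theta> / 1" using th(1) by (intro divide_left_mono) auto
    then have rng: "0 \<le> \<theta> / 2 ^ n" "\<theta> / 2 ^ n < pi" using th by auto
    have pp: "orthogonal_pair (fst p) (snd p)" "compact_operator (fst p - id_blinfun)"
      "\<And>x. cos (\<theta> / 2 ^ n) * (norm x)\<^sup>2 \<le> fst p x \<bullet> x"
      using p by (simp_all add: P_def)
    have pC: "\<And>C. C o\<^sub>L w = w o\<^sub>L C \<Longrightarrow> C o\<^sub>L fst p = fst p o\<^sub>L C"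
      "\<And>C. C o\<^sub>L w = w' o\<^sub>L C \<Longrightarrow> C o\<^sub>L fst p = snd p o\<^sub>L C"
      using p unfolding P_def by blast+
    have m1: "-1 < cos (\<theta> / 2 ^ n)" using rng cos_monotone_0_pi[of "\<theta> / 2 ^ n" pi] by simp
    have half: "sqrt ((1 + cos (\<theta> / 2 ^ n)) / 2) = cos (\<theta> / 2 ^ Suc n)"
      using cos_half_eq_sqrt[of "\<theta> / 2 ^ n"] rng by (simp add: field_simps)
    obtain v v' where v: "orthogonal_pair v v'" "compact_operator (v - id_blinfun)" "v o\<^sub>L v = fst p"
      "\<And>x. sqrt ((1 + cos (\<theta> / 2 ^ n)) / 2) * (norm x)\<^sup>2 \<le> v x \<bullet> x"
      "\<And>C. C o\<^sub>L fst p = fst p o\<^sub>L C \<Longrightarrow> C o\<^sub>L v = v o\<^sub>L C"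
      "\<And>C. C o\<^sub>L fst p = snd p o\<^sub>L C \<Longrightarrow> C o\<^sub>L v = v' o\<^sub>L C"
      by (rule orthogonal_square_root[OF pp(1,2) m1 cos_le_one pp(3)], rule that)
    have "P (Suc n) (v, v')"
      unfolding P_def fst_conv snd_conv
      by (intro conjI allI impI v(1,2) v(4)[unfolded half] v(5)[OF pC(1)] v(6)[OF pC(2)]) simp_all
    then show ?thesis using v(3) by (intro exI[of _ "(v, v')"]) simp
  qed
  ultimately obtain f where f: "\<And>n. P n (f n)" "\<And>n. fst (f (Suc n)) o\<^sub>L fst (f (Suc n)) = fst (f n)"
    using dependent_nat_choice[of P "\<lambda>_ p p'. fst p' o\<^sub>L fst p' = fst p"] by blast
  define v where "v n = fst (f n)" for n
  define v' where "v' n = snd (f n)" for n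
  have v: "orthogonal_pair (v n) (v' n)" "compact_operator (v n - id_blinfun)"
    "\<And>x. cos (\<theta> / 2 ^ n) * (norm x)\<^sup>2 \<le> v n x \<bullet> x"
    "\<And>C. C o\<^sub>L w = w o\<^sub>L C \<Longrightarrow> C o\<^sub>L v n = v n o\<^sub>L C"
    "\<And>C. C o\<^sub>L w = w' o\<^sub>L C \<Longrightarrow> C o\<^sub>L v n = v' n o\<^sub>L C"
    "v (Suc n) o\<^sub>L v (Suc n) = v n" for n
    using f[of n] by (auto simp: P_def v_def v'_def)
  have v0: "v 0 = w" using f(1)[of 0] by (simp add: P_def v_def)
  have vn: "norm (v n - id_blinfun) \<le> \<theta> / 2 ^ n" for n
    using th(1) cos_ge_one_minus_square[of "\<theta> / 2 ^ n"]
    by (intro orthogonal_pair_norm_diff_id[OF v(1,3)]) auto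
  have v'n: "norm (v' n - id_blinfun) \<le> \<theta> / 2 ^ n" for n
    using orthogonal_pair_norm_inverse_diff_id[OF v(1)] vn order_trans by blast
  define X where "X n = (2 ^ n) *\<^sub>R (v n - id_blinfun)" for n
  \<comment> \<open>With \<open>d = v (Suc n) - 1\<close> one has
    \<open>v n - 1 = 2 d + d\<^sup>2\<close>, so the first order terms cancel and
    \<open>- (2 ^ n) d\<^sup>2\<close> remains, which is geometrically small.\<close>
  have step: "norm (X (Suc n) - X n) \<le> \<theta>\<^sup>2 * (1 / 2) ^ n" for n
  proof -
    let ?d = "v (Suc n) - id_blinfun"
    have "X n = (2 ^ n) *\<^sub>R ((v (Suc n) o\<^sub>L v (Suc n)) - id_blinfun)" by (simp add: X_def v(6))
    then have "X (Suc n) - X n = - ((2 ^ n) *\<^sub>R (?d o\<^sub>L ?d))"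
      by (simp add: X_def blinfun_compose_linear_simps algebra_simps scaleR_2 flip: scaleR_scaleR)
    then have "norm (X (Suc n) - X n) = 2 ^ n * norm (?d o\<^sub>L ?d)" by simp
    also have "\<dots> \<le> 2 ^ n * ((\<theta> / 2 ^ Suc n) * (\<theta> / 2 ^ Suc n))"
      by (intro mult_left_mono norm_blinfun_compose_le vn) simp
    also have "\<dots> = \<theta>\<^sup>2 * (1 / 2) ^ n / 4" by (simp add: power2_eq_square power_one_over field_simps)
    also have "\<dots> \<le> \<theta>\<^sup>2 * (1 / 2) ^ n" by simp
    finally show ?thesis .
  qed
  have tail: "norm (X (m + k) - X m) \<le> 2 * \<theta>\<^sup>2 * (1 / 2) ^ m - 2 * \<theta>\<^sup>2 * (1 / 2) ^ (m + k)" for m k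
  proof (induction k)
    case (Suc k)
    have "norm (X (m + Suc k) - X m) \<le> norm (X (Suc (m + k)) - X (m + k)) + norm (X (m + k) - X m)"
      using norm_triangle_ineq[of "X (Suc (m + k)) - X (m + k)" "X (m + k) - X m"] by simp
    then show ?case using step[of "m + k"] Suc by simp
  qed simp
  have "Cauchy X"
  proof (rule CauchyI')
    fix e :: real assume "e > 0"
    have "(\<lambda>m. 2 * \<theta>\<^sup>2 * (1 / 2) ^ m) \<longlonglongrightarrow> 2 * \<theta>\<^sup>2 * 0"
      by (intro tendsto_intros LIMSEQ_power_zero) simp
    then obtain M where M: "\<And>m. m \<ge> M \<Longrightarrow> 2 * \<theta>\<^sup>2 * (1 / 2) ^ m < e"
      using LIMSEQ_D[of _ 0 e] \<open>e > 0\<close> by (metis (no_types, lifting) abs_less_iff diff_zero mult_zero_right real_norm_def)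
    have "dist (X m) (X n) < e" if "m \<ge> M" "n > m" for m n
    proof -
      have "dist (X m) (X n) = norm (X (m + (n - m)) - X m)" using that by (simp add: dist_norm norm_minus_commute)
      also have "\<dots> \<le> 2 * \<theta>\<^sup>2 * (1 / 2) ^ m - 2 * \<theta>\<^sup>2 * (1 / 2) ^ (m + (n - m))" by (rule tail)
      also have "\<dots> \<le> 2 * \<theta>\<^sup>2 * (1 / 2) ^ m" by simp
      finally show ?thesis using M[OF that(1)] by simp
    qed
    then show "\<exists>M. \<forall>m\<ge>M. \<forall>n>m. dist (X m) (X n) < e" by blast
  qed
  then obtain L where L: "X \<longlonglongrightarrow> L" using blinfun_Cauchy_convergent convergent_def by blast
  have "(\<lambda>n. \<theta> / 2 ^ n) \<longlonglongrightarrow> 0"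
    using tendsto_mult[OF tendsto_const[of \<theta>] LIMSEQ_power_zero[of "1/2 :: real"]] by (simp add: power_one_over)
  then have "(\<lambda>n. v' n - id_blinfun) \<longlonglongrightarrow> 0"
    by (rule Lim_null_comparison[OF always_eventually, rotated]) (simp add: v'n)
  then have v'_lim: "v' \<longlonglongrightarrow> id_blinfun" using LIM_zero_iff by blast
  have X'_eq: "(2 ^ n) *\<^sub>R (v' n - id_blinfun) = - (v' n o\<^sub>L X n)" for n
    using v(1)[of n] by (simp add: X_def orthogonal_pair_def blinfun_compose_linear_simps scaleR_diff_right)
  \<comment> \<open>The rescaled adjoints tend to \<open>- L\<close>, since
    \<open>v' - 1 = - v' (v - 1)\<close> and \<open>v'\<close> tends to the identity. Skewness of
    the limit comes from here.\<close>
  have X'_lim: "(\<lambda>n. (2 ^ n) *\<^sub>R (v' n - id_blinfun)) \<longlonglongrightarrow> - L"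
  proof -
    have "(\<lambda>n. - (v' n o\<^sub>L X n)) \<longlonglongrightarrow> - (id_blinfun o\<^sub>L L)"
      by (intro tendsto_minus blinfun_compose.tendsto v'_lim L)
    then show ?thesis by (simp add: X'_eq)
  qed
  have adj: "is_adjoint L (- L)"
  proof (rule is_adjoint_tendsto[OF _ L X'_lim])
    show "is_adjoint (X n) (2 ^ n *\<^sub>R (v' n - id_blinfun))" for n
      using v(1)[of n] unfolding X_def orthogonal_pair_def by (intro is_adjoint_intros) auto
  qed
  have comp: "compact_operator L"
    by (rule compact_operator_tendsto[OF _ L]) (simp add: X_def compact_operator_scaleR v(2))
  have nrm: "norm L \<le> \<theta>"
  proof (rule Lim_norm_ubound[OF sequentially_bot L], rule always_eventually, rule allI)
    show "norm (X n) \<le> \<theta>" for n using vn[of n] unfolding X_def norm_scaleR by (simp add: field_simps)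
  qed
  have c1: "C o\<^sub>L L = L o\<^sub>L C" if "C o\<^sub>L w = w o\<^sub>L C" for C
  proof -
    have "(\<lambda>n. C o\<^sub>L X n) \<longlonglongrightarrow> (C o\<^sub>L L)" "(\<lambda>n. X n o\<^sub>L C) \<longlonglongrightarrow> (L o\<^sub>L C)"
      by (intro tendsto_intros L)+
    moreover have "(\<lambda>n. C o\<^sub>L X n) = (\<lambda>n. X n o\<^sub>L C)"
      using v(4)[OF that] by (simp add: X_def blinfun_compose_linear_simps)
    ultimately show ?thesis using LIMSEQ_unique by metis
  qed
  have c2: "C o\<^sub>L L = - (L o\<^sub>L C)" if "C o\<^sub>L w = w' o\<^sub>L C" for C
  proof -
    have "(\<lambda>n. C o\<^sub>L X n) \<longlonglongrightarrow> (C o\<^sub>L L)"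
      "(\<lambda>n. ((2 ^ n) *\<^sub>R (v' n - id_blinfun)) o\<^sub>L C) \<longlonglongrightarrow> (- L o\<^sub>L C)"
      by (intro tendsto_intros L X'_lim)+
    moreover have "(\<lambda>n. C o\<^sub>L X n) = (\<lambda>n. ((2 ^ n) *\<^sub>R (v' n - id_blinfun)) o\<^sub>L C)"
      using v(5)[OF that] by (simp add: X_def blinfun_compose_linear_simps)
    ultimately have "C o\<^sub>L L = - L o\<^sub>L C" using LIMSEQ_unique by metis
    then show ?thesis by (simp add: blinfun_compose_linear_simps)
  qed
  define e where "e n = op_exp ((1 / 2 ^ n) *\<^sub>R L)" for n :: nat
  have e_pair: "orthogonal_pair (e n) (op_exp (- ((1 / 2 ^ n) *\<^sub>R L)))" for n
    unfolding e_def using is_adjoint_scaleR[OF adj, of "1 / 2 ^ n"]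
    by (intro orthogonal_pair_skew_exp) simp
  have ee: "e n = e (Suc n) o\<^sub>L e (Suc n)" for n
    using op_exp_half[of "(1 / 2 ^ n) *\<^sub>R L"] by (simp add: e_def)
  \<comment> \<open>Both \<open>v n\<close> and \<open>e n\<close> equal the identity plus
    \<open>(1 / 2 ^ n) *\<^sub>R L\<close> up to an error that vanishes even after multiplication by
    \<open>2 ^ n\<close>, the loss from \<open>n\<close> squarings.\<close>
  have "norm (v 0 - e 0) \<le> 2 ^ n * norm (v n - e n)" for n
  proof (induction n)
    case (Suc n)
    have "norm (v n - e n) \<le> 2 * norm (v (Suc n) - e (Suc n))"
      using norm_square_diff_le[of "v (Suc n)" "e (Suc n)"] orthogonal_pair_norm_le[OF v(1)]
        orthogonal_pair_norm_le[OF e_pair] by (simp add: v(6) flip: ee)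
    then have "2 ^ n * norm (v n - e n) \<le> 2 ^ n * (2 * norm (v (Suc n) - e (Suc n)))"
      by (intro mult_left_mono) auto
    with Suc have "norm (v 0 - e 0) \<le> 2 ^ n * (2 * norm (v (Suc n) - e (Suc n)))"
      by (rule order_trans)
    then show ?case by (simp add: mult.assoc mult.left_commute)
  qed simp
  moreover have "(\<lambda>n. 2 ^ n * norm (v n - e n)) \<longlonglongrightarrow> 0"
  proof -
    have "(\<lambda>n. X n - (2 ^ n) *\<^sub>R (e n - id_blinfun)) \<longlonglongrightarrow> L - L"
      unfolding e_def by (intro tendsto_diff L op_exp_derivative_at_zero)
    then have "(\<lambda>n. norm (X n - (2 ^ n) *\<^sub>R (e n - id_blinfun))) \<longlonglongrightarrow> 0"
      using tendsto_norm_zero by simp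
    moreover have "norm (X n - (2 ^ n) *\<^sub>R (e n - id_blinfun)) = 2 ^ n * norm (v n - e n)" for n
    proof -
      have "X n - (2 ^ n) *\<^sub>R (e n - id_blinfun) = (2 ^ n) *\<^sub>R (v n - e n)"
        by (simp add: X_def scaleR_diff_right)
      then show ?thesis by simp
    qed
    ultimately show ?thesis by simp
  qed
  ultimately have "norm (v 0 - e 0) \<le> 0"
    using LIMSEQ_le_const by blast
  then have "op_exp L = w" by (simp add: v0 e_def)
  then show ?thesis using that adj comp nrm c1 c2 by blast
qed

section \<open>Lengths of curves and angles\<close>

lemma arccos_scaled_limit:
  assumes "-1 \<le> k" "k \<le> 1"
  shows "(\<lambda>n. arccos ((1 - 1 / real (Suc n)) * k)) \<longlonglongrightarrow> arccos k"
proof (rule continuous_on_tendsto_compose[OF continuous_on_arccos'])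
  have "(\<lambda>n. (1 - 1 / real (Suc n)) * k) \<longlonglongrightarrow> (1 - 0) * k"
    by (intro tendsto_intros LIMSEQ_Suc[OF lim_1_over_n])
  then show "(\<lambda>n. (1 - 1 / real (Suc n)) * k) \<longlonglongrightarrow> k" by simp
  have "\<bar>(1 - 1 / real (Suc n)) * k\<bar> \<le> 1" for n
  proof -
    have "\<bar>1 - 1 / real (Suc n)\<bar> \<le> 1" by (simp add: abs_le_iff)
    then show ?thesis using assms by (simp add: abs_mult mult_le_one)
  qed
  then have "(1 - 1 / real (Suc n)) * k \<in> {-1..1}" for n by (simp add: abs_le_iff)
  then show "\<forall>\<^sub>F n in sequentially. (1 - 1 / real (Suc n)) * k \<in> {-1..1}" by (rule always_eventually[OF allI])
qed (use assms in simp)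

text \<open>As \<open>d\<close> is tangent at \<open>c\<close>, only the component of
  \<open>a\<close> orthogonal to \<open>c\<close> contributes, and its length
  \<open>sqrt (1 - (a \<bullet> c)\<^sup>2)\<close> cancels the denominator in the derivative of
  \<open>arccos\<close>.\<close>

lemma unit_sphere_velocity_bound:
  fixes a c d :: "'h::real_inner"
  assumes "norm a = 1" "norm c = 1" "c \<bullet> d = 0"
  shows "\<bar>a \<bullet> d\<bar> \<le> sqrt (1 - (a \<bullet> c)\<^sup>2) * norm d"
proof -
  have "a \<bullet> d = (a - (a \<bullet> c) *\<^sub>R c) \<bullet> d" using assms(3) by (simp add: inner_diff_left)
  then have "\<bar>a \<bullet> d\<bar> \<le> norm (a - (a \<bullet> c) *\<^sub>R c) * norm d" by (simp only: Cauchy_Schwarz_ineq2)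
  moreover have "(a - (a \<bullet> c) *\<^sub>R c) \<bullet> (a - (a \<bullet> c) *\<^sub>R c) = 1 - (a \<bullet> c)\<^sup>2"
  proof -
    have "a \<bullet> a = 1" "c \<bullet> c = 1" using assms(1,2) by (simp_all add: dot_square_norm)
    then show ?thesis
      by (simp add: inner_diff_left inner_diff_right inner_commute[of c a] power2_eq_square)
  qed
  then have "norm (a - (a \<bullet> c) *\<^sub>R c) = sqrt (1 - (a \<bullet> c)\<^sup>2)" by (simp only: norm_eq_sqrt_inner)
  ultimately show ?thesis by simp
qed

text \<open>
  The function \<open>arccos (c(0) \<bullet> c(t))\<close> is not differentiable where \<open>c(t) = \<plusminus> c(0)\<close>; scaling the
  argument by \<open>\<eta> < 1\<close> removes the singularity, and \<open>\<eta> \<longlongrightarrow> 1\<close> at the end.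
\<close>

lemma unit_sphere_angle_le_length:
  fixes c c' :: "real \<Rightarrow> 'h::real_inner"
  assumes S: "finite S" and cont: "continuous_on {0..1} c"
    and deriv: "\<And>t. t \<in> {0<..<1} - S \<Longrightarrow> (c has_vector_derivative c' t) (at t)"
    and unit: "\<And>t. t \<in> {0..1} \<Longrightarrow> norm (c t) = 1"
    and bound: "\<And>t. t \<in> {0<..<1} - S \<Longrightarrow> norm (c' t) \<le> g t"
    and g: "g integrable_on {0..1}" "\<And>t. t \<in> {0..1} \<Longrightarrow> 0 \<le> g t"
  shows "arccos (c 0 \<bullet> c 1) \<le> integral {0..1} g"
proof -
  define k where "k t = c 0 \<bullet> c t" for t
  have k_bound: "\<bar>k t\<bar> \<le> 1" if "t \<in> {0..1}" for t
    using Cauchy_Schwarz_ineq2[of "c 0" "c t"] unit[of 0] unit[OF that] by (simp add: k_def)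
  have scaled: "arccos (\<eta> * k 1) - arccos \<eta> \<le> integral {0..1} g" if eta: "0 \<le> \<eta>" "\<eta> < 1" for \<eta>
  proof -
    have lt1: "\<bar>\<eta> * k t\<bar> < 1" if "t \<in> {0..1}" for t
    proof -
      have "\<bar>\<eta> * k t\<bar> \<le> \<eta> * 1" unfolding abs_mult using k_bound[OF that] eta by (intro mult_mono) auto
      then show ?thesis using eta by simp
    qed
    \<comment> \<open>Off the smooth points \<open>h'\<close> is set to \<open>0\<close>: finitely
      many values do not affect the integral, and the bound by \<open>g\<close> then holds on the
      whole interval.\<close>
    define h' where "h' t = (if t \<in> {0<..<1} - S then inverse (- sqrt (1 - (\<eta> * k t)\<^sup>2)) * (\<eta> * (c 0 \<bullet> c' t)) else 0)" for t
    have der: "((\<lambda>t. arccos (\<eta> * k t)) has_vector_derivative h' t) (at t)" if t: "t \<in> {0<..<1} - S" for t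
    proof -
      have "(k has_vector_derivative (c 0 \<bullet> c' t)) (at t)"
        unfolding k_def
        by (rule bounded_linear.has_vector_derivative[OF bounded_linear_inner_right deriv[OF t]])
      then have "((\<lambda>t. \<eta> * k t) has_real_derivative (\<eta> * (c 0 \<bullet> c' t))) (at t)"
        by (intro DERIV_cmult) (simp add: has_real_derivative_iff_has_vector_derivative)
      moreover have "(arccos has_real_derivative inverse (- sqrt (1 - (\<eta> * k t)\<^sup>2))) (at (\<eta> * k t))"
        using lt1[of t] t by (intro DERIV_arccos) (auto simp: abs_less_iff)
      ultimately have "((\<lambda>t. arccos (\<eta> * k t)) has_real_derivative
          inverse (- sqrt (1 - (\<eta> * k t)\<^sup>2)) * (\<eta> * (c 0 \<bullet> c' t))) (at t)"
        by (rule DERIV_chain2[rotated])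
      then show ?thesis using t by (simp add: h'_def has_real_derivative_iff_has_vector_derivative)
    qed
    have "continuous_on {0..1} (\<lambda>t. arccos (\<eta> * k t))"
      unfolding k_def
      by (intro continuous_intros cont ballI) (use lt1 in \<open>auto simp: k_def abs_less_iff dest!: lt1 intro: less_imp_le\<close>)
    with der have int: "(h' has_integral (arccos (\<eta> * k 1) - arccos (\<eta> * k 0))) {0..1}"
      by (intro fundamental_theorem_of_calculus_interior_strong[OF S]) auto
    have "norm (h' t) \<le> g t" if t01: "t \<in> {0..1}" for t
    proof (cases "t \<in> {0<..<1} - S")
      case True
      have orth: "c t \<bullet> c' t = 0"
      proof -
        have "((\<lambda>s. c s \<bullet> c s) has_vector_derivative (c t \<bullet> c' t + c' t \<bullet> c t)) (at t)"
          by (rule bounded_bilinear.has_vector_derivative[OF bounded_bilinear_inner deriv[OF True] deriv[OF True]])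
        then have D: "((\<lambda>s. c s \<bullet> c s) has_real_derivative (2 * (c t \<bullet> c' t))) (at t)"
          by (simp add: has_real_derivative_iff_has_vector_derivative inner_commute)
        have "2 * (c t \<bullet> c' t) = 0"
        proof (rule DERIV_local_const[OF D])
          show "0 < min t (1 - t)" using True by simp
          show "\<forall>y. \<bar>t - y\<bar> < min t (1 - t) \<longrightarrow> c t \<bullet> c t = c y \<bullet> c y"
          proof (intro allI impI)
            fix y assume "\<bar>t - y\<bar> < min t (1 - t)"
            then have "y \<in> {0..1}" by auto
            then show "c t \<bullet> c t = c y \<bullet> c y" using unit[OF t01] unit[of y] by (simp add: dot_square_norm)
          qed
        qed
        then show ?thesis by simp
      qed
      have pos: "0 < 1 - (\<eta> * k t)\<^sup>2"
        using lt1[OF t01] by (simp add: abs_square_less_1)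
      have "\<eta>\<^sup>2 * (1 - (k t)\<^sup>2) \<le> 1 - (\<eta> * k t)\<^sup>2"
        using eta by (simp add: power_mult_distrib algebra_simps abs_square_le_1)
      then have "\<eta> * sqrt (1 - (k t)\<^sup>2) \<le> sqrt (1 - (\<eta> * k t)\<^sup>2)"
        using eta by (metis real_sqrt_le_mono real_sqrt_mult real_sqrt_pow2 real_sqrt_power real_sqrt_abs abs_of_nonneg)
      moreover have "\<bar>c 0 \<bullet> c' t\<bar> \<le> sqrt (1 - (k t)\<^sup>2) * norm (c' t)"
        unfolding k_def using unit[of 0] unit[OF t01] orth by (intro unit_sphere_velocity_bound) auto
      then have "\<eta> * \<bar>c 0 \<bullet> c' t\<bar> \<le> \<eta> * sqrt (1 - (k t)\<^sup>2) * norm (c' t)"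
        using eta by (simp add: mult.assoc mult_left_mono)
      ultimately have "\<eta> * \<bar>c 0 \<bullet> c' t\<bar> \<le> sqrt (1 - (\<eta> * k t)\<^sup>2) * norm (c' t)"
        by (meson mult_right_mono norm_ge_zero order_trans)
      then have "norm (h' t) \<le> norm (c' t)"
        using True pos eta by (simp add: h'_def abs_mult abs_inverse divide_simps mult.commute)
      then show ?thesis using bound[OF True] by linarith
    next
      case False
      then have "h' t = 0" unfolding h'_def by (rule if_not_P)
      then show ?thesis using g(2)[OF t01] by simp
    qed
    then have "norm (integral {0..1} h') \<le> integral {0..1} g"
      using int g(1) by (intro integral_norm_bound_integral) (auto simp: integrable_on_def)
    moreover have "integral {0..1} h' = arccos (\<eta> * k 1) - arccos (\<eta> * k 0)"
      using int by (rule integral_unique)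
    moreover have "k 0 = 1" using unit[of 0] by (simp add: k_def dot_square_norm)
    ultimately show ?thesis by simp
  qed
  have "(\<lambda>n. arccos ((1 - 1 / real (Suc n)) * k 1) - arccos ((1 - 1 / real (Suc n)) * 1))
    \<longlonglongrightarrow> arccos (k 1) - arccos 1"
    using k_bound[of 1] by (intro tendsto_diff arccos_scaled_limit) (auto simp: abs_le_iff)
  then have "arccos (k 1) - arccos 1 \<le> integral {0..1} g"
    by (rule LIMSEQ_le_const2) (use scaled in auto)
  then show ?thesis by (simp add: k_def)
qed

text \<open>Evaluation at a unit vector gives a curve on the sphere whose speed is at most
  \<open>g\<close>. The bound by \<open>pi\<close> keeps the angles in the range where
  \<open>cos\<close> decreases. It serves curves of symmetries and one-parameter groups
  alike.\<close>

lemma isometric_curve_angle: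
  fixes \<delta> \<delta>' :: "real \<Rightarrow> 'h::real_inner op"
  assumes S: "finite S" and cont: "continuous_on {0..1} \<delta>"
    and deriv: "\<And>t. t \<in> {0<..<1} - S \<Longrightarrow> (\<delta> has_vector_derivative \<delta>' t) (at t)"
    and iso: "\<And>t x. t \<in> {0..1} \<Longrightarrow> norm (\<delta> t x) = norm x"
    and bound: "\<And>t. t \<in> {0<..<1} - S \<Longrightarrow> norm (\<delta>' t) \<le> g t"
    and g: "g integrable_on {0..1}" "\<And>t. t \<in> {0..1} \<Longrightarrow> 0 \<le> g t"
    and le_pi: "integral {0..1} g \<le> pi"
  shows "cos (integral {0..1} g) * (norm x)\<^sup>2 \<le> \<delta> 0 x \<bullet> \<delta> 1 x"
proof (cases "x = 0")
  case False
  define y where "y = (1 / norm x) *\<^sub>R x"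
  have y: "norm y = 1" "x = norm x *\<^sub>R y" using False by (simp_all add: y_def)
  have arc: "arccos (\<delta> 0 y \<bullet> \<delta> 1 y) \<le> integral {0..1} g"
  proof (rule unit_sphere_angle_le_length[OF S _ _ _ _ g])
    show "continuous_on {0..1} (\<lambda>t. \<delta> t y)"
      by (intro continuous_intros cont)
    show "((\<lambda>t. \<delta> t y) has_vector_derivative \<delta>' t y) (at t)" if "t \<in> {0<..<1} - S" for t
      by (rule bounded_linear.has_vector_derivative[OF blinfun.bounded_linear_left deriv[OF that]])
    show "norm (\<delta> t y) = 1" if "t \<in> {0..1}" for t using iso[OF that] y(1) by simp
    show "norm (\<delta>' t y) \<le> g t" if "t \<in> {0<..<1} - S" for t
      using norm_blinfun[of "\<delta>' t" y] bound[OF that] y(1) by simp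
  qed
  have "\<bar>\<delta> 0 y \<bullet> \<delta> 1 y\<bar> \<le> 1"
    using Cauchy_Schwarz_ineq2[of "\<delta> 0 y" "\<delta> 1 y"] iso y(1) by simp
  then have range: "-1 \<le> \<delta> 0 y \<bullet> \<delta> 1 y" "\<delta> 0 y \<bullet> \<delta> 1 y \<le> 1" by auto
  have "cos (integral {0..1} g) \<le> cos (arccos (\<delta> 0 y \<bullet> \<delta> 1 y))"
    using arc le_pi arccos_lbound[OF range] by (intro cos_monotone_0_pi_le) auto
  then have "cos (integral {0..1} g) \<le> \<delta> 0 y \<bullet> \<delta> 1 y" using range by simp
  then have "cos (integral {0..1} g) * (norm x)\<^sup>2 \<le> (\<delta> 0 y \<bullet> \<delta> 1 y) * (norm x)\<^sup>2"
    by (intro mult_right_mono) simp_all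
  also have "\<dots> = \<delta> 0 (norm x *\<^sub>R y) \<bullet> \<delta> 1 (norm x *\<^sub>R y)"
    by (simp add: blinfun.scaleR_right power2_eq_square)
  finally show ?thesis using y(2) by simp
qed (simp add: blinfun.zero_right)

section \<open>The norm of a skew operator against the angles of its exponential\<close>

text \<open>Along the path \<open>op_exp (t *\<^sub>R Z)\<close> from the identity the speed is at
  most \<open>norm Z\<close>.\<close>

lemma skew_exp_angle_le_norm:
  fixes Z :: "'h::{real_inner,complete_space} op"
  assumes skew: "is_adjoint Z (- Z)" and "norm Z \<le> pi"
  shows "cos (norm Z) * (norm x)\<^sup>2 \<le> op_exp Z x \<bullet> x"
proof -
  have pair: "orthogonal_pair (op_exp (t *\<^sub>R Z)) (op_exp (- (t *\<^sub>R Z)))" for t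
    using is_adjoint_scaleR[OF skew, of t] by (intro orthogonal_pair_skew_exp) simp
  have "cos (integral {0..1} (\<lambda>t::real. norm Z)) * (norm x)\<^sup>2 \<le> op_exp (0 *\<^sub>R Z) x \<bullet> op_exp (1 *\<^sub>R Z) x"
  proof (rule isometric_curve_angle[where S = "{}"])
    show "continuous_on {0..1} (\<lambda>t. op_exp (t *\<^sub>R Z))"
      using op_exp_derivative by (intro differentiable_imp_continuous_on)
        (auto simp: differentiable_on_def intro: differentiableI_vector)
    show "((\<lambda>t. op_exp (t *\<^sub>R Z)) has_vector_derivative (Z o\<^sub>L op_exp (t *\<^sub>R Z))) (at t)" for t
      by (rule op_exp_derivative)
    show "norm (op_exp (t *\<^sub>R Z) x) = norm x" for t x by (rule orthogonal_pair_norm[OF pair])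
    show "norm (Z o\<^sub>L op_exp (t *\<^sub>R Z)) \<le> norm Z" for t
      using norm_blinfun_compose_le[OF order_refl orthogonal_pair_norm_le[OF pair]] by simp
  qed (use assms in auto)
  then show ?thesis by (simp add: inner_commute)
qed

text \<open>
  Conversely the angles of \<open>e\<^sup>X\<close> detect \<open>norm X\<close>. For \<open>r = norm X\<close> compare \<open>e\<^sup>t\<^sup>X x\<close> with
  \<open>cos (t r) x + sin (t r) X x / r\<close>, which solves the same equation up to an error governed by
  \<open>r\<^sup>2 x + X\<^sup>2 x\<close>; the latter is small when \<open>x\<close> almost attains the norm.
\<close>

lemma skew_exp_rotation_error:
  fixes X :: "'h::{real_inner,complete_space} op"
  assumes skew: "is_adjoint X (- X)" and r: "0 < r"
  shows "op_exp X x \<bullet> x \<le> cos r * (norm x)\<^sup>2 + norm (r\<^sup>2 *\<^sub>R x + X (X x)) * norm x"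
proof -
  define d where "d = r\<^sup>2 *\<^sub>R x + X (X x)"
  define u where "u t = cos (t * r) *\<^sub>R x + (sin (t * r) / r) *\<^sub>R X x" for t
  \<comment> \<open>Undoing the flow leaves only the error: the derivative of \<open>F\<close> is
    \<open>op_exp (t *\<^sub>R (- X)) d\<close> times \<open>- sin (t * r) / r\<close>, of norm at
    most \<open>norm d\<close> because \<open>\<bar>sin (t * r)\<bar> \<le> r\<close> on the
    interval.\<close>
  define F where "F t = op_exp (t *\<^sub>R (- X)) (u t)" for t
  have pair: "orthogonal_pair (op_exp (t *\<^sub>R (- X))) (op_exp (t *\<^sub>R X))" for t
  proof -
    have "is_adjoint (t *\<^sub>R (- X)) (- (t *\<^sub>R (- X)))"
      using is_adjoint_scaleR[OF is_adjoint_minus[OF skew], of t] by simp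
    from orthogonal_pair_skew_exp[OF this] show ?thesis by simp
  qed
  have uder: "(u has_vector_derivative ((- sin (t * r) * r) *\<^sub>R x + cos (t * r) *\<^sub>R X x)) (at t within {0..1})" for t
    unfolding u_def using r
    by (auto intro!: derivative_eq_intros simp: has_vector_derivative_def fun_eq_iff algebra_simps)
  have Fder: "(F has_vector_derivative (- (sin (t * r) / r)) *\<^sub>R op_exp (t *\<^sub>R (- X)) d) (at t within {0..1})" for t
  proof -
    let ?e = "op_exp (t *\<^sub>R (- X))"
    have "(F has_vector_derivative (?e ((- sin (t * r) * r) *\<^sub>R x + cos (t * r) *\<^sub>R X x)
        + (- X o\<^sub>L ?e) (u t))) (at t within {0..1})"
      unfolding F_def
      by (rule bounded_bilinear.has_vector_derivative[OF bounded_bilinear_blinfun_apply op_exp_derivative uder])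
    moreover have "(- X o\<^sub>L ?e) (u t) = ?e (- X (u t))"
    proof -
      have "(- X) o\<^sub>L ?e = ?e o\<^sub>L (- X)"
        using op_exp_intertwine[of "- X" "t *\<^sub>R (- X)" "t *\<^sub>R (- X)"]
        by (simp add: blinfun_compose_linear_simps)
      then have "((- X) o\<^sub>L ?e) (u t) = (?e o\<^sub>L (- X)) (u t)" by simp
      then show ?thesis by (simp add: blinfun.minus_left)
    qed
    moreover have "(- sin (t * r) * r) *\<^sub>R x + cos (t * r) *\<^sub>R X x + (- X (u t)) = (- (sin (t * r) / r)) *\<^sub>R d"
      using r by (simp add: u_def d_def blinfun.add_right blinfun.scaleR_right scaleR_add_right power2_eq_square)
    ultimately have "(F has_vector_derivative ?e ((- (sin (t * r) / r)) *\<^sub>R d)) (at t within {0..1})"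
      by (simp only: flip: blinfun.add_right)
    then show ?thesis by (simp only: blinfun.scaleR_right)
  qed
  have "norm (F 1 - F 0) \<le> norm d * norm (1 - 0 :: real)"
  proof (rule differentiable_bound[of "{0..1}" F "\<lambda>t h. h *\<^sub>R ((- (sin (t * r) / r)) *\<^sub>R op_exp (t *\<^sub>R (- X)) d)"])
    fix t :: real assume t: "t \<in> {0..1}"
    show "(F has_derivative (\<lambda>h. h *\<^sub>R ((- (sin (t * r) / r)) *\<^sub>R op_exp (t *\<^sub>R (- X)) d))) (at t within {0..1})"
      using Fder by (simp add: has_vector_derivative_def)
    have "\<bar>sin (t * r)\<bar> \<le> \<bar>t * r\<bar>" by (rule abs_sin_x_le_abs_x)
    also have "\<dots> \<le> 1 * r" unfolding abs_mult using t r by (intro mult_mono) auto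
    finally have "\<bar>sin (t * r) / r\<bar> \<le> 1" using r by simp
    then have "\<bar>sin (t * r) / r\<bar> * norm d \<le> 1 * norm d" by (intro mult_right_mono) simp_all
    then have "norm ((- (sin (t * r) / r)) *\<^sub>R op_exp (t *\<^sub>R (- X)) d) \<le> norm d"
      unfolding norm_scaleR orthogonal_pair_norm[OF pair] by simp
    then have "norm (h *\<^sub>R ((- (sin (t * r) / r)) *\<^sub>R op_exp (t *\<^sub>R (- X)) d)) \<le> norm d * norm h" for h :: real
      unfolding norm_scaleR[of h] by (simp only: real_norm_def mult.commute[of "\<bar>h\<bar>"]) (intro mult_right_mono abs_ge_zero)
    then show "onorm (\<lambda>h. h *\<^sub>R ((- (sin (t * r) / r)) *\<^sub>R op_exp (t *\<^sub>R (- X)) d)) \<le> norm d"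
      by (intro onorm_bound) auto
  qed auto
  moreover have "F 0 = x" by (simp add: F_def u_def)
  moreover have "F 1 = op_exp (- X) (u 1)" by (simp add: F_def)
  moreover have "op_exp (- X) (u 1) - x = op_exp (- X) (u 1 - op_exp X x)"
  proof -
    have "(op_exp (- X) o\<^sub>L op_exp X) x = x" by (simp add: op_exp_minus)
    then show ?thesis by (simp add: blinfun.diff_right)
  qed
  ultimately have close: "norm (u 1 - op_exp X x) \<le> norm d"
    using orthogonal_pair_norm[OF pair[of 1], of "u 1 - op_exp X x"] by simp
  have "X x \<bullet> x = 0" using is_adjointD[OF skew, of x x] by (simp add: blinfun.minus_left inner_commute)
  then have "u 1 \<bullet> x = cos r * (norm x)\<^sup>2" by (simp add: u_def inner_add_left power2_norm_eq_inner)
  moreover have "(op_exp X x - u 1) \<bullet> x \<le> norm d * norm x"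
    using norm_cauchy_schwarz[of "op_exp X x - u 1" x] close
    by (smt (verit) mult_right_mono norm_ge_zero norm_minus_commute)
  ultimately show ?thesis by (simp add: d_def inner_diff_left)
qed

text \<open>If \<open>r = norm X\<close> exceeded \<open>\<theta>\<close>, the rotation estimate
  would give \<open>k * norm x \<le> norm (r\<^sup>2 *\<^sub>R x + X (X x))\<close> with
  \<open>k = cos \<theta> - cos r > 0\<close>, for every \<open>x\<close>. Expanding the square
  bounds \<open>(norm (X x))\<^sup>2\<close> by
  \<open>(r\<^sup>2 - k\<^sup>2 / r\<^sup>2) * (norm x)\<^sup>2\<close>, so \<open>r\<close> could
  not be the norm.\<close>

lemma norm_le_angle:
  fixes X :: "'h::{real_inner,complete_space} op"
  assumes skew: "is_adjoint X (- X)" and X: "norm X \<le> pi" and th: "0 \<le> \<theta>" "\<theta> \<le> pi"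
    and low: "\<And>x. cos \<theta> * (norm x)\<^sup>2 \<le> op_exp X x \<bullet> x"
  shows "norm X \<le> \<theta>"
proof (rule ccontr)
  assume "\<not> norm X \<le> \<theta>"
  define r where "r = norm X"
  have r: "\<theta> < r" "0 < r" "r \<le> pi" using \<open>\<not> norm X \<le> \<theta>\<close> X th by (auto simp: r_def)
  define k where "k = cos \<theta> - cos r"
  have k: "0 < k" using cos_monotone_0_pi[of \<theta> r] th r by (simp add: k_def)
  define b where "b = max 0 (r\<^sup>2 - k\<^sup>2 / r\<^sup>2)"
  have "(norm (X x))\<^sup>2 \<le> b * (norm x)\<^sup>2" for x
  proof (cases "x = 0")
    case False
    let ?d = "norm (r\<^sup>2 *\<^sub>R x + X (X x))"
    have "k * (norm x)\<^sup>2 \<le> ?d * norm x"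
      using skew_exp_rotation_error[OF skew r(2), of x] low[of x] by (simp add: k_def algebra_simps)
    then have "k * norm x \<le> ?d" using False by (simp add: power2_eq_square)
    then have "(k * norm x)\<^sup>2 \<le> ?d\<^sup>2" using k by (intro power_mono) auto
    also have "?d\<^sup>2 = r\<^sup>2 * (r\<^sup>2 * (norm x)\<^sup>2) + 2 * r\<^sup>2 * (X (X x) \<bullet> x) + (norm (X (X x)))\<^sup>2"
      by (simp add: power2_norm_eq_inner inner_simps inner_commute algebra_simps)
    also have "X (X x) \<bullet> x = - (norm (X x))\<^sup>2"
      using is_adjointD[OF skew, of "X x" x] by (simp add: blinfun.minus_left power2_norm_eq_inner)
    also have "(norm (X (X x)))\<^sup>2 \<le> (r * norm (X x))\<^sup>2"
      unfolding r_def by (intro power_mono norm_blinfun) simp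
    finally have "k\<^sup>2 * (norm x)\<^sup>2 \<le> r\<^sup>2 * (r\<^sup>2 * (norm x)\<^sup>2 - (norm (X x))\<^sup>2)"
      by (simp add: power_mult_distrib algebra_simps)
    then have "(norm (X x))\<^sup>2 \<le> (r\<^sup>2 - k\<^sup>2 / r\<^sup>2) * (norm x)\<^sup>2"
      using r by (simp add: field_simps)
    also have "\<dots> \<le> b * (norm x)\<^sup>2" by (intro mult_right_mono) (simp_all add: b_def)
    finally show ?thesis .
  qed simp
  then have "(norm (X x))\<^sup>2 \<le> (sqrt b * norm x)\<^sup>2" for x
    by (simp add: power_mult_distrib b_def)
  then have "norm (X x) \<le> sqrt b * norm x" for x
    by (rule power2_le_imp_le) (simp add: b_def)
  then have "r \<le> sqrt b" unfolding r_def by (intro norm_blinfun_bound) (simp_all add: b_def)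
  moreover have "b < r\<^sup>2" using r k by (simp add: b_def)
  then have "sqrt b < r" using r by (intro real_less_lsqrt) (auto simp: b_def)
  ultimately show False by simp
qed

section \<open>Injectivity of the exponential and compact logarithms\<close>

text \<open>
  If \<open>u\<^sup>2 = v\<^sup>2\<close>, then \<open>D = u - v\<close> satisfies \<open>u D = - D v\<close>, hence \<open>(1 - \<epsilon>u) D = D (1 + \<epsilon>v)\<close>. For small
  \<open>\<epsilon>\<close> the left factor is a strict contraction, whereas \<open>1 + \<epsilon>v\<close> is expanding.
\<close>

lemma accretive_square_root_unique:
  fixes u v :: "'h::{real_inner,complete_space} op"
  assumes u: "orthogonal_pair u u'" and v: "orthogonal_pair v v'" and sq: "u o\<^sub>L u = v o\<^sub>L v"
    and c: "0 < c" "\<And>x. c * (norm x)\<^sup>2 \<le> u x \<bullet> x" "\<And>x. c * (norm x)\<^sup>2 \<le> v x \<bullet> x"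
  shows "u = v"
proof -
  define D where "D = u - v"
  \<comment> \<open>\<open>e \<le> c\<close> gives the contraction constant
    \<open>sqrt (1 - e\<^sup>2)\<close> of \<open>id_blinfun - e *\<^sub>R u\<close>;
    \<open>e < 1\<close> makes \<open>id_blinfun + e *\<^sub>R v\<close> invertible.\<close>
  define e where "e = min c (1/2)"
  have e: "0 < e" "e \<le> c" "e < 1" using c(1) by (auto simp: e_def)
  have uD: "u o\<^sub>L D = - (D o\<^sub>L v)" using sq by (simp add: D_def blinfun_compose_linear_simps)
  then have DD: "(id_blinfun - e *\<^sub>R u) o\<^sub>L D = D o\<^sub>L (id_blinfun + e *\<^sub>R v)"
    by (simp add: blinfun_compose_linear_simps)
  have rho: "norm (id_blinfun - e *\<^sub>R u) \<le> sqrt (1 - e\<^sup>2)"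
  proof (rule norm_blinfun_bound)
    fix x
    have "(norm (x - e *\<^sub>R u x))\<^sup>2 = (norm x)\<^sup>2 - 2 * e * (u x \<bullet> x) + e\<^sup>2 * (norm (u x))\<^sup>2"
      by (simp only: power2_norm_eq_inner) (simp add: inner_diff_left inner_diff_right inner_commute[of x "u x"] power2_eq_square algebra_simps)
    also have "\<dots> = (norm x)\<^sup>2 - 2 * e * (u x \<bullet> x) + e\<^sup>2 * (norm x)\<^sup>2" by (simp add: orthogonal_pair_norm[OF u])
    also have "\<dots> \<le> (norm x)\<^sup>2 - 2 * e * (e * (norm x)\<^sup>2) + e\<^sup>2 * (norm x)\<^sup>2"
    proof -
      have "e * (norm x)\<^sup>2 \<le> c * (norm x)\<^sup>2" using e by (intro mult_right_mono) auto
      then have "e * (norm x)\<^sup>2 \<le> u x \<bullet> x" using c(2)[of x] by linarith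
      then show ?thesis using e by simp
    qed
    also have "\<dots> = (1 - e\<^sup>2) * (norm x)\<^sup>2" by (simp add: power2_eq_square algebra_simps)
    also have "\<dots> = (sqrt (1 - e\<^sup>2) * norm x)\<^sup>2"
      using e by (simp add: power_mult_distrib abs_square_le_1)
    finally have "norm (x - e *\<^sub>R u x) \<le> sqrt (1 - e\<^sup>2) * norm x"
      using e by (elim power2_le_imp_le) (simp add: abs_square_le_1)
    then show "norm ((id_blinfun - e *\<^sub>R u) x) \<le> sqrt (1 - e\<^sup>2) * norm x"
      by (simp add: blinfun.diff_left blinfun.scaleR_left)
  qed (use e in \<open>simp add: abs_square_le_1\<close>)
  have "norm (- (e *\<^sub>R v)) \<le> e * 1"
    using orthogonal_pair_norm_le[OF v] e by (simp add: mult_left_le)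
  then have "norm (- (e *\<^sub>R v)) < 1" using e by linarith
  then obtain Z where Z: "(id_blinfun - (- (e *\<^sub>R v))) o\<^sub>L Z = id_blinfun"
    by (rule neumann_inverse)
  have "norm Z \<le> 1"
  proof (rule norm_blinfun_bound)
    fix x
    let ?y = "Z x"
    have "((id_blinfun - (- (e *\<^sub>R v))) o\<^sub>L Z) x = x" by (simp only: Z blinfun_apply_id_blinfun)
    then have x: "?y + e *\<^sub>R v ?y = x" by (simp add: blinfun.add_left blinfun.scaleR_left)
    have "(norm (?y + e *\<^sub>R v ?y))\<^sup>2 = (norm ?y)\<^sup>2 + 2 * e * (v ?y \<bullet> ?y) + e\<^sup>2 * (norm (v ?y))\<^sup>2"
      by (simp only: power2_norm_eq_inner) (simp add: inner_add_left inner_add_right inner_commute[of ?y "v ?y"] power2_eq_square algebra_simps)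
    moreover have "0 \<le> v ?y \<bullet> ?y" using c(3)[of ?y] c(1) by (smt (verit) mult_nonneg_nonneg zero_le_power2)
    ultimately have "(norm ?y)\<^sup>2 \<le> (norm x)\<^sup>2" using e x by simp
    then show "norm ?y \<le> 1 * norm x" by (simp only: mult_1) (erule power2_le_imp_le, simp)
  qed simp
  have "D = (D o\<^sub>L (id_blinfun + e *\<^sub>R v)) o\<^sub>L Z" using Z by (simp add: blinfun_compose_assoc)
  also have "\<dots> = (id_blinfun - e *\<^sub>R u) o\<^sub>L (D o\<^sub>L Z)" by (simp only: DD[symmetric] blinfun_compose_assoc)
  finally have "norm D = norm ((id_blinfun - e *\<^sub>R u) o\<^sub>L (D o\<^sub>L Z))" by simp
  also have "\<dots> \<le> sqrt (1 - e\<^sup>2) * (norm D * 1)"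
    by (intro norm_blinfun_compose_le rho order_refl \<open>norm Z \<le> 1\<close>)
  finally have "norm D \<le> sqrt (1 - e\<^sup>2) * norm D" by simp
  moreover have "sqrt (1 - e\<^sup>2) < 1" using e by simp
  ultimately have "norm D \<le> 0" by (smt (verit) mult_less_cancel_right2 norm_ge_zero)
  then show ?thesis by (simp add: D_def)
qed

text \<open>Below \<open>pi\<close> the angles of all halved exponentials are at most
  \<open>M / 2 < pi / 2\<close>, so \<open>cos (M / 2)\<close> is a common accretivity constant.
  Uniqueness of accretive roots carries the equality down to every \<open>1 / 2 ^ k\<close>, and the
  derivative at zero recovers the exponents.\<close>

lemma skew_exp_injective:
  fixes X Y :: "'h::{real_inner,complete_space} op"
  assumes X: "is_adjoint X (- X)" "norm X < pi" and Y: "is_adjoint Y (- Y)" "norm Y < pi"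
    and eq: "op_exp X = op_exp Y"
  shows "X = Y"
proof -
  have skew: "is_adjoint (a *\<^sub>R X) (- (a *\<^sub>R X))" "is_adjoint (a *\<^sub>R Y) (- (a *\<^sub>R Y))" for a
    using is_adjoint_scaleR[OF X(1), of a] is_adjoint_scaleR[OF Y(1), of a] by simp_all
  define M where "M = max (norm X) (norm Y)"
  define c where "c = cos (M / 2)"
  have M: "0 \<le> M" "M < pi" "norm X \<le> M" "norm Y \<le> M" using X(2) Y(2) by (auto simp: M_def max_def)
  then have c: "0 < c" unfolding c_def by (intro cos_gt_zero_pi) linarith+
  have low: "c * (norm x)\<^sup>2 \<le> op_exp ((1 / 2 ^ Suc k) *\<^sub>R Z) x \<bullet> x"
    if Z: "is_adjoint (a *\<^sub>R Z) (- (a *\<^sub>R Z))" "norm Z \<le> M" "a = 1 / 2 ^ Suc k" for Z x a k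
  proof -
    have "(1::real) * 2 \<le> 2 ^ Suc k" by simp
    then have "norm Z / 2 ^ Suc k \<le> norm Z / 2" by (intro divide_left_mono) auto
    then have n: "norm ((1 / 2 ^ Suc k) *\<^sub>R Z) \<le> M / 2" using Z(2) by simp
    have "c \<le> cos (norm ((1 / 2 ^ Suc k) *\<^sub>R Z))"
      unfolding c_def using n M by (intro cos_monotone_0_pi_le) auto
    then have "c * (norm x)\<^sup>2 \<le> cos (norm ((1 / 2 ^ Suc k) *\<^sub>R Z)) * (norm x)\<^sup>2"
      by (intro mult_right_mono) simp_all
    also have "\<dots> \<le> op_exp ((1 / 2 ^ Suc k) *\<^sub>R Z) x \<bullet> x"
      using n M Z(1,3) by (intro skew_exp_angle_le_norm) auto
    finally show ?thesis .
  qed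
  have "op_exp ((1 / 2 ^ k) *\<^sub>R X) = op_exp ((1 / 2 ^ k) *\<^sub>R Y)" for k :: nat
  proof (induction k)
    case (Suc k)
    have half: "op_exp ((1 / 2 ^ k) *\<^sub>R Z) = op_exp ((1 / 2 ^ Suc k) *\<^sub>R Z) o\<^sub>L op_exp ((1 / 2 ^ Suc k) *\<^sub>R Z)" for Z :: "'h op"
      using op_exp_half[of "(1 / 2 ^ k) *\<^sub>R Z"] by simp
    show ?case
      by (rule accretive_square_root_unique[OF orthogonal_pair_skew_exp[OF skew(1)] orthogonal_pair_skew_exp[OF skew(2)] _ c])
        (use Suc half low[OF skew(1) M(3) refl] low[OF skew(2) M(4) refl] in simp_all)
  qed (simp add: eq)
  then have "(\<lambda>k. (2 ^ k) *\<^sub>R (op_exp ((1 / 2 ^ k) *\<^sub>R X) - id_blinfun)) \<longlonglongrightarrow> Y"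
    using op_exp_derivative_at_zero[of Y] by simp
  then show ?thesis using op_exp_derivative_at_zero[of X] LIMSEQ_unique by blast
qed

text \<open>With \<open>v\<close> the exponential of half of \<open>Z\<close>,
  \<open>op_exp Z - 1 = (v + 1) (v - 1)\<close>. The angles of \<open>v\<close> are at most
  \<open>pi / 2\<close>, so \<open>norm (v - 1) \<le> sqrt 2 < 2\<close> and
  \<open>(v + 1) / 2 = 1 + (v - 1) / 2\<close> is invertible.\<close>

lemma compact_half_exp:
  fixes Z :: "'h::{real_inner,complete_space} op"
  assumes Z: "is_adjoint Z (- Z)" "norm Z \<le> pi" and comp: "compact_operator (op_exp Z - id_blinfun)"
  shows "compact_operator (op_exp ((1/2) *\<^sub>R Z) - id_blinfun)"
proof -
  define v where "v = op_exp ((1/2) *\<^sub>R Z)"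
  have skew: "is_adjoint ((1/2) *\<^sub>R Z) (- ((1/2) *\<^sub>R Z))" using is_adjoint_scaleR[OF Z(1), of "1/2"] by simp
  then have pair: "orthogonal_pair v (op_exp (- ((1/2) *\<^sub>R Z)))" unfolding v_def by (rule orthogonal_pair_skew_exp)
  have "0 * (norm x)\<^sup>2 \<le> v x \<bullet> x" for x
  proof -
    have "0 \<le> cos (norm ((1/2) *\<^sub>R Z))" using Z(2) norm_ge_zero[of Z] pi_gt_zero by (intro cos_ge_zero; simp; linarith)
    then have "0 \<le> cos (norm ((1/2) *\<^sub>R Z)) * (norm x)\<^sup>2" by simp
    also have "\<dots> \<le> v x \<bullet> x" unfolding v_def using Z(2) pi_gt_zero by (intro skew_exp_angle_le_norm[OF skew]; simp; linarith)
    finally show ?thesis by simp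
  qed
  then have "norm (v - id_blinfun) \<le> sqrt 2" by (rule orthogonal_pair_norm_diff_id[OF pair]) auto
  moreover have "sqrt 2 < 2" by (rule real_less_lsqrt) auto
  ultimately have "norm (- ((1/2) *\<^sub>R (v - id_blinfun))) < 1" by simp
  then obtain Y where Y: "Y o\<^sub>L (id_blinfun - (- ((1/2) *\<^sub>R (v - id_blinfun)))) = id_blinfun"
    by (rule neumann_inverse)
  have "op_exp Z - id_blinfun = 2 *\<^sub>R ((id_blinfun - (- ((1/2) *\<^sub>R (v - id_blinfun)))) o\<^sub>L (v - id_blinfun))"
    unfolding op_exp_half[of Z] v_def[symmetric]
    by (simp add: blinfun_compose_linear_simps scaleR_2 algebra_simps)
  then have "Y o\<^sub>L (op_exp Z - id_blinfun)
    = 2 *\<^sub>R ((Y o\<^sub>L (id_blinfun - (- ((1/2) *\<^sub>R (v - id_blinfun))))) o\<^sub>L (v - id_blinfun))"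
    by (simp only: blinfun_compose.scaleR_right blinfun_compose_assoc)
  also have "\<dots> = 2 *\<^sub>R (v - id_blinfun)" by (simp only: Y blinfun_compose_id)
  finally have "v - id_blinfun = (1/2) *\<^sub>R (Y o\<^sub>L (op_exp Z - id_blinfun))" by simp
  then show ?thesis
    unfolding v_def[symmetric] using comp by (simp only: compact_operator_scaleR compact_operator_compose_left)
qed

text \<open>Compactness survives each halving and the norm limit of the rescaled differences. Norm
  exactly \<open>pi\<close>, where logarithms need not be unique, is included.\<close>

lemma compact_skew_logarithm:
  fixes X :: "'h::{real_inner,complete_space} op"
  assumes X: "is_adjoint X (- X)" "norm X \<le> pi" and comp: "compact_operator (op_exp X - id_blinfun)"
  shows "compact_operator X"
proof (rule compact_operator_tendsto[OF _ op_exp_derivative_at_zero], rule compact_operator_scaleR)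
  show "compact_operator (op_exp ((1 / 2 ^ k) *\<^sub>R X) - id_blinfun)" for k :: nat
  proof (induction k)
    case (Suc k)
    have "norm X / 2 ^ k \<le> norm X / 1" by (intro divide_left_mono) auto
    then have "norm ((1 / 2 ^ k) *\<^sub>R X) \<le> pi" using X(2) by simp
    moreover have "is_adjoint ((1 / 2 ^ k) *\<^sub>R X) (- ((1 / 2 ^ k) *\<^sub>R X))"
      using is_adjoint_scaleR[OF X(1), of "1 / 2 ^ k"] by simp
    ultimately show ?case using compact_half_exp Suc by fastforce
  qed (simp add: comp)
qed

section \<open>Lagrangian subspaces and the compact orbit\<close>

lemma lagrangian_symmetriesD:
  assumes "e \<in> lagrangian_symmetries J"
  shows "is_adjoint e e" "e o\<^sub>L e = id_blinfun" "e o\<^sub>L J = - (J o\<^sub>L e)"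
  using assms by (auto simp: lagrangian_symmetries_def)

lemma lagrangian_symmetry_isometry:
  assumes "e \<in> lagrangian_symmetries J"
  shows "norm (e x) = norm x" "norm e \<le> 1"
  using isometry_norm[of e e x] isometry_norm_le[of e e] lagrangian_symmetriesD[OF assms] by auto

lemma complex_structure_square: "complex_structure J \<Longrightarrow> J o\<^sub>L J = - id_blinfun"
  by (simp add: complex_structure_def)

lemma orthogonal_projection_eq:
  assumes "subspace S" "\<And>x. blinfun_apply p x \<in> S" "\<And>x. x - blinfun_apply p x \<in> orthogonal_comp S"
  shows "orthogonal_projection S = p"
  unfolding orthogonal_projection_def
proof (rule the_equality)
  fix q :: "'a op"
  assume q: "\<forall>x. q x \<in> S \<and> x - q x \<in> orthogonal_comp S"
  show "q = p"
    by (rule blinfun_eqI) (use q assms in \<open>blast intro: orthogonal_decomposition_unique\<close>)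
qed (use assms in blast)

lemma orthogonal_operator_pair:
  assumes "orthogonal_operator u"
  obtains u' where "orthogonal_pair u u'"
proof -
  have ip: "u x \<bullet> u y = x \<bullet> y" for x y
    using assms by (simp add: orthogonal_operator_def orthogonal_transformation_def)
  have nrm: "norm (u x) = norm x" for x using ip by (simp add: norm_eq_sqrt_inner)
  have inj: "x = y" if "u x = u y" for x y
  proof -
    have "norm (u (x - y)) = 0" using that by (simp add: blinfun.diff_right)
    then show ?thesis using nrm[of "x - y"] by simp
  qed
  obtain g where g: "\<And>x. u (g x) = x"
    using assms unfolding orthogonal_operator_def surj_def by metis
  have "bounded_linear g"
  proof (rule bounded_linear_intro[of _ 1])
    show "g (x + y) = g x + g y" for x y by (rule inj) (simp add: blinfun.add_right g)
    show "g (r *\<^sub>R x) = r *\<^sub>R g x" for r x by (rule inj) (simp add: blinfun.scaleR_right g)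
    show "norm (g x) \<le> norm x * 1" for x using nrm[of "g x"] g[of x] by simp
  qed
  then have app: "blinfun_apply (Blinfun g) = g" by (rule bounded_linear_Blinfun_apply)
  have "is_adjoint u (Blinfun g)"
    using ip g by (intro is_adjointI) (metis app)
  moreover have "u o\<^sub>L Blinfun g = id_blinfun" by (rule blinfun_eqI) (simp add: app g)
  moreover have "Blinfun g o\<^sub>L u = id_blinfun" by (rule blinfun_eqI, rule inj) (simp add: app g)
  ultimately show ?thesis using that by (simp add: orthogonal_pair_def)
qed

lemma orthogonal_pair_operator:
  assumes "orthogonal_pair u u'"
  shows "orthogonal_operator u"
proof -
  have "(u o\<^sub>L u') x = x" for x using assms by (simp add: orthogonal_pair_def)
  then have "surj (blinfun_apply u)" by (metis blinfun_apply_blinfun_compose surjI)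
  then show ?thesis
    using orthogonal_pair_norm[OF assms]
    by (simp add: orthogonal_operator_def orthogonal_transformation bounded_linear.linear[OF blinfun.bounded_linear_right])
qed

lemma orthogonal_pair_compose:
  assumes "orthogonal_pair u u'" "orthogonal_pair v v'"
  shows "orthogonal_pair (u o\<^sub>L v) (v' o\<^sub>L u')"
  using assms is_adjoint_compose[of u u' v v']
  by (simp add: orthogonal_pair_def blinfun_compose_assoc compose_cancel)

text \<open>Translates the action on subspaces into conjugation of symmetries, so that the orbit can
  be handled by operators.\<close>

lemma symmetry_image:
  fixes S :: "'h::{real_inner,complete_space} set"
  assumes "closed S" "subspace S" "orthogonal_pair u u'"
  shows "symmetry (blinfun_apply u ` S) = u o\<^sub>L (symmetry S o\<^sub>L u')"
proof -
  obtain p :: "'h op" where p: "\<And>x. p x \<in> S" "\<And>x. x - p x \<in> orthogonal_comp S"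
    using projection_exists[OF assms(1,2)] by blast
  have uu': "u o\<^sub>L u' = id_blinfun" and u'u: "u' o\<^sub>L u = id_blinfun" and adj: "is_adjoint u u'"
    using assms(3) by (auto simp: orthogonal_pair_def)
  have "orthogonal_projection (blinfun_apply u ` S) = u o\<^sub>L (p o\<^sub>L u')"
  proof (rule orthogonal_projection_eq)
    show "subspace (blinfun_apply u ` S)"
      by (rule linear_subspace_image[OF bounded_linear.linear[OF blinfun.bounded_linear_right] assms(2)])
    show "(u o\<^sub>L (p o\<^sub>L u')) x \<in> blinfun_apply u ` S" for x using p(1) by simp
    fix x
    have "(u o\<^sub>L u') x = x" using uu' by simp
    then have x: "x - (u o\<^sub>L (p o\<^sub>L u')) x = u (u' x - p (u' x))" by (simp add: blinfun.diff_right)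
    have "u s \<bullet> u (u' x - p (u' x)) = 0" if "s \<in> S" for s
    proof -
      have "u s \<bullet> u (u' x - p (u' x)) = s \<bullet> (u' o\<^sub>L u) (u' x - p (u' x))"
        using is_adjointD[OF adj] by simp
      also have "\<dots> = (u' x - p (u' x)) \<bullet> s" using u'u by (simp add: inner_commute)
      also have "\<dots> = 0" using orthogonal_compD[OF p(2) that] by simp
      finally show ?thesis .
    qed
    then show "x - (u o\<^sub>L (p o\<^sub>L u')) x \<in> orthogonal_comp (blinfun_apply u ` S)"
      unfolding x by (auto simp: orthogonal_comp_def orthogonal_def)
  qed
  moreover have "orthogonal_projection S = p" using assms(2) p by (rule orthogonal_projection_eq)
  ultimately show ?thesis
    using uu' by (simp add: symmetry_def blinfun_compose_linear_simps)
qed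

text \<open>\<open>J\<close> carries \<open>L\<close> onto its orthogonal complement and, squaring
  to \<open>-1\<close>, the complement back into \<open>L\<close>. So
  \<open>J (x - p x) + J (p x)\<close> is the orthogonal decomposition of \<open>J x\<close>, which
  gives \<open>p J = J (1 - p)\<close>.\<close>

lemma lagrangian_symmetry_mem:
  fixes J :: "'h::{real_inner,complete_space} op"
  assumes J: "complex_structure J" and L: "lagrangian J L"
  shows "symmetry L \<in> lagrangian_symmetries J"
proof -
  have cl: "closed L" and sub: "subspace L" and JL: "blinfun_apply J ` L = orthogonal_comp L"
    using L by (auto simp: lagrangian_def)
  obtain p :: "'h op" where p: "\<And>x. p x \<in> L" "\<And>x. x - p x \<in> orthogonal_comp L"
    using projection_exists[OF cl sub] by blast
  have sym: "symmetry L = 2 *\<^sub>R p - id_blinfun"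
    using orthogonal_projection_eq[OF sub p] by (simp add: symmetry_def)
  have padj: "is_adjoint p p" using p by (rule projection_selfadjoint)
  have pp: "p o\<^sub>L p = p"
    by (rule blinfun_eqI) (simp add: projection_fixes[OF sub p p(1)])
  have pJ: "p o\<^sub>L J = J - (J o\<^sub>L p)"
  proof (rule blinfun_eqI)
    fix x
    obtain l where l: "l \<in> L" "x - p x = J l" using p(2)[of x] JL by blast
    have "(J o\<^sub>L J) l = - l" by (simp add: complex_structure_square[OF J] blinfun.minus_left)
    then have "J (x - p x) = - l" using l(2) by simp
    then have 1: "J (x - p x) \<in> L" using l(1) sub by (simp add: subspace_neg)
    have "J x - J (x - p x) = J (p x)" by (simp add: blinfun.diff_right)
    then have 2: "J x - J (x - p x) \<in> orthogonal_comp L" using JL p(1) by auto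
    have "p (J x) = J (x - p x)"
      by (rule orthogonal_decomposition_unique[OF sub p(1) 1 p(2) 2])
    then show "(p o\<^sub>L J) x = (J - (J o\<^sub>L p)) x" by (simp add: blinfun.diff_left blinfun.diff_right)
  qed
  have "is_adjoint (symmetry L) (symmetry L)" unfolding sym by (intro is_adjoint_intros padj)
  moreover have "symmetry L o\<^sub>L symmetry L = id_blinfun"
    unfolding sym by (simp add: blinfun_compose_linear_simps pp scaleR_2)
  moreover have "symmetry L o\<^sub>L J = - (J o\<^sub>L symmetry L)"
    unfolding sym by (simp add: blinfun_compose_linear_simps pJ scaleR_diff_right scaleR_2)
  ultimately show ?thesis by (simp add: lagrangian_symmetries_def)
qed

lemma conjugate_lagrangian_symmetry:
  assumes e: "e \<in> lagrangian_symmetries J" and u: "orthogonal_pair u u'" and uJ: "u o\<^sub>L J = J o\<^sub>L u"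
  shows "u o\<^sub>L (e o\<^sub>L u') \<in> lagrangian_symmetries J"
proof -
  note eD = lagrangian_symmetriesD[OF e]
  have uD: "is_adjoint u u'" "u o\<^sub>L u' = id_blinfun" "u' o\<^sub>L u = id_blinfun"
    using u by (auto simp: orthogonal_pair_def)
  have u'J: "J o\<^sub>L u' = u' o\<^sub>L J"
    by (rule inverse_intertwines[OF uD(3) uD(2)]) (simp add: uJ)
  have "is_adjoint (u o\<^sub>L (e o\<^sub>L u')) (u o\<^sub>L (e o\<^sub>L u'))"
    using is_adjoint_compose[OF uD(1) is_adjoint_compose[OF eD(1) is_adjoint_sym[OF uD(1)]]]
    by (simp add: blinfun_compose_assoc)
  moreover have "(u o\<^sub>L (e o\<^sub>L u')) o\<^sub>L (u o\<^sub>L (e o\<^sub>L u')) = id_blinfun"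
    by (simp add: blinfun_compose_assoc compose_cancel[OF uD(3)] compose_cancel[OF eD(2)] uD(2))
  moreover have "(u o\<^sub>L (e o\<^sub>L u')) o\<^sub>L J = - (J o\<^sub>L (u o\<^sub>L (e o\<^sub>L u')))"
  proof -
    have "e o\<^sub>L (J o\<^sub>L u') = - (J o\<^sub>L (e o\<^sub>L u'))"
      using eD(3) by (simp add: blinfun_compose.minus_left flip: blinfun_compose_assoc)
    moreover have "u o\<^sub>L (J o\<^sub>L (e o\<^sub>L u')) = J o\<^sub>L (u o\<^sub>L (e o\<^sub>L u'))" by (rule compose_swap[OF uJ])
    ultimately show ?thesis
      by (simp add: blinfun_compose_assoc blinfun_compose.minus_right flip: u'J)
  qed
  ultimately show ?thesis by (simp add: lagrangian_symmetries_def)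
qed

lemma compact_orbitE:
  fixes J :: "'h::{real_inner,complete_space} op"
  assumes L: "lagrangian J L" and S: "S \<in> compact_orbit J L"
  obtains u u' where "orthogonal_pair u u'" "u o\<^sub>L J = J o\<^sub>L u" "compact_operator (u - id_blinfun)"
    "S = blinfun_apply u ` L" "symmetry S = u o\<^sub>L (symmetry L o\<^sub>L u')"
proof -
  obtain u where u: "u \<in> compact_unitary_group J" "S = blinfun_apply u ` L"
    using S by (auto simp: compact_orbit_def)
  then obtain u' where "orthogonal_pair u u'"
    using orthogonal_operator_pair by (auto simp: compact_unitary_group_def unitary_group_def)
  moreover from this have "symmetry S = u o\<^sub>L (symmetry L o\<^sub>L u')"
    using L u(2) symmetry_image[of L u u'] by (simp add: lagrangian_def)
  ultimately show ?thesis using u that by (auto simp: compact_unitary_group_def unitary_group_def)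
qed

lemma compact_orbit_lagrangian_symmetry:
  fixes J :: "'h::{real_inner,complete_space} op"
  assumes "complex_structure J" "lagrangian J L" "S \<in> compact_orbit J L"
  shows "symmetry S \<in> lagrangian_symmetries J"
proof (rule compact_orbitE[OF assms(2,3)])
  fix u u' assume "orthogonal_pair u u'" "u o\<^sub>L J = J o\<^sub>L u" "symmetry S = u o\<^sub>L (symmetry L o\<^sub>L u')"
  then show ?thesis
    using conjugate_lagrangian_symmetry[OF lagrangian_symmetry_mem[OF assms(1,2)]] by simp
qed

text \<open>In \<open>u e u' - e = (u - 1) e u' - e u' (u - 1)\<close> each term has a compact
  factor. This is the source of compactness of \<open>w - 1\<close>.\<close>

lemma compact_orbit_symmetry_diff:
  fixes J :: "'h::{real_inner,complete_space} op"
  assumes "lagrangian J L" "S \<in> compact_orbit J L"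
  shows "compact_operator (symmetry S - symmetry L)"
proof (rule compact_orbitE[OF assms])
  fix u u' assume u: "orthogonal_pair u u'" "compact_operator (u - id_blinfun)"
    "symmetry S = u o\<^sub>L (symmetry L o\<^sub>L u')"
  let ?e = "symmetry L"
  have "?e o\<^sub>L (u' o\<^sub>L u) = ?e" using u(1) by (simp add: orthogonal_pair_def)
  then have "symmetry S - ?e = ((u - id_blinfun) o\<^sub>L (?e o\<^sub>L u')) - (?e o\<^sub>L (u' o\<^sub>L (u - id_blinfun)))"
    by (simp add: u(3) blinfun_compose_linear_simps)
  then show ?thesis
    using u(2) by (simp add: compact_operator_diff compact_operator_compose_left compact_operator_compose_right)
qed

text \<open>Since \<open>X\<close> anticommutes with \<open>\<epsilon>\<close>, \<open>e\<^sup>X \<epsilon>\<close> is the conjugate of \<open>\<epsilon>\<close> by \<open>e\<^sup>X\<^sup>/\<^sup>2\<close>.\<close>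

lemma exp_mem_compact_orbit:
  fixes J X :: "'h::{real_inner,complete_space} op"
  assumes L: "lagrangian J L" and S: "S \<in> compact_orbit J L"
    and X: "is_adjoint X (- X)" "X o\<^sub>L symmetry S = - (symmetry S o\<^sub>L X)" "X o\<^sub>L J = J o\<^sub>L X"
    and comp: "compact_operator X"
  shows "op_exp X o\<^sub>L symmetry S \<in> symmetry ` compact_orbit J L"
proof (rule compact_orbitE[OF L S])
  fix u u' assume u: "orthogonal_pair u u'" "u o\<^sub>L J = J o\<^sub>L u" "compact_operator (u - id_blinfun)"
    "symmetry S = u o\<^sub>L (symmetry L o\<^sub>L u')"
  define Y where "Y = (1/2) *\<^sub>R X"
  define v where "v = op_exp Y"
  have "is_adjoint Y (- Y)" using is_adjoint_scaleR[OF X(1), of "1/2"] by (simp add: Y_def)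
  then have v: "orthogonal_pair v (op_exp (- Y))" unfolding v_def by (rule orthogonal_pair_skew_exp)
  have vJ: "v o\<^sub>L J = J o\<^sub>L v"
    unfolding v_def using X(3)
    by (intro op_exp_intertwine[symmetric]) (simp add: Y_def blinfun_compose_linear_simps)
  have swap: "symmetry S o\<^sub>L op_exp (- Y) = v o\<^sub>L symmetry S"
    unfolding v_def using X(2) by (intro op_exp_intertwine) (simp add: Y_def blinfun_compose_linear_simps)
  have vc: "compact_operator (v - id_blinfun)"
    unfolding v_def Y_def by (intro op_exp_compact compact_operator_scaleR comp)
  have pair: "orthogonal_pair (v o\<^sub>L u) (u' o\<^sub>L op_exp (- Y))" using v u(1) by (rule orthogonal_pair_compose)
  have "(v o\<^sub>L u) o\<^sub>L J = J o\<^sub>L (v o\<^sub>L u)"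
    using vJ u(2) by (metis blinfun_compose_assoc)
  moreover have "compact_operator ((v o\<^sub>L u) - id_blinfun)"
  proof -
    have "(v o\<^sub>L u) - id_blinfun = ((v - id_blinfun) o\<^sub>L u) + (u - id_blinfun)"
      by (simp add: blinfun_compose_linear_simps)
    then show ?thesis using vc u(3) by (simp only: compact_operator_add compact_operator_compose_right)
  qed
  ultimately have "v o\<^sub>L u \<in> compact_unitary_group J"
    using orthogonal_pair_operator[OF pair] by (simp add: compact_unitary_group_def unitary_group_def)
  then have "blinfun_apply (v o\<^sub>L u) ` L \<in> compact_orbit J L" unfolding compact_orbit_def by blast
  moreover have "symmetry (blinfun_apply (v o\<^sub>L u) ` L) = op_exp X o\<^sub>L symmetry S"
  proof -
    have "symmetry (blinfun_apply (v o\<^sub>L u) ` L) = v o\<^sub>L (symmetry S o\<^sub>L op_exp (- Y))"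
      using symmetry_image[OF _ _ pair, of L] L by (simp add: lagrangian_def u(4) blinfun_compose_assoc)
    also have "\<dots> = op_exp X o\<^sub>L symmetry S"
      unfolding swap using op_exp_half[of X] by (simp add: v_def Y_def blinfun_compose_assoc)
    finally show ?thesis .
  qed
  ultimately show ?thesis by (metis imageI)
qed

section \<open>The logarithm joining two Lagrangian symmetries\<close>

text \<open>\<open>w\<close> and its inverse share the eigenspace for \<open>-1\<close>. Taking
  adjoints in \<open>w' p = - p\<close> gives \<open>p w = - p\<close>, so the eigenspace reduces
  \<open>w\<close>.\<close>

lemma eigenspace_projection:
  fixes w w' :: "'h::{real_inner,complete_space} op"
  assumes w: "orthogonal_pair w w'"
  obtains p where "is_adjoint p p" "p o\<^sub>L p = p" "w o\<^sub>L p = - p" "p o\<^sub>L w = - p"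
    "\<And>x. w x = - x \<Longrightarrow> p x = x"
proof -
  define N where "N = {x. w x = - x}"
  have "closed N" unfolding N_def by (intro closed_Collect_eq continuous_intros)
  moreover have sub: "subspace N"
    by (auto simp: N_def subspace_def blinfun.add_right blinfun.scaleR_right blinfun.zero_right)
  ultimately obtain p :: "'h op" where p: "\<And>x. p x \<in> N" "\<And>x. x - p x \<in> orthogonal_comp N"
    using projection_exists by blast
  have adj: "is_adjoint p p" using p by (rule projection_selfadjoint)
  have fixed: "p x = x" if "x \<in> N" for x using projection_fixes[OF sub p that] .
  have wp: "w o\<^sub>L p = - p"
    using p(1) by (intro blinfun_eqI) (simp add: N_def blinfun.minus_left)
  have w'p: "w' o\<^sub>L p = - p"
  proof -
    have "p = w' o\<^sub>L (w o\<^sub>L p)" using w by (simp add: orthogonal_pair_def compose_cancel)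
    then have "p = - (w' o\<^sub>L p)" by (simp add: wp blinfun_compose_linear_simps)
    then show ?thesis by (metis minus_minus)
  qed
  have "is_adjoint (w' o\<^sub>L p) (p o\<^sub>L w)"
    using w by (intro is_adjoint_compose adj) (simp add: orthogonal_pair_def is_adjoint_sym)
  then have "p o\<^sub>L w = - p"
    using is_adjoint_unique is_adjoint_minus[OF adj] unfolding w'p by blast
  moreover have "p o\<^sub>L p = p" using fixed p(1) by (intro blinfun_eqI) simp
  ultimately show ?thesis using that adj wp fixed by (simp add: N_def)
qed

text \<open>
  The operator \<open>W = w + 2p\<close> is \<open>w\<close> with its eigenvalue \<open>-1\<close> replaced by \<open>1\<close>, so it has a logarithm of
  norm below \<open>\<pi>\<close>. On the eigenspace the logarithm \<open>\<pi> J\<close> of \<open>-1\<close> has the required symmetries.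
\<close>

lemma symmetric_logarithm:
  fixes J e f :: "'h::{real_inner,complete_space} op"
  assumes J: "complex_structure J" and e: "e \<in> lagrangian_symmetries J" and f: "f \<in> lagrangian_symmetries J"
    and comp: "compact_operator (f - e)"
  obtains X where "op_exp X = f o\<^sub>L e" "is_adjoint X (- X)" "compact_operator X" "norm X \<le> pi"
    "X o\<^sub>L e = - (e o\<^sub>L X)" "X o\<^sub>L J = J o\<^sub>L X"
proof -
  note eD = lagrangian_symmetriesD[OF e] and fD = lagrangian_symmetriesD[OF f]
  have JJ: "J o\<^sub>L J = - id_blinfun" and Jadj: "is_adjoint J (- J)"
    using J by (simp_all add: complex_structure_def)
  define w where "w = f o\<^sub>L e"
  define w' where "w' = e o\<^sub>L f"
  have pair: "orthogonal_pair w w'"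
    unfolding w_def w'_def using eD fD
    by (simp add: orthogonal_pair_def is_adjoint_compose blinfun_compose_assoc compose_cancel)
  have ww': "w o\<^sub>L w' = id_blinfun" and w'w: "w' o\<^sub>L w = id_blinfun" and wadj: "is_adjoint w w'"
    using pair by (auto simp: orthogonal_pair_def)
  have "w - id_blinfun = (f - e) o\<^sub>L e" using eD(2) by (simp add: w_def blinfun_compose_linear_simps)
  then have wcomp: "compact_operator (w - id_blinfun)" using comp by (simp only: compact_operator_compose_right)
  have Jw: "J o\<^sub>L w = w o\<^sub>L J"
  proof -
    have "w o\<^sub>L J = f o\<^sub>L (e o\<^sub>L J)" by (simp add: w_def blinfun_compose_assoc)
    also have "\<dots> = - ((f o\<^sub>L J) o\<^sub>L e)" by (simp only: eD(3) blinfun_compose.minus_right blinfun_compose_assoc)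
    also have "\<dots> = J o\<^sub>L w" by (simp only: fD(3) blinfun_compose.minus_left blinfun_compose_assoc minus_minus w_def)
    finally show ?thesis by simp
  qed
  have ew: "e o\<^sub>L w = w' o\<^sub>L e" by (simp add: w_def w'_def blinfun_compose_assoc)
  have ew': "e o\<^sub>L w' = w o\<^sub>L e" by (rule inverse_intertwines[OF ww' ww' ew])
  obtain p where p: "is_adjoint p p" "p o\<^sub>L p = p" "w o\<^sub>L p = - p" "p o\<^sub>L w = - p"
    "\<And>x. w x = - x \<Longrightarrow> p x = x"
    using eigenspace_projection[OF pair] by blast
  have w'p: "w' o\<^sub>L p = - p"
  proof -
    have "p = w' o\<^sub>L (w o\<^sub>L p)" using w'w by (simp add: compose_cancel)
    then have "p = - (w' o\<^sub>L p)" by (simp add: p(3) blinfun_compose_linear_simps)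
    then show ?thesis by (metis minus_minus)
  qed
  have pw': "p o\<^sub>L w' = - p"
    using is_adjoint_unique[OF is_adjoint_compose[OF wadj p(1)]] is_adjoint_minus[OF p(1)] unfolding p(3) by blast
  have Jp: "J o\<^sub>L p = p o\<^sub>L J"
  proof -
    \<comment> \<open>\<open>J\<close> commutes with \<open>w\<close> and so preserves the
      eigenspace; the adjoint of this relation gives \<open>p J p = p J\<close>, and the two
      together give commutation. The argument for \<open>e\<close> below is the same, using that
      \<open>e\<close> exchanges \<open>w\<close> and \<open>w'\<close>.\<close>
    have 1: "p o\<^sub>L (J o\<^sub>L p) = J o\<^sub>L p"
    proof (rule blinfun_eqI)
      fix x
      have "(w o\<^sub>L (J o\<^sub>L p)) x = (J o\<^sub>L (w o\<^sub>L p)) x" using Jw by (metis blinfun_compose_assoc)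
      then have "w (J (p x)) = - J (p x)" by (simp add: p(3) blinfun.minus_left blinfun.minus_right)
      then show "(p o\<^sub>L (J o\<^sub>L p)) x = (J o\<^sub>L p) x" by (simp add: p(5))
    qed
    have "is_adjoint (p o\<^sub>L (J o\<^sub>L p)) ((p o\<^sub>L - J) o\<^sub>L p)" "is_adjoint (J o\<^sub>L p) (p o\<^sub>L - J)"
      by (intro is_adjoint_compose p(1) Jadj)+
    then have "(p o\<^sub>L - J) o\<^sub>L p = p o\<^sub>L - J" unfolding 1 by (rule is_adjoint_unique)
    then have "p o\<^sub>L (J o\<^sub>L p) = p o\<^sub>L J" by (simp add: op_ring)
    then show ?thesis using 1 by simp
  qed
  have ep: "e o\<^sub>L p = p o\<^sub>L e"
  proof -
    have 1: "p o\<^sub>L (e o\<^sub>L p) = e o\<^sub>L p"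
    proof (rule blinfun_eqI)
      fix x
      have "(w o\<^sub>L (e o\<^sub>L p)) x = (e o\<^sub>L (w' o\<^sub>L p)) x" using ew' by (metis blinfun_compose_assoc)
      then have "w (e (p x)) = - e (p x)" by (simp add: w'p blinfun.minus_left blinfun.minus_right)
      then show "(p o\<^sub>L (e o\<^sub>L p)) x = (e o\<^sub>L p) x" by (simp add: p(5))
    qed
    have "is_adjoint (p o\<^sub>L (e o\<^sub>L p)) ((p o\<^sub>L e) o\<^sub>L p)" "is_adjoint (e o\<^sub>L p) (p o\<^sub>L e)"
      by (intro is_adjoint_compose p(1) eD(1))+
    then have "(p o\<^sub>L e) o\<^sub>L p = p o\<^sub>L e" unfolding 1 by (rule is_adjoint_unique)
    then show ?thesis using 1 by (simp add: op_ring)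
  qed
  have pcomp: "compact_operator p"
  proof -
    \<comment> \<open>On the eigenspace \<open>w - id_blinfun\<close> is \<open>-2\<close>, so
      \<open>p\<close> inherits its compactness.\<close>
    have "(w - id_blinfun) o\<^sub>L p = - (2 *\<^sub>R p)" by (simp add: op_ring p(3) scaleR_2)
    then have "p = (- (1/2)) *\<^sub>R ((w - id_blinfun) o\<^sub>L p)" by simp
    moreover have "compact_operator ((- (1/2)) *\<^sub>R ((w - id_blinfun) o\<^sub>L p))"
      by (intro compact_operator_scaleR compact_operator_compose_right wcomp)
    ultimately show ?thesis by simp
  qed
  define W where "W = w + 2 *\<^sub>R p"
  define W' where "W' = w' + 2 *\<^sub>R p"
  have Wpair: "orthogonal_pair W W'"
  proof -
    have "W o\<^sub>L W' = id_blinfun" "W' o\<^sub>L W = id_blinfun"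
      unfolding W_def W'_def by (simp_all add: op_ring ww' w'w p(2,3,4) w'p pw' scaleR_2)
    moreover have "is_adjoint W W'"
      unfolding W_def W'_def by (intro is_adjoint_intros wadj p(1))
    ultimately show ?thesis by (simp add: orthogonal_pair_def)
  qed
  have Wcomp: "compact_operator (W - id_blinfun)"
  proof -
    have "W - id_blinfun = (w - id_blinfun) + 2 *\<^sub>R p" by (simp add: W_def)
    then show ?thesis using wcomp pcomp by (simp only: compact_operator_add compact_operator_scaleR)
  qed
  \<comment> \<open>\<open>W\<close> has no eigenvalue \<open>-1\<close>: since
    \<open>p W = p\<close>, a vector with \<open>W x = - x\<close> has \<open>p x = 0\<close>,
    whence \<open>w x = - x\<close>, which forces \<open>p x = x\<close>.\<close>
  have inj: "x = 0" if "(W - id_blinfun) x + 2 *\<^sub>R x = 0" for x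
  proof -
    have Wx: "W x = - x" using that by (simp add: blinfun.diff_left scaleR_2 eq_neg_iff_add_eq_0)
    have "(p o\<^sub>L W) x = p x" unfolding W_def by (simp add: op_ring p(2,4) scaleR_2)
    then have "p x = - p x" using Wx by (simp add: blinfun.minus_right)
    then have "2 *\<^sub>R p x = 0" unfolding scaleR_2 by (simp only: eq_neg_iff_add_eq_0)
    then have px: "p x = 0" by simp
    then have "w x = - x" using Wx by (simp add: W_def blinfun.add_left blinfun.scaleR_left)
    then show ?thesis using p(5) px by metis
  qed
  obtain c where c: "c > 0" "\<And>x. c * norm x \<le> norm ((W - id_blinfun) x + 2 *\<^sub>R x)"
    using compact_perturbation_bounded_below[OF Wcomp inj] by blast
  \<comment> \<open>Comes from expanding \<open>(norm (W x + x))\<^sup>2\<close> into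
    \<open>2 * (norm x)\<^sup>2 + 2 * (W x \<bullet> x)\<close>; the minimum with \<open>1\<close>
    makes \<open>a\<close> a cosine.\<close>
  define a where "a = min 1 (c\<^sup>2 / 2 - 1)"
  have a: "-1 < a" "a \<le> 1" using c(1) by (auto simp: a_def)
  have low: "a * (norm x)\<^sup>2 \<le> W x \<bullet> x" for x
  proof -
    have "c * norm x \<le> norm (W x + x)" using c(2)[of x] by (simp add: blinfun.diff_left scaleR_2)
    then have "(c * norm x)\<^sup>2 \<le> (norm (W x + x))\<^sup>2" using c(1) by (intro power_mono) auto
    also have "\<dots> = (norm (W x))\<^sup>2 + (norm x)\<^sup>2 + 2 * (W x \<bullet> x)"
      by (simp only: power2_norm_eq_inner) (simp add: inner_simps inner_commute)
    also have "\<dots> = 2 * (norm x)\<^sup>2 + 2 * (W x \<bullet> x)" by (simp add: orthogonal_pair_norm[OF Wpair])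
    finally have "(c\<^sup>2 / 2 - 1) * (norm x)\<^sup>2 \<le> W x \<bullet> x" by (simp add: power_mult_distrib algebra_simps)
    moreover have "a * (norm x)\<^sup>2 \<le> (c\<^sup>2 / 2 - 1) * (norm x)\<^sup>2" by (intro mult_right_mono) (simp_all add: a_def)
    ultimately show ?thesis by linarith
  qed
  have th: "0 \<le> arccos a" "arccos a < pi"
    using a arccos_less_arccos[of "-1" a] by (auto intro: arccos_lbound)
  have low': "cos (arccos a) * (norm x)\<^sup>2 \<le> W x \<bullet> x" for x using low a by simp
  obtain Y where Y: "op_exp Y = W" "is_adjoint Y (- Y)" "compact_operator Y" "norm Y \<le> arccos a"
    "\<And>C. C o\<^sub>L W = W o\<^sub>L C \<Longrightarrow> C o\<^sub>L Y = Y o\<^sub>L C"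
    "\<And>C. C o\<^sub>L W = W' o\<^sub>L C \<Longrightarrow> C o\<^sub>L Y = - (Y o\<^sub>L C)"
    by (rule orthogonal_logarithm[OF Wpair Wcomp th low'], rule that)
  have JY: "J o\<^sub>L Y = Y o\<^sub>L J" using Jw Jp by (intro Y(5)) (simp add: W_def op_ring)
  have pY: "p o\<^sub>L Y = Y o\<^sub>L p" using p by (intro Y(5)) (simp add: W_def op_ring)
  have eY: "e o\<^sub>L Y = - (Y o\<^sub>L e)" using ew ep by (intro Y(6)) (simp add: W_def W'_def op_ring)
  define q where "q = id_blinfun - p"
  have q: "q o\<^sub>L q = q" "p o\<^sub>L q = 0" "q o\<^sub>L p = 0" "is_adjoint q q" "q o\<^sub>L Y = Y o\<^sub>L q" "J o\<^sub>L q = q o\<^sub>L J" "e o\<^sub>L q = q o\<^sub>L e"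
    unfolding q_def using p(2) pY Jp ep
    by (simp_all add: op_ring is_adjoint_diff is_adjoint_id p(1))
  define X where "X = (Y o\<^sub>L q) + pi *\<^sub>R (J o\<^sub>L p)"
  have Xadj: "is_adjoint X (- X)"
  proof -
    have "is_adjoint X ((q o\<^sub>L - Y) + pi *\<^sub>R (p o\<^sub>L - J))"
      unfolding X_def by (intro is_adjoint_intros Y(2) q(4) p(1) Jadj)
    then show ?thesis by (simp add: X_def op_ring q(5) Jp)
  qed
  have Xcomp: "compact_operator X"
    unfolding X_def by (intro compact_operator_add compact_operator_scaleR compact_operator_compose_left
        compact_operator_compose_right Y(3) pcomp)
  have Xe: "X o\<^sub>L e = - (e o\<^sub>L X)"
  proof -
    have 1: "(Y o\<^sub>L q) o\<^sub>L e = - (e o\<^sub>L (Y o\<^sub>L q))"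
    proof -
      have "(Y o\<^sub>L q) o\<^sub>L e = (Y o\<^sub>L e) o\<^sub>L q" by (simp add: blinfun_compose_assoc q(7))
      also have "Y o\<^sub>L e = - (e o\<^sub>L Y)" by (simp add: eY)
      finally show ?thesis by (simp add: op_ring)
    qed
    have 2: "(J o\<^sub>L p) o\<^sub>L e = - (e o\<^sub>L (J o\<^sub>L p))"
    proof -
      have "(J o\<^sub>L p) o\<^sub>L e = (J o\<^sub>L e) o\<^sub>L p" by (simp add: blinfun_compose_assoc ep)
      also have "J o\<^sub>L e = - (e o\<^sub>L J)" by (simp add: eD(3))
      finally show ?thesis by (simp add: op_ring)
    qed
    show ?thesis unfolding X_def by (simp add: blinfun_compose_linear_simps 1 2)
  qed
  have XJ: "X o\<^sub>L J = J o\<^sub>L X"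
    unfolding X_def
    by (simp add: op_ring compose_swap[OF JY] flip: q(6) Jp)
  have Xnorm: "norm X \<le> pi"
  proof (rule norm_blinfun_bound)
    fix x
    \<comment> \<open>The two summands of \<open>X x\<close> lie in the ranges of \<open>q\<close>
      and \<open>p\<close>, so Pythagoras bounds the norm by the larger of \<open>norm Y\<close> and
      \<open>pi\<close>.\<close>
    have "Y (q x) \<bullet> J (p x) = 0"
    proof -
      have "(Y o\<^sub>L q) x \<bullet> (J o\<^sub>L p) x = (q o\<^sub>L Y) x \<bullet> (p o\<^sub>L J) x" by (simp only: q(5) Jp)
      also have "\<dots> = Y x \<bullet> (q o\<^sub>L p) (J x)" using is_adjointD[OF q(4)] by simp
      finally show ?thesis by (simp add: q(3))
    qed
    then have "orthogonal (Y (q x)) (pi *\<^sub>R J (p x))" by (simp add: orthogonal_def)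
    then have "(norm (Y (q x) + pi *\<^sub>R J (p x)))\<^sup>2 = (norm (Y (q x)))\<^sup>2 + (norm (pi *\<^sub>R J (p x)))\<^sup>2"
      by (rule norm_add_Pythagorean)
    moreover have "X x = Y (q x) + pi *\<^sub>R J (p x)" by (simp add: X_def blinfun.add_left blinfun.scaleR_left)
    ultimately have 1: "(norm (X x))\<^sup>2 = (norm (Y (q x)))\<^sup>2 + pi\<^sup>2 * (norm (J (p x)))\<^sup>2"
      by (simp add: power_mult_distrib)
    have "p x \<bullet> q x = x \<bullet> (p o\<^sub>L q) x" using is_adjointD[OF p(1)] by simp
    then have "p x \<bullet> q x = 0" by (simp add: q(2))
    moreover have "x = p x + q x" by (simp add: q_def blinfun.diff_left)
    ultimately have 2: "(norm x)\<^sup>2 = (norm (p x))\<^sup>2 + (norm (q x))\<^sup>2"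
      by (metis norm_add_Pythagorean orthogonal_def)
    have "norm (Y (q x)) \<le> norm Y * norm (q x)" by (rule norm_blinfun)
    also have "\<dots> \<le> pi * norm (q x)" using Y(4) th by (intro mult_right_mono) auto
    finally have "(norm (Y (q x)))\<^sup>2 \<le> (pi * norm (q x))\<^sup>2" by (intro power_mono) auto
    moreover have "norm (J (p x)) = norm (p x)" using J by (simp add: complex_structure_def)
    ultimately have "(norm (X x))\<^sup>2 \<le> (pi * norm x)\<^sup>2" using 1 2 by (simp add: power_mult_distrib algebra_simps)
    then show "norm (X x) \<le> pi * norm x" by (rule power2_le_imp_le) simp
  qed simp
  have Xexp: "op_exp X = w"
  proof -
    \<comment> \<open>Explicit candidate for \<open>op_exp (t *\<^sub>R X)\<close>: the group of
      \<open>Y\<close> on the complement, and on the eigenspace the rotation by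
      \<open>pi * t\<close> with \<open>J\<close> as imaginary unit. At \<open>t = 1\<close> it is
      \<open>W q - p = w\<close>.\<close>
    define F where "F t = (op_exp (t *\<^sub>R Y) o\<^sub>L q) + (cos (pi * t) *\<^sub>R p + sin (pi * t) *\<^sub>R (J o\<^sub>L p))" for t
    have "F 1 = op_exp (1 *\<^sub>R X) o\<^sub>L F 0"
    proof (rule op_exp_ode_unique)
      fix t :: real
      let ?E = "op_exp (t *\<^sub>R Y)"
      have d1: "((\<lambda>t. op_exp (t *\<^sub>R Y) o\<^sub>L q) has_vector_derivative ((Y o\<^sub>L ?E) o\<^sub>L q)) (at t within {0..1})"
        by (rule bounded_linear.has_vector_derivative[OF blinfun_compose.bounded_linear_left op_exp_derivative])
      have d2: "((\<lambda>t. cos (pi * t) *\<^sub>R p + sin (pi * t) *\<^sub>R (J o\<^sub>L p)) has_vector_derivative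
          ((- pi * sin (pi * t)) *\<^sub>R p + (pi * cos (pi * t)) *\<^sub>R (J o\<^sub>L p))) (at t within {0..1})"
        by (auto intro!: derivative_eq_intros simp: has_vector_derivative_def fun_eq_iff algebra_simps)
      have "(F has_vector_derivative ((Y o\<^sub>L ?E) o\<^sub>L q) + ((- pi * sin (pi * t)) *\<^sub>R p + (pi * cos (pi * t)) *\<^sub>R (J o\<^sub>L p)))
          (at t within {0..1})"
        unfolding F_def by (rule has_vector_derivative_add[OF d1 d2])
      moreover have "X o\<^sub>L F t = ((Y o\<^sub>L ?E) o\<^sub>L q) + ((- pi * sin (pi * t)) *\<^sub>R p + (pi * cos (pi * t)) *\<^sub>R (J o\<^sub>L p))"
      proof -
        have qE: "q o\<^sub>L ?E = ?E o\<^sub>L q" using q(5) by (intro op_exp_intertwine) (simp add: blinfun_compose_linear_simps)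
        have pE: "p o\<^sub>L ?E = ?E o\<^sub>L p" using pY by (intro op_exp_intertwine) (simp add: blinfun_compose_linear_simps)
        have a1: "(Y o\<^sub>L q) o\<^sub>L (?E o\<^sub>L q) = (Y o\<^sub>L ?E) o\<^sub>L q"
          by (simp add: blinfun_compose_assoc compose_swap[OF qE] q(1))
        have a2: "(Y o\<^sub>L q) o\<^sub>L p = 0" by (simp add: blinfun_compose_assoc q(3))
        have a3: "(Y o\<^sub>L q) o\<^sub>L (J o\<^sub>L p) = 0"
          by (simp add: blinfun_compose_assoc compose_swap[OF q(6)[symmetric]] q(3))
        have a4: "(J o\<^sub>L p) o\<^sub>L (?E o\<^sub>L q) = 0"
          by (simp add: blinfun_compose_assoc compose_swap[OF pE] q(2))
        have a5: "(J o\<^sub>L p) o\<^sub>L p = J o\<^sub>L p" by (simp add: blinfun_compose_assoc p(2))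
        have a6: "(J o\<^sub>L p) o\<^sub>L (J o\<^sub>L p) = - p"
        proof -
          have "(J o\<^sub>L p) o\<^sub>L (J o\<^sub>L p) = J o\<^sub>L (J o\<^sub>L (p o\<^sub>L p))"
            by (simp add: blinfun_compose_assoc compose_swap[OF Jp[symmetric]])
          also have "\<dots> = (J o\<^sub>L J) o\<^sub>L p" by (simp add: blinfun_compose_assoc p(2))
          finally show ?thesis by (simp add: JJ blinfun_compose_linear_simps)
        qed
        show ?thesis
          unfolding X_def F_def
          by (simp only: blinfun_compose_linear_simps a1 a2 a3 a4 a5 a6) (simp add: algebra_simps)
      qed
      ultimately show "(F has_vector_derivative (X o\<^sub>L F t)) (at t within {0..1})" by simp
    qed simp
    moreover have "F 0 = id_blinfun" by (simp add: F_def q_def)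
    moreover have "F 1 = w"
      by (simp add: F_def q_def Y(1) W_def op_ring p(2,3) scaleR_2)
    ultimately show ?thesis by simp
  qed
  show ?thesis using that[OF _ Xadj Xcomp Xnorm Xe XJ] Xexp by (simp add: w_def)
qed

section \<open>Geodesics\<close>

text \<open>Allows identities valid on the closed interval to be differentiated at its end points
  too, where derivatives are one-sided.\<close>

lemma vector_derivative_unique_on_unit_interval:
  fixes f g :: "real \<Rightarrow> 'a::real_normed_vector"
  assumes "t \<in> {0..1}" "(f has_vector_derivative a) (at t within {0..1})"
    "(g has_vector_derivative b) (at t within {0..1})" "\<And>s. s \<in> {0..1} \<Longrightarrow> f s = g s"
  shows "a = b"
proof -
  have "(g has_vector_derivative a) (at t within {0..1})"
    by (rule has_vector_derivative_transform[OF assms(1) _ assms(2)]) (simp add: assms(4))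
  then show ?thesis
    using vector_derivative_unique_within_closed_interval[of 0 1 t g a b] assms(1,3) by simp
qed

lemma velocity_eq:
  assumes "t \<in> {0..1}" "(\<gamma> has_vector_derivative v) (at t within {0..1})"
  shows "velocity \<gamma> t = v"
  using vector_derivative_within_cbox[of 0 1 t \<gamma> v] assms by (simp add: velocity_def)

lemma norm_compose_lagrangian_symmetry:
  assumes "e \<in> lagrangian_symmetries J"
  shows "norm (X o\<^sub>L e) = norm X"
proof (rule antisym)
  note eD = lagrangian_symmetriesD(2)[OF assms] and en = lagrangian_symmetry_isometry(2)[OF assms]
  show "norm (X o\<^sub>L e) \<le> norm X" using norm_blinfun_compose_le[OF order_refl en, of X] by simp
  have "X = (X o\<^sub>L e) o\<^sub>L e" using eD by (simp add: blinfun_compose_assoc)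
  then show "norm X \<le> norm (X o\<^sub>L e)"
    using norm_blinfun_compose_le[OF order_refl en, of "X o\<^sub>L e"] by simp
qed

lemma curve_length_constant_speed:
  assumes "\<And>t. t \<in> {0..1} \<Longrightarrow> norm (velocity \<gamma> t) = c"
  shows "curve_length \<gamma> = c"
proof -
  have "curve_length \<gamma> = integral {0..1} (\<lambda>t::real. c)"
    unfolding curve_length_def using assms by (intro integral_cong) simp
  then show ?thesis by simp
qed

lemma exp_curve_mem:
  fixes J X e :: "'h::{real_inner,complete_space} op"
  assumes e: "e \<in> lagrangian_symmetries J"
    and X: "is_adjoint X (- X)" "X o\<^sub>L e = - (e o\<^sub>L X)" "X o\<^sub>L J = J o\<^sub>L X"
  shows "op_exp (t *\<^sub>R X) o\<^sub>L e \<in> lagrangian_symmetries J"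
proof -
  note eD = lagrangian_symmetriesD[OF e]
  have swap: "e o\<^sub>L op_exp (- (t *\<^sub>R X)) = op_exp (t *\<^sub>R X) o\<^sub>L e"
    using X(2) by (intro op_exp_intertwine) (simp add: blinfun_compose_linear_simps)
  have swap': "e o\<^sub>L op_exp (t *\<^sub>R X) = op_exp (- (t *\<^sub>R X)) o\<^sub>L e"
    using X(2) by (intro op_exp_intertwine) (simp add: blinfun_compose_linear_simps)
  have "is_adjoint (op_exp (t *\<^sub>R X)) (op_exp (- (t *\<^sub>R X)))"
    using is_adjoint_scaleR[OF X(1), of t] by (intro op_exp_adjoint) simp
  from is_adjoint_compose[OF this eD(1)]
  have "is_adjoint (op_exp (t *\<^sub>R X) o\<^sub>L e) (op_exp (t *\<^sub>R X) o\<^sub>L e)" by (simp only: swap)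
  moreover have "(op_exp (t *\<^sub>R X) o\<^sub>L e) o\<^sub>L (op_exp (t *\<^sub>R X) o\<^sub>L e) = id_blinfun"
    by (simp add: blinfun_compose_assoc compose_swap[OF swap'] compose_cancel[OF op_exp_minus(2)] op_exp_minus(2) eD(2))
  moreover have "(op_exp (t *\<^sub>R X) o\<^sub>L e) o\<^sub>L J = - (J o\<^sub>L (op_exp (t *\<^sub>R X) o\<^sub>L e))"
  proof -
    have Jt: "J o\<^sub>L op_exp (t *\<^sub>R X) = op_exp (t *\<^sub>R X) o\<^sub>L J"
      using X(3) by (intro op_exp_intertwine) (simp add: blinfun_compose_linear_simps)
    show ?thesis
      by (simp add: blinfun_compose_assoc eD(3) blinfun_compose.minus_right compose_swap[OF Jt])
  qed
  ultimately show ?thesis by (simp add: lagrangian_symmetries_def)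
qed

lemma exp_curve_derivative:
  fixes X e :: "'h::{real_inner,complete_space} op"
  shows "((\<lambda>t. op_exp (t *\<^sub>R X) o\<^sub>L e) has_vector_derivative (X o\<^sub>L (op_exp (t *\<^sub>R X) o\<^sub>L e))) (at t within T)"
  using bounded_linear.has_vector_derivative[OF blinfun_compose.bounded_linear_left op_exp_derivative, of X e t T]
  by (simp add: blinfun_compose_assoc)

lemma exp_curve_length:
  fixes J X e :: "'h::{real_inner,complete_space} op"
  assumes "e \<in> lagrangian_symmetries J"
    "is_adjoint X (- X)" "X o\<^sub>L e = - (e o\<^sub>L X)" "X o\<^sub>L J = J o\<^sub>L X"
  shows "curve_length (\<lambda>t. op_exp (t *\<^sub>R X) o\<^sub>L e) = norm X"
proof (rule curve_length_constant_speed)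
  fix t :: real assume "t \<in> {0..1}"
  then have "velocity (\<lambda>t. op_exp (t *\<^sub>R X) o\<^sub>L e) t = X o\<^sub>L (op_exp (t *\<^sub>R X) o\<^sub>L e)"
    by (rule velocity_eq[OF _ exp_curve_derivative])
  then show "norm (velocity (\<lambda>t. op_exp (t *\<^sub>R X) o\<^sub>L e) t) = norm X"
    using norm_compose_lagrangian_symmetry[OF exp_curve_mem[OF assms], of X t] by simp
qed

lemma exp_curve_finite_length:
  fixes J X e :: "'h::{real_inner,complete_space} op"
  assumes "e \<in> lagrangian_symmetries J"
    "is_adjoint X (- X)" "X o\<^sub>L e = - (e o\<^sub>L X)" "X o\<^sub>L J = J o\<^sub>L X"
    and M: "\<And>t. t \<in> {0..1} \<Longrightarrow> op_exp (t *\<^sub>R X) o\<^sub>L e \<in> M"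
  shows "finite_length_curve M (\<lambda>t. op_exp (t *\<^sub>R X) o\<^sub>L e)"
proof -
  let ?\<gamma> = "\<lambda>t. op_exp (t *\<^sub>R X) o\<^sub>L e"
  have cont: "continuous_on A ?\<gamma>" for A
    unfolding continuous_on_eq_continuous_within
    by (intro ballI has_vector_derivative_continuous[OF exp_curve_derivative])
  have "?\<gamma> C1_differentiable_on {0..1}"
    unfolding C1_differentiable_on_def
    by (rule exI[of _ "\<lambda>t. X o\<^sub>L ?\<gamma> t"]) (auto intro!: exp_curve_derivative continuous_intros cont)
  then have "?\<gamma> piecewise_C1_differentiable_on {0..1}"
    by (rule C1_differentiable_imp_piecewise)
  moreover have "(\<lambda>t. norm (velocity ?\<gamma> t)) integrable_on {0..1}"
  proof (rule integrable_eq)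
    show "(\<lambda>t::real. norm X) integrable_on {0..1}" by (rule integrable_const_ivl)
    fix t :: real assume "t \<in> {0..1}"
    then have "velocity ?\<gamma> t = X o\<^sub>L ?\<gamma> t" by (rule velocity_eq[OF _ exp_curve_derivative])
    then show "norm X = norm (velocity ?\<gamma> t)"
      using norm_compose_lagrangian_symmetry[OF exp_curve_mem[OF assms(1-4)], of X t] by simp
  qed
  ultimately show ?thesis using M by (auto simp: finite_length_curve_def)
qed

text \<open>\<open>X\<close> anticommutes with every \<open>\<gamma> t\<close>, so
  \<open>X\<^sup>2\<close> commutes with it. Conjugation by \<open>\<gamma> t\<close> therefore
  fixes the second derivative \<open>X\<^sup>2 \<gamma>\<close>, and the connection projection
  annihilates it.\<close>

lemma exp_curve_geodesic:
  fixes J X e :: "'h::{real_inner,complete_space} op"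
  assumes "e \<in> lagrangian_symmetries J"
    "is_adjoint X (- X)" "X o\<^sub>L e = - (e o\<^sub>L X)" "X o\<^sub>L J = J o\<^sub>L X"
    and M: "\<And>t. t \<in> {0..1} \<Longrightarrow> op_exp (t *\<^sub>R X) o\<^sub>L e \<in> M"
  shows "geodesic M (\<lambda>t. op_exp (t *\<^sub>R X) o\<^sub>L e)"
proof -
  let ?\<gamma> = "\<lambda>t. op_exp (t *\<^sub>R X) o\<^sub>L e"
  have vel: "velocity ?\<gamma> t = X o\<^sub>L ?\<gamma> t" if "t \<in> {0..1}" for t
    using that by (rule velocity_eq[OF _ exp_curve_derivative])
  have acc: "(velocity ?\<gamma> has_vector_derivative (X o\<^sub>L (X o\<^sub>L ?\<gamma> t))) (at t within {0..1})" if t: "t \<in> {0..1}" for t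
    by (rule has_vector_derivative_transform[OF t vel
          bounded_linear.has_vector_derivative[OF blinfun_compose.bounded_linear_right exp_curve_derivative]])
  have "covariant_derivative ?\<gamma> (velocity ?\<gamma>) t = 0" if t: "t \<in> {0..1}" for t
  proof -
    have D2: "vector_derivative (velocity ?\<gamma>) (at t within {0..1}) = X o\<^sub>L (X o\<^sub>L ?\<gamma> t)"
      using vector_derivative_within_cbox[of 0 1 t] acc[OF t] t by simp
    note gg = lagrangian_symmetriesD(2)[OF exp_curve_mem[OF assms(1-4), of t]]
    have "(- X) o\<^sub>L op_exp (t *\<^sub>R X) = op_exp (t *\<^sub>R X) o\<^sub>L (- X)"
      by (intro op_exp_intertwine) (simp add: blinfun_compose_linear_simps)
    then have "op_exp (t *\<^sub>R X) o\<^sub>L X = X o\<^sub>L op_exp (t *\<^sub>R X)" by (simp add: blinfun_compose_linear_simps)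
    then have anti: "?\<gamma> t o\<^sub>L X = - (X o\<^sub>L ?\<gamma> t)"
      using assms(3) by (simp add: blinfun_compose_assoc blinfun_compose.minus_right)
        (metis blinfun_compose.minus_right blinfun_compose_assoc minus_minus)
    then have "?\<gamma> t o\<^sub>L (X o\<^sub>L (X o\<^sub>L ?\<gamma> t)) = X o\<^sub>L (X o\<^sub>L (?\<gamma> t o\<^sub>L ?\<gamma> t))"
      by (metis (no_types, opaque_lifting) blinfun_compose.minus_left blinfun_compose.minus_right blinfun_compose_assoc minus_minus)
    then have "?\<gamma> t o\<^sub>L (X o\<^sub>L (X o\<^sub>L ?\<gamma> t)) = X o\<^sub>L X"
      by (simp only: gg blinfun_compose_id)
    then have "(?\<gamma> t o\<^sub>L (X o\<^sub>L (X o\<^sub>L ?\<gamma> t))) o\<^sub>L ?\<gamma> t = X o\<^sub>L (X o\<^sub>L ?\<gamma> t)"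
      by (simp only: blinfun_compose_assoc[of X X])
    then show ?thesis
      by (simp only: covariant_derivative_def connection_projection_def D2) simp
  qed
  then show ?thesis
    using M differentiableI_vector[OF acc] differentiableI_vector[OF exp_curve_derivative, of X e]
    by (auto simp: geodesic_def differentiable_on_def)
qed

text \<open>
  Along a geodesic of symmetries \<open>X = \<gamma>' \<gamma>\<close> is constant: \<open>\<gamma> \<gamma>'' = \<gamma>'' \<gamma>\<close> by the geodesic equation,
  so differentiating \<open>\<gamma>' \<gamma> + \<gamma> \<gamma>' = 0\<close> gives \<open>\<gamma>'' \<gamma> + \<gamma>'\<^sup>2 = 0\<close>. Thus \<open>\<gamma>' = X \<gamma>\<close>.
\<close>

lemma geodesic_is_exp_curve:
  fixes J :: "'h::{real_inner,complete_space} op"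
  assumes geo: "geodesic M \<gamma>" and M: "M \<subseteq> lagrangian_symmetries J"
  obtains X where "X = velocity \<gamma> 0 o\<^sub>L \<gamma> 0" "is_adjoint X (- X)" "X o\<^sub>L \<gamma> 0 = - (\<gamma> 0 o\<^sub>L X)"
    "X o\<^sub>L J = J o\<^sub>L X" "\<And>t. t \<in> {0..1} \<Longrightarrow> \<gamma> t = op_exp (t *\<^sub>R X) o\<^sub>L \<gamma> 0" "curve_length \<gamma> = norm X"
proof -
  define D where "D = velocity \<gamma>"
  define A where "A t = vector_derivative D (at t within {0..1})" for t
  have mem: "\<gamma> t \<in> lagrangian_symmetries J" if "t \<in> {0..1}" for t
    using geo M that unfolding geodesic_def by blast
  note gD = lagrangian_symmetriesD[OF mem]
  have d1: "(\<gamma> has_vector_derivative D t) (at t within {0..1})" if "t \<in> {0..1}" for t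
    using geo that unfolding geodesic_def differentiable_on_def D_def velocity_def vector_derivative_works by blast
  have d2: "(D has_vector_derivative A t) (at t within {0..1})" if "t \<in> {0..1}" for t
    using geo that unfolding geodesic_def differentiable_on_def D_def A_def vector_derivative_works by blast
  note prod = bounded_bilinear.has_vector_derivative[OF bounded_bilinear_blinfun_compose]
  have anti: "(\<gamma> t o\<^sub>L D t) + (D t o\<^sub>L \<gamma> t) = 0" if t: "t \<in> {0..1}" for t
    by (rule vector_derivative_unique_on_unit_interval[OF t prod[OF d1[OF t] d1[OF t]] has_vector_derivative_const])
      (rule gD(2))
  have second: "((\<gamma> t o\<^sub>L A t) + (D t o\<^sub>L D t)) + ((D t o\<^sub>L D t) + (A t o\<^sub>L \<gamma> t)) = 0" if t: "t \<in> {0..1}" for t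
    by (rule vector_derivative_unique_on_unit_interval[OF t
          has_vector_derivative_add[OF prod[OF d1[OF t] d2[OF t]] prod[OF d2[OF t] d1[OF t]]]
          has_vector_derivative_const]) (rule anti)
  have comm: "\<gamma> t o\<^sub>L A t = A t o\<^sub>L \<gamma> t" if t: "t \<in> {0..1}" for t
  proof -
    have "A t = (\<gamma> t o\<^sub>L A t) o\<^sub>L \<gamma> t"
      using geo t by (simp add: geodesic_def covariant_derivative_def connection_projection_def A_def D_def)
    then show ?thesis using gD(2)[OF t] by (metis blinfun_compose_assoc blinfun_compose_id(1))
  qed
  have flat: "(D t o\<^sub>L D t) + (A t o\<^sub>L \<gamma> t) = 0" if t: "t \<in> {0..1}" for t
  proof -
    have "2 *\<^sub>R ((D t o\<^sub>L D t) + (A t o\<^sub>L \<gamma> t)) = 0"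
      using second[OF t] by (simp add: comm[OF t] scaleR_2 algebra_simps)
    then show ?thesis by simp
  qed
  have "((\<lambda>t. D t o\<^sub>L \<gamma> t) has_vector_derivative 0) (at t within {0..1})" if t: "t \<in> {0..1}" for t
    using prod[OF d2[OF t] d1[OF t]] flat[OF t] by simp
  then obtain X where X: "\<And>t. t \<in> {0..1} \<Longrightarrow> D t o\<^sub>L \<gamma> t = X"
    using has_vector_derivative_zero_constant[of "{0..1::real}" "\<lambda>t. D t o\<^sub>L \<gamma> t"] by auto
  have DX: "D t = X o\<^sub>L \<gamma> t" if t: "t \<in> {0..1}" for t
    using gD(2)[OF t] by (simp add: blinfun_compose_assoc flip: X[OF t])
  have flow: "\<gamma> t = op_exp (t *\<^sub>R X) o\<^sub>L \<gamma> 0" if "t \<in> {0..1}" for t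
    using d1 DX by (intro op_exp_ode_unique that) simp
  have 0: "(0::real) \<in> {0..1}" by simp
  have D0: "is_adjoint (D 0) (D 0)"
  proof (rule is_adjointI)
    fix x y
    have "((\<lambda>t. \<gamma> t x \<bullet> y) has_vector_derivative (D 0 x \<bullet> y)) (at 0 within {0..1})"
      by (rule bounded_linear.has_vector_derivative[OF bounded_linear_compose[OF bounded_linear_inner_left
              blinfun.bounded_linear_left] d1[OF 0]])
    moreover have "((\<lambda>t. x \<bullet> \<gamma> t y) has_vector_derivative (x \<bullet> D 0 y)) (at 0 within {0..1})"
      by (rule bounded_linear.has_vector_derivative[OF bounded_linear_compose[OF bounded_linear_inner_right
              blinfun.bounded_linear_left] d1[OF 0]])
    ultimately show "D 0 x \<bullet> y = x \<bullet> D 0 y"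
      by (rule vector_derivative_unique_on_unit_interval[OF 0]) (rule is_adjointD[OF gD(1)])
  qed
  have gDX: "\<gamma> 0 o\<^sub>L D 0 = - X" using anti[OF 0] X[OF 0] by (simp add: add_eq_0_iff2)
  have skew: "is_adjoint X (- X)"
    using is_adjoint_compose[OF D0 gD(1)[OF 0]] unfolding X[OF 0] gDX .
  have Xg: "X o\<^sub>L \<gamma> 0 = - (\<gamma> 0 o\<^sub>L X)"
  proof -
    have "\<gamma> 0 o\<^sub>L X = (\<gamma> 0 o\<^sub>L D 0) o\<^sub>L \<gamma> 0" using X[OF 0] by (simp add: blinfun_compose_assoc)
    then show ?thesis by (simp add: gDX blinfun_compose.minus_left)
  qed
  have DJ: "D 0 o\<^sub>L J = - (J o\<^sub>L D 0)"
  proof (rule vector_derivative_unique_on_unit_interval[OF 0])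
    show "((\<lambda>t. \<gamma> t o\<^sub>L J) has_vector_derivative (D 0 o\<^sub>L J)) (at 0 within {0..1})"
      by (rule bounded_linear.has_vector_derivative[OF blinfun_compose.bounded_linear_left d1[OF 0]])
    show "((\<lambda>t. - (J o\<^sub>L \<gamma> t)) has_vector_derivative (- (J o\<^sub>L D 0))) (at 0 within {0..1})"
      by (intro has_vector_derivative_minus
          bounded_linear.has_vector_derivative[OF blinfun_compose.bounded_linear_right d1[OF 0]])
  qed (rule gD(3))
  have XJ: "X o\<^sub>L J = J o\<^sub>L X"
  proof -
    have "X o\<^sub>L J = D 0 o\<^sub>L (\<gamma> 0 o\<^sub>L J)" by (simp add: blinfun_compose_assoc flip: X[OF 0])
    also have "\<dots> = - ((D 0 o\<^sub>L J) o\<^sub>L \<gamma> 0)" by (simp only: gD(3)[OF 0] blinfun_compose.minus_right blinfun_compose_assoc)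
    also have "\<dots> = J o\<^sub>L (D 0 o\<^sub>L \<gamma> 0)" by (simp only: DJ blinfun_compose.minus_left blinfun_compose_assoc minus_minus)
    finally show ?thesis by (simp only: X[OF 0])
  qed
  have len: "curve_length \<gamma> = norm X"
  proof (rule curve_length_constant_speed)
    show "norm (velocity \<gamma> t) = norm X" if t: "t \<in> {0..1}" for t
      using DX[OF t] norm_compose_lagrangian_symmetry[OF mem[OF t]] by (simp add: D_def)
  qed
  show ?thesis
    by (rule that[OF _ skew Xg XJ flow len]) (simp only: X[OF 0] flip: D_def)
qed

section \<open>Length comparison and assembly of the theorem\<close>

text \<open>A curve longer than \<open>pi\<close> needs no argument, as
  \<open>norm X \<le> pi\<close>. For a shorter one the angle between \<open>e x\<close> and
  \<open>f x\<close> is the angle between \<open>x\<close> and \<open>op_exp X x\<close>, because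
  \<open>f\<close> is symmetric and \<open>op_exp X = f o\<^sub>L e\<close>; so the length can serve
  as \<open>\<theta>\<close> in \<open>norm_le_angle\<close>.\<close>

lemma norm_logarithm_le_curve_length:
  fixes J X :: "'h::{real_inner,complete_space} op"
  assumes X: "is_adjoint X (- X)" "norm X \<le> pi" "op_exp X = f o\<^sub>L e"
    and \<delta>: "finite_length_curve M \<delta>" "joins \<delta> e f" and M: "M \<subseteq> lagrangian_symmetries J"
  shows "norm X \<le> curve_length \<delta>"
proof (cases "curve_length \<delta> \<le> pi")
  case True
  have mem: "\<delta> t \<in> lagrangian_symmetries J" if "t \<in> {0..1}" for t
    using \<delta>(1) M that unfolding finite_length_curve_def by blast
  have ends: "\<delta> 0 = e" "\<delta> 1 = f" using \<delta>(2) by (auto simp: joins_def)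
  obtain S where S: "finite S" "\<delta> C1_differentiable_on ({0..1} - S)" and cont: "continuous_on {0..1} \<delta>"
    using \<delta>(1) by (auto simp: finite_length_curve_def piecewise_C1_differentiable_on_def)
  then obtain D where D: "\<And>t. t \<in> {0..1} - S \<Longrightarrow> (\<delta> has_vector_derivative D t) (at t)"
    unfolding C1_differentiable_on_def by blast
  have int: "(\<lambda>t. norm (velocity \<delta> t)) integrable_on {0..1}" using \<delta>(1) by (simp add: finite_length_curve_def)
  have fD: "is_adjoint f f" using lagrangian_symmetriesD(1)[OF mem[of 1]] ends by simp
  show ?thesis
  proof (rule norm_le_angle[OF X(1,2) _ True])
    show "0 \<le> curve_length \<delta>" unfolding curve_length_def by (rule integral_nonneg[OF int]) simp
    fix x
    have "cos (curve_length \<delta>) * (norm x)\<^sup>2 \<le> \<delta> 0 x \<bullet> \<delta> 1 x"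
      unfolding curve_length_def
    proof (rule isometric_curve_angle[OF S(1) cont _ _ _ int])
      show "(\<delta> has_vector_derivative D t) (at t)" if "t \<in> {0<..<1} - S" for t using that by (intro D) auto
      show "norm (\<delta> t y) = norm y" if "t \<in> {0..1}" for t y
        by (rule lagrangian_symmetry_isometry(1)[OF mem[OF that]])
      show "norm (D t) \<le> norm (velocity \<delta> t)" if "t \<in> {0<..<1} - S" for t
        using velocity_eq[of t \<delta>, OF _ has_vector_derivative_at_within[OF D]] that by simp
    qed (use True in \<open>auto simp: curve_length_def\<close>)
    also have "\<delta> 0 x \<bullet> \<delta> 1 x = op_exp X x \<bullet> x"
      using is_adjointD[OF fD, of "e x" x] by (simp add: ends X(3))
    finally show "cos (curve_length \<delta>) * (norm x)\<^sup>2 \<le> op_exp X x \<bullet> x" .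
  qed
qed (use X(2) in simp)

text \<open>\<open>norm (f - e) < 2\<close> keeps the angles between \<open>e x\<close> and \<open>f x\<close> away from \<open>\<pi>\<close>.\<close>

lemma norm_logarithm_less_pi:
  fixes X :: "'h::{real_inner,complete_space} op"
  assumes X: "is_adjoint X (- X)" "norm X \<le> pi" "op_exp X = f o\<^sub>L e"
    and e: "e \<in> lagrangian_symmetries J" and close: "norm (f - e) < 2"
  shows "norm X < pi"
proof -
  have "op_exp X - id_blinfun = (f - e) o\<^sub>L e"
    using lagrangian_symmetriesD(2)[OF e] by (simp add: X(3) blinfun_compose_linear_simps)
  then have n: "norm (op_exp X - id_blinfun) = norm (f - e)" by (simp add: norm_compose_lagrangian_symmetry[OF e])
  define a where "a = 1 - (norm (f - e))\<^sup>2 / 2"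
  have "(norm (f - e))\<^sup>2 < 2\<^sup>2" using close by (intro power_strict_mono) auto
  then have a: "-1 < a" "a \<le> 1" by (auto simp: a_def)
  have "a * (norm x)\<^sup>2 \<le> op_exp X x \<bullet> x" for x
  proof -
    have "norm ((op_exp X - id_blinfun) x) \<le> norm (f - e) * norm x" using norm_blinfun n by metis
    then have "(norm (op_exp X x - x))\<^sup>2 \<le> (norm (f - e) * norm x)\<^sup>2"
      by (intro power_mono) (simp_all add: blinfun.diff_left)
    then show ?thesis
      unfolding orthogonal_pair_dist_sq[OF orthogonal_pair_skew_exp[OF X(1)]]
      by (simp add: a_def power_mult_distrib algebra_simps)
  qed
  then have "norm X \<le> arccos a"
    using a by (intro norm_le_angle[OF X(1,2)]) (auto intro: arccos_lbound arccos_ubound)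
  also have "\<dots> < pi" using arccos_less_arccos[of "-1" a] a by simp
  finally show ?thesis .
qed

theorem theorem5p5:
  fixes J :: "'h::{real_inner,complete_space} op" and L\<^sub>0 S\<^sub>0 S\<^sub>1 :: "'h set"
  assumes "complex_structure J"
    and "lagrangian J L\<^sub>0"
    and "S\<^sub>0 \<in> compact_orbit J L\<^sub>0"
    and "S\<^sub>1 \<in> compact_orbit J L\<^sub>0"
  shows
    "(\<exists>\<gamma>. minimal_geodesic (symmetry ` compact_orbit J L\<^sub>0) (symmetry S\<^sub>0) (symmetry S\<^sub>1) \<gamma>)
     \<and> (norm (symmetry S\<^sub>0 - symmetry S\<^sub>1) < 2 \<longrightarrow>
          (\<forall>\<gamma> \<delta>. minimal_geodesic (symmetry ` compact_orbit J L\<^sub>0) (symmetry S\<^sub>0) (symmetry S\<^sub>1) \<gamma> \<and>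
                 minimal_geodesic (symmetry ` compact_orbit J L\<^sub>0) (symmetry S\<^sub>0) (symmetry S\<^sub>1) \<delta> \<longrightarrow>
                 (\<forall>t\<in>{0..1}. \<gamma> t = \<delta> t)))
     \<and> (\<forall>\<gamma>. minimal_geodesic (lagrangian_symmetries J) (symmetry S\<^sub>0) (symmetry S\<^sub>1) \<gamma> \<longrightarrow>
             \<gamma> ` {0..1} \<subseteq> symmetry ` compact_orbit J L\<^sub>0)
     \<and> (\<forall>\<gamma>. geodesic (lagrangian_symmetries J) \<gamma> \<and> joins \<gamma> (symmetry S\<^sub>0) (symmetry S\<^sub>1) \<and>
             velocity \<gamma> 0 \<in> orbit_tangent_space J (symmetry S\<^sub>0) \<longrightarrow>
             \<gamma> ` {0..1} \<subseteq> symmetry ` compact_orbit J L\<^sub>0)"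
proof -
  let ?O = "symmetry ` compact_orbit J L\<^sub>0" and ?\<Lambda> = "lagrangian_symmetries J"
  let ?e = "symmetry S\<^sub>0" and ?f = "symmetry S\<^sub>1"
  have sub: "?O \<subseteq> ?\<Lambda>" using compact_orbit_lagrangian_symmetry[OF assms(1,2)] by blast
  have e: "?e \<in> ?\<Lambda>" and f: "?f \<in> ?\<Lambda>" using sub assms(3,4) by auto
  have "?f - ?e = (?f - symmetry L\<^sub>0) - (?e - symmetry L\<^sub>0)" by simp
  then have comp: "compact_operator (?f - ?e)"
    using compact_orbit_symmetry_diff[OF assms(2,3)] compact_orbit_symmetry_diff[OF assms(2,4)]
    by (metis compact_operator_diff)
  obtain Z where Z: "op_exp Z = ?f o\<^sub>L ?e" "is_adjoint Z (- Z)" "compact_operator Z" "norm Z \<le> pi"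
    "Z o\<^sub>L ?e = - (?e o\<^sub>L Z)" "Z o\<^sub>L J = J o\<^sub>L Z"
    by (rule symmetric_logarithm[OF assms(1) e f comp])
  have in_orbit: "op_exp (t *\<^sub>R X) o\<^sub>L ?e \<in> ?O"
    if X: "is_adjoint X (- X)" "X o\<^sub>L ?e = - (?e o\<^sub>L X)" "X o\<^sub>L J = J o\<^sub>L X" "compact_operator X" for X t
  proof (rule exp_mem_compact_orbit[OF assms(2,3)])
    show "is_adjoint (t *\<^sub>R X) (- (t *\<^sub>R X))" using is_adjoint_scaleR[OF X(1), of t] by simp
  qed (use X in \<open>simp_all add: blinfun_compose_linear_simps compact_operator_scaleR\<close>)
  define \<zeta> where "\<zeta> = (\<lambda>t. op_exp (t *\<^sub>R Z) o\<^sub>L ?e)"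
  have \<zeta>_mem: "op_exp (t *\<^sub>R Z) o\<^sub>L ?e \<in> ?O" for t by (rule in_orbit[OF Z(2,5,6,3)])
  have \<zeta>_joins: "joins \<zeta> ?e ?f"
    using lagrangian_symmetriesD(2)[OF e] by (simp add: joins_def \<zeta>_def Z(1) blinfun_compose_assoc)
  have \<zeta>_len: "curve_length \<zeta> = norm Z" unfolding \<zeta>_def by (rule exp_curve_length[OF e Z(2,5,6)])
  have \<zeta>_finite: "finite_length_curve ?O \<zeta>"
    unfolding \<zeta>_def by (rule exp_curve_finite_length[OF e Z(2,5,6) \<zeta>_mem])
  then have \<zeta>_finite': "finite_length_curve ?\<Lambda> \<zeta>" using sub unfolding finite_length_curve_def by blast
  have "geodesic ?O \<zeta>" unfolding \<zeta>_def by (rule exp_curve_geodesic[OF e Z(2,5,6) \<zeta>_mem])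
  moreover have "curve_length \<zeta> \<le> curve_length \<delta>" if "finite_length_curve ?O \<delta>" "joins \<delta> ?e ?f" for \<delta>
    unfolding \<zeta>_len by (rule norm_logarithm_le_curve_length[OF Z(2,4,1) that sub])
  ultimately have exist: "minimal_geodesic ?O ?e ?f \<zeta>"
    using \<zeta>_joins by (simp add: minimal_geodesic_def)
  \<comment> \<open>Stated for any \<open>M\<close> because it is used for the orbit (uniqueness)
    and for all Lagrangian symmetries (convexity). Comparison with \<open>\<zeta>\<close>, itself a
    curve in \<open>M\<close>, gives \<open>norm X \<le> norm Z \<le> pi\<close>.\<close>
  have shape: "\<exists>X. is_adjoint X (- X) \<and> norm X \<le> pi \<and> op_exp X = ?f o\<^sub>L ?e \<and> X o\<^sub>L ?e = - (?e o\<^sub>L X) \<and>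
      X o\<^sub>L J = J o\<^sub>L X \<and> (\<forall>t\<in>{0..1}. \<gamma> t = op_exp (t *\<^sub>R X) o\<^sub>L ?e)"
    if min: "minimal_geodesic M ?e ?f \<gamma>" and M: "M \<subseteq> ?\<Lambda>" and \<zeta>M: "finite_length_curve M \<zeta>" for M \<gamma>
  proof -
    have geo: "geodesic M \<gamma>" and ends: "\<gamma> 0 = ?e" "\<gamma> 1 = ?f"
      using min by (auto simp: minimal_geodesic_def joins_def)
    obtain X where X: "is_adjoint X (- X)" "X o\<^sub>L \<gamma> 0 = - (\<gamma> 0 o\<^sub>L X)" "X o\<^sub>L J = J o\<^sub>L X"
      "\<And>t. t \<in> {0..1} \<Longrightarrow> \<gamma> t = op_exp (t *\<^sub>R X) o\<^sub>L \<gamma> 0" "curve_length \<gamma> = norm X"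
      using geodesic_is_exp_curve[OF geo M] by metis
    have "curve_length \<gamma> \<le> curve_length \<zeta>" using min \<zeta>M \<zeta>_joins by (simp add: minimal_geodesic_def)
    then have "norm X \<le> pi" using X(5) \<zeta>_len Z(4) by simp
    moreover have "op_exp X = ?f o\<^sub>L ?e"
      using X(4)[of 1] ends lagrangian_symmetriesD(2)[OF e] by (simp add: blinfun_compose_assoc)
    ultimately show ?thesis using X ends by auto
  qed
  have unique: "\<gamma> t = \<delta> t"
    if close: "norm (?e - ?f) < 2" and mins: "minimal_geodesic ?O ?e ?f \<gamma>" "minimal_geodesic ?O ?e ?f \<delta>" and t: "t \<in> {0..1}" for \<gamma> \<delta> t
  proof -
    obtain X where X: "is_adjoint X (- X)" "norm X \<le> pi" "op_exp X = ?f o\<^sub>L ?e"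
      "\<forall>t\<in>{0..1}. \<gamma> t = op_exp (t *\<^sub>R X) o\<^sub>L ?e" using shape[OF mins(1) sub \<zeta>_finite] by blast
    obtain Y where Y: "is_adjoint Y (- Y)" "norm Y \<le> pi" "op_exp Y = ?f o\<^sub>L ?e"
      "\<forall>t\<in>{0..1}. \<delta> t = op_exp (t *\<^sub>R Y) o\<^sub>L ?e" using shape[OF mins(2) sub \<zeta>_finite] by blast
    have close': "norm (?f - ?e) < 2" using close by (simp add: norm_minus_commute)
    have "X = Y"
      by (rule skew_exp_injective[OF X(1) norm_logarithm_less_pi[OF X(1,2,3) e close']
            Y(1) norm_logarithm_less_pi[OF Y(1,2,3) e close']]) (simp only: X(3) Y(3))
    then show ?thesis using X(4) Y(4) t by simp
  qed
  have convex: "\<gamma> ` {0..1} \<subseteq> ?O" if min: "minimal_geodesic ?\<Lambda> ?e ?f \<gamma>" for \<gamma>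
  proof -
    obtain X where X: "is_adjoint X (- X)" "norm X \<le> pi" "op_exp X = ?f o\<^sub>L ?e" "X o\<^sub>L ?e = - (?e o\<^sub>L X)"
      "X o\<^sub>L J = J o\<^sub>L X" "\<forall>t\<in>{0..1}. \<gamma> t = op_exp (t *\<^sub>R X) o\<^sub>L ?e"
      using shape[OF min order_refl \<zeta>_finite'] by blast
    \<comment> \<open>\<open>X\<close> may differ from the compact \<open>Z\<close>, but the two
      have the same exponential.\<close>
    have "compact_operator (op_exp X - id_blinfun)" using op_exp_compact[OF Z(3)] by (simp add: X(3) Z(1))
    then have "compact_operator X" by (rule compact_skew_logarithm[OF X(1,2)])
    then show ?thesis using X(6) in_orbit[OF X(1,4,5)] by auto
  qed
  have tangent: "\<gamma> ` {0..1} \<subseteq> ?O"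
    if geo: "geodesic ?\<Lambda> \<gamma>" "joins \<gamma> ?e ?f" "velocity \<gamma> 0 \<in> orbit_tangent_space J ?e" for \<gamma>
  proof -
    have ends: "\<gamma> 0 = ?e" using geo(2) by (simp add: joins_def)
    obtain X where X: "X = velocity \<gamma> 0 o\<^sub>L \<gamma> 0" "is_adjoint X (- X)" "X o\<^sub>L \<gamma> 0 = - (\<gamma> 0 o\<^sub>L X)"
      "X o\<^sub>L J = J o\<^sub>L X" "\<And>t. t \<in> {0..1} \<Longrightarrow> \<gamma> t = op_exp (t *\<^sub>R X) o\<^sub>L \<gamma> 0"
      using geodesic_is_exp_curve[OF geo(1) order_refl] by metis
    \<comment> \<open>No length bound is available here; instead \<open>X\<close> is the compact
      initial velocity composed with \<open>\<gamma> 0\<close>.\<close>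
    have "compact_operator X"
      using geo(3) unfolding X(1) orbit_tangent_space_def by (intro compact_operator_compose_right) blast
    then show ?thesis using X in_orbit[of X] ends by auto
  qed
  show ?thesis using exist unique convex tangent by blast
qed

end
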